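(* If $\alpha<1$ then the correlation length condition (CL) holds.
   Context: Setting: fix an integer $d\geq 1$, a real $\alpha>0$, a norm $\|\cdot\|$ on $\mathbb{R}^d$, and a kernel of the form $J(x,y)=\mathbf{1}(x\neq y)J(\|x-y\|)$ for $x,y\in\mathbb{Z}^d$, where $J:(0,\infty)\to(0,\infty)$ is decreasing and differentiable, tends to $0$ at infinity (so that $J(x,y)\sim \mathrm{const.}\,\|x-y\|^{-d-\alpha}$), and satisfies $|J'(r)|=C(1+\delta_r)r^{-d-\alpha-1}$ for some constant $C>0$ and some measurable error function $r\mapsto\delta_r$ with $\delta_r\to0$ as $r\to\infty$ and $\int_{r_0}^\infty \frac{|\delta_r|}{r}\,dr<\infty$ for some $r_0<\infty$. Long-range percolation with parameter $\beta\ge 0$ is the random graph on $\mathbb{Z}^d$ in which each pair of distinct vertices $x,y$ is joined by an (open) edge independently with probability $1-e^{-\beta J(x,y)}$; $\mathbb{P}_\beta$ denotes its law. The critical point is $\beta_c=\inf\{\beta\ge0:\mathbb{P}_\beta(\text{there is an infinite cluster})>0\}$, where clusters are connected components. $K$ denotes the cluster of the origin. Cut-off measures: for $r>0$ let $J_r(x,y)=\mathbf{1}(x\neq y,\|x-y\|\le r)\int_{\|x-y\|}^r|J'(s)|\,ds$, and let $\mathbb{P}_{\beta,r},\mathbb{E}_{\beta,r}$ denote the law and expectation of long-range percolation with kernel $J_r$ at parameter $\beta$. $\beta_c$ always denotes the critical point of the original kernel $J$. For $p>0$ define the $L^p$ radius of gyration $\xi_p(\beta_c,r)=\left[\mathbb{E}_{\beta_c,r}\left[\sum_{x\in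 K}\|x\|_2^p\right]/\mathbb{E}_{\beta_c,r}|K|\right]^{1/p}$. Condition (CL): $\beta_c<\infty$ and for each $p>0$ there exists a constant $C_p<\infty$ such that $\xi_p(\beta_c,r)\le C_p r$ for every $r\ge1$. *)

theory Defs
  imports "HOL-Probability.Probability"
begin

section \<open>Norms and kernels\<close>

definition is_norm :: "('a::real_vector \<Rightarrow> real) \<Rightarrow> bool" where
  "is_norm N \<longleftrightarrow>
     (\<forall>x. 0 \<le> N x) \<and> (\<forall>x. N x = 0 \<longleftrightarrow> x = 0) \<and>
     (\<forall>a x. N (a *\<^sub>R x) = \<bar>a\<bar> * N x) \<and>
     (\<forall>x y. N (x + y) \<le> N x + N y)"

definition lattice_point :: "int ^ 'd \<Rightarrow> real ^ 'd" where
  "lattice_point x = (\<chi> i. real_of_int (x $ i))"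

text \<open>Only the values of the radial function on the positive half-line are constrained
  (and used).  "Decreasing" is not required to be strict.\<close>

definition admissible_kernel :: "nat \<Rightarrow> real \<Rightarrow> (real \<Rightarrow> real) \<Rightarrow> bool" where
  "admissible_kernel d \<alpha> J \<longleftrightarrow>
     (\<forall>r>0. J r > 0) \<and>
     antimono_on {0<..} J \<and>
     (\<forall>r>0. J differentiable (at r)) \<and>
     (J \<longlongrightarrow> 0) at_top \<and>
     (\<exists>C>0. \<exists>\<delta>.
        set_borel_measurable borel {0<..} \<delta> \<and>
        (\<forall>r>0. \<bar>deriv J r\<bar> = C * (1 + \<delta> r) * r powr (- real d - \<alpha> - 1)) \<and>
        (\<delta> \<longlongrightarrow> 0) at_top \<and>
        (\<exists>r0>0. set_integrable lborel {r0..} (\<lambda>r. \<bar>\<delta> r\<bar> / r)))"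

definition lattice_kernel ::
    "(real ^ 'd \<Rightarrow> real) \<Rightarrow> (real \<Rightarrow> real) \<Rightarrow> int ^ 'd \<Rightarrow> int ^ 'd \<Rightarrow> real" where
  "lattice_kernel N J x y =
     (if x \<noteq> y then J (N (lattice_point x - lattice_point y)) else 0)"

definition cutoff_kernel ::
    "(real ^ 'd \<Rightarrow> real) \<Rightarrow> (real \<Rightarrow> real) \<Rightarrow> real \<Rightarrow> int ^ 'd \<Rightarrow> int ^ 'd \<Rightarrow> real" where
  "cutoff_kernel N J r x y =
     (let \<rho> = N (lattice_point x - lattice_point y) in
      if x \<noteq> y \<and> \<rho> \<le> r then (LINT s:{\<rho>..r}|lborel. \<bar>deriv J s\<bar>) else 0)"

section \<open>Percolation\<close>

text \<open>Edges are two-element sets of vertices; a symmetric kernel descends to them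
  (\<open>edge_weight_pair\<close>), and both kernels above are symmetric.\<close>

definition edge_weight :: "('v \<Rightarrow> 'v \<Rightarrow> real) \<Rightarrow> 'v set \<Rightarrow> real" where
  "edge_weight k e = (THE w. \<exists>x y. e = {x, y} \<and> w = k x y)"

lemma edge_weight_pair:
  assumes "\<And>x y. k x y = k y x"
  shows "edge_weight k {x, y} = k x y"
  unfolding edge_weight_def using assms by (intro the_equality) (auto simp: doubleton_eq_iff)

lemma is_norm_minus_commute:
  assumes "is_norm N" shows "N (x - y) = N (y - x)"
proof -
  have "N ((-1) *\<^sub>R (y - x)) = \<bar>-1\<bar> * N (y - x)"
    using assms unfolding is_norm_def by blast
  then show ?thesis by simp
qed

lemma lattice_kernel_commute:
  assumes "is_norm N" shows "lattice_kernel N J x y = lattice_kernel N J y x"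
  by (auto simp: lattice_kernel_def
      is_norm_minus_commute[OF assms, of "lattice_point x" "lattice_point y"])

lemma cutoff_kernel_commute:
  assumes "is_norm N" shows "cutoff_kernel N J r x y = cutoff_kernel N J r y x"
  by (auto simp: cutoff_kernel_def Let_def
      is_norm_minus_commute[OF assms, of "lattice_point x" "lattice_point y"])

definition percolation :: "('v \<Rightarrow> 'v \<Rightarrow> real) \<Rightarrow> real \<Rightarrow> ('v set \<Rightarrow> bool) measure" where
  "percolation k \<beta> =
     (\<Pi>\<^sub>M e \<in> {e. card e = 2}.
        measure_pmf (bernoulli_pmf (1 - exp (- \<beta> * edge_weight k e))))"

lemma prob_space_percolation: "prob_space (percolation k \<beta>)"
  unfolding percolation_def by (intro prob_space_PiM measure_pmf.prob_space_axioms)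

definition cluster :: "('v set \<Rightarrow> bool) \<Rightarrow> 'v \<Rightarrow> 'v set" where
  "cluster \<omega> x = {y. (x, y) \<in> {(u, v). u \<noteq> v \<and> \<omega> {u, v}}\<^sup>*}"

text \<open>The infimum is taken in the extended reals, so it is \<open>\<infinity>\<close> if there is no
  percolation at any parameter.\<close>

definition critical_point :: "('v \<Rightarrow> 'v \<Rightarrow> real) \<Rightarrow> ereal" where
  "critical_point k =
     Inf {ereal \<beta> | \<beta>. 0 \<le> \<beta> \<and>
       measure (percolation k \<beta>)
         {\<omega> \<in> space (percolation k \<beta>). \<exists>x. infinite (cluster \<omega> x)} > 0}"

section \<open>Radius of gyration\<close>

definition expected_cluster_size :: "(int ^ 'd \<Rightarrow> int ^ 'd \<Rightarrow> real) \<Rightarrow> real \<Rightarrow> ennreal" where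
  "expected_cluster_size k \<beta> =
     (\<integral>\<^sup>+ \<omega>. emeasure (count_space UNIV) (cluster \<omega> 0) \<partial>percolation k \<beta>)"

definition expected_cluster_moment ::
    "(int ^ 'd \<Rightarrow> int ^ 'd \<Rightarrow> real) \<Rightarrow> real \<Rightarrow> real \<Rightarrow> ennreal" where
  "expected_cluster_moment k \<beta> p =
     (\<integral>\<^sup>+ \<omega>. (\<integral>\<^sup>+ x. ennreal (norm (lattice_point x) powr p) \<partial>count_space (cluster \<omega> 0))
        \<partial>percolation k \<beta>)"

text \<open>With the conventions of \<^typ>\<open>ennreal\<close> the quotient \<open>\<infinity> / \<infinity>\<close> would be 0.  The radius
  is set to \<open>\<infinity>\<close> instead, so that an upper bound on it includes the finiteness
  of both expectations.\<close>

definition gyration_radius ::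
    "(int ^ 'd \<Rightarrow> int ^ 'd \<Rightarrow> real) \<Rightarrow> real \<Rightarrow> real \<Rightarrow> ennreal" where
  "gyration_radius k \<beta> p =
     (if expected_cluster_size k \<beta> = \<infinity> \<or> expected_cluster_moment k \<beta> p = \<infinity> then \<infinity>
      else ennreal ((enn2real (expected_cluster_moment k \<beta> p) /
                     enn2real (expected_cluster_size k \<beta>)) powr (1 / p)))"

definition correlation_length_condition ::
    "(real ^ 'd \<Rightarrow> real) \<Rightarrow> (real \<Rightarrow> real) \<Rightarrow> bool" where
  "correlation_length_condition N J \<longleftrightarrow>
     (let \<beta>c = critical_point (lattice_kernel N J) in
      \<beta>c < \<infinity> \<and>
      (\<forall>p>0. \<exists>C::real. \<forall>r\<ge>1.
         gyration_radius (cutoff_kernel N J r) (real_of_ereal \<beta>c) p \<le> ennreal (C * r)))"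

end

theory Submission
  imports Defs
begin

text \<open>Write \<open>a = d + \<alpha>\<close>.  A box of side \<open>n\<close> containing, with high probability, a cluster of
  size \<open>m\<close> with \<open>\<beta> m\<^sup>2 \<ge> L n\<^sup>a\<close> for a large constant \<open>L\<close> starts a renormalisation that produces an
  infinite cluster.  With \<open>n = m = 1\<close> this gives \<open>\<beta>\<^sub>c < \<infinity>\<close>, and by continuity in \<open>\<beta>\<close> it shows that
  at \<open>\<beta>\<^sub>c\<close> the largest cluster of a box has size \<open>O(n\<^sup>a\<^sup>/\<^sup>2)\<close> with probability bounded below.  Splitting
  a cluster of size \<open>3m\<close> into two edge-disjoint ones of size \<open>m\<close> and applying the van den
  Berg--Kesten inequality turns this into a rapidly decaying tail.  If the sum of squared cluster
  sizes for the cut-off kernel were much larger than \<open>n\<^sup>a\<close>, then sprinkling the edges lost by the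
  cut-off would create a too large cluster; hence its expectation is \<open>O(n\<^sup>a)\<close> and the expected cluster
  size inside a box of side \<open>n \<ge> r\<close> is \<open>O(n\<^sup>\<alpha>)\<close>.

  For \<open>\<alpha> < 1\<close> the total \<open>r\<close>-cut-off weight across the boundary of a box of side \<open>n = A r\<close> is
  \<open>O(n\<^sup>d\<^sup>-\<^sup>1 r\<^sup>1\<^sup>-\<^sup>\<alpha>)\<close>, so, averaged over the position of the origin in the box, the expected number of
  open edges leaving the box from the cluster of the origin is \<open>O(A\<^sup>\<alpha>\<^sup>-\<^sup>1)\<close>, at most \<open>1/2\<close> for
  large \<open>A\<close>.  Iterating the Simon--Lieb inequality with such boxes gives exponential decay on the
  scale \<open>r\<close>, which controls all moments.\<close>

text \<open>All estimates are made in finite volume; the product measure is reached only through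
  events of finitely many edges and monotone limits over cubes. Edges carry rates instead of
  probabilities, because independent configurations then superpose by adding rates and sprinkling
  amounts to a comparison of weights. The sprinkling budget is supplied by the cut-off itself: in a
  box of side \<open>n \<ge> r\<close> every edge loses a weight of order \<open>n\<close> to the
  power \<open>- (d + \<alpha>)\<close>, the inverse square of the cluster size that is critical for
  this box. So what is known at the critical point about the full kernel can be spent on the
  truncated one, with constants uniform in \<open>r\<close>. The condition
  \<open>\<alpha> < 1\<close> acts at the boundary of a box: weight times displacement, summed over
  edges up to length \<open>r\<close>, is then dominated by the longest edges, and large boxes gain
  a power of \<open>r / n\<close>. Finally, the radius of gyration is a ratio, and no sharp value of
  the mean cluster size is available; the moments are therefore bounded by a multiple of that mean
  itself, which cancels.\<close>

text \<open>\<open>bern E w F\<close> is the expectation of \<open>F\<close> when each edge \<open>e\<close> of the finite set \<open>E\<close> is open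
  independently with probability \<open>1 - exp (- w e)\<close>.\<close>

definition bern :: "'e set \<Rightarrow> ('e \<Rightarrow> real) \<Rightarrow> ('e set \<Rightarrow> real) \<Rightarrow> real" where
  "bern E w F = (\<Sum>\<omega>\<in>Pow E. (\<Prod>e\<in>\<omega>. 1 - exp (- w e)) * (\<Prod>e\<in>E - \<omega>. exp (- w e)) * F \<omega>)"

section \<open>Finite Bernoulli expectations\<close>

lemma bern_empty [simp]: "bern {} w F = F {}"
  by (simp add: bern_def)

lemma bern_insert:
  assumes "finite E" "e \<notin> E"
  shows "bern (insert e E) w F =
    exp (- w e) * bern E w F + (1 - exp (- w e)) * bern E w (\<lambda>\<omega>. F (insert e \<omega>))"
proof -
  have inj: "inj_on (insert e) (Pow E)"
    using assms by (auto simp: inj_on_def)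
  have disj: "Pow E \<inter> insert e ` Pow E = {}"
    using assms by auto
  have fin: "finite \<omega>" if "\<omega> \<subseteq> E" for \<omega> using that assms finite_subset by blast
  let ?g = "\<lambda>E \<omega>. (\<Prod>e\<in>\<omega>. 1 - exp (- w e)) * (\<Prod>e\<in>E - \<omega>. exp (- w e))"
  have 1: "?g (insert e E) \<omega> = exp (- w e) * ?g E \<omega>" if "\<omega> \<subseteq> E" for \<omega>
  proof -
    have "insert e E - \<omega> = insert e (E - \<omega>)" using that assms by auto
    then show ?thesis using assms by simp
  qed
  have 2: "?g (insert e E) (insert e \<omega>) = (1 - exp (- w e)) * ?g E \<omega>" if "\<omega> \<subseteq> E" for \<omega>
  proof -
    have "insert e E - insert e \<omega> = E - \<omega>" "e \<notin> \<omega>" using that assms by auto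
    then show ?thesis using assms fin[OF that] by simp
  qed
  have "bern (insert e E) w F =
     (\<Sum>\<omega>\<in>Pow E. ?g (insert e E) \<omega> * F \<omega>) + (\<Sum>\<omega>\<in>insert e ` Pow E. ?g (insert e E) \<omega> * F \<omega>)"
    unfolding bern_def Pow_insert using assms disj by (subst sum.union_disjoint) auto
  also have "(\<Sum>\<omega>\<in>insert e ` Pow E. ?g (insert e E) \<omega> * F \<omega>)
      = (\<Sum>\<omega>\<in>Pow E. ?g (insert e E) (insert e \<omega>) * F (insert e \<omega>))"
    by (subst sum.reindex[OF inj]) simp
  also have "\<dots> = (1 - exp (- w e)) * bern E w (\<lambda>\<omega>. F (insert e \<omega>))"
    unfolding bern_def sum_distrib_left by (intro sum.cong refl) (subst 2, auto)
  also have "(\<Sum>\<omega>\<in>Pow E. ?g (insert e E) \<omega> * F \<omega>) = exp (- w e) * bern E w F"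
    unfolding bern_def sum_distrib_left by (intro sum.cong refl) (subst 1, auto)
  finally show ?thesis .
qed

lemma bern_cong:
  assumes "\<And>e. e \<in> E \<Longrightarrow> w e = w' e" "\<And>\<omega>. \<omega> \<subseteq> E \<Longrightarrow> F \<omega> = G \<omega>"
  shows "bern E w F = bern E w' G"
proof -
  have "(\<Prod>e\<in>\<omega>. 1 - exp (- w e)) = (\<Prod>e\<in>\<omega>. 1 - exp (- w' e))"
    "(\<Prod>e\<in>E - \<omega>. exp (- w e)) = (\<Prod>e\<in>E - \<omega>. exp (- w' e))" if "\<omega> \<subseteq> E" for \<omega>
    using that assms(1) by (auto intro!: prod.cong)
  then show ?thesis unfolding bern_def using assms(2) by (intro sum.cong refl) auto
qed

lemma bern_add: "bern E w (\<lambda>\<omega>. F \<omega> + G \<omega>) = bern E w F + bern E w G"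
  by (simp add: bern_def algebra_simps sum.distrib)

lemma bern_diff: "bern E w (\<lambda>\<omega>. F \<omega> - G \<omega>) = bern E w F - bern E w G"
  by (simp add: bern_def algebra_simps sum_subtractf)

lemma bern_cmult: "bern E w (\<lambda>\<omega>. c * F \<omega>) = c * bern E w F"
  by (simp add: bern_def algebra_simps sum_distrib_left)

lemma bern_multc: "bern E w (\<lambda>\<omega>. F \<omega> * c) = bern E w F * c"
  by (simp add: bern_def algebra_simps sum_distrib_left)

lemma bern_sum: "bern E w (\<lambda>\<omega>. \<Sum>i\<in>I. F i \<omega>) = (\<Sum>i\<in>I. bern E w (F i))"
  unfolding bern_def sum_distrib_left by (rule sum.swap)

lemma bern_const [simp]: "finite E \<Longrightarrow> bern E w (\<lambda>\<omega>. c) = c"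
proof (induction E rule: finite_induct)
  case (insert e E)
  then show ?case by (simp add: bern_insert algebra_simps)
qed simp

lemma bern_mono:
  assumes "\<And>e. e \<in> E \<Longrightarrow> 0 \<le> w e" "\<And>\<omega>. \<omega> \<subseteq> E \<Longrightarrow> F \<omega> \<le> G \<omega>"
  shows "bern E w F \<le> bern E w G"
  unfolding bern_def using assms
  by (intro sum_mono mult_left_mono mult_nonneg_nonneg prod_nonneg) (auto simp: subset_eq)

lemma bern_nonneg:
  assumes "\<And>e. e \<in> E \<Longrightarrow> 0 \<le> w e" "\<And>\<omega>. \<omega> \<subseteq> E \<Longrightarrow> 0 \<le> F \<omega>"
  shows "0 \<le> bern E w F"
  unfolding bern_def using assms
  by (intro sum_nonneg mult_nonneg_nonneg prod_nonneg) (auto simp: subset_eq)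

lemma bern_le_const:
  assumes "finite E" "\<And>e. e \<in> E \<Longrightarrow> 0 \<le> w e" "\<And>\<omega>. \<omega> \<subseteq> E \<Longrightarrow> F \<omega> \<le> c"
  shows "bern E w F \<le> c"
  using bern_mono[of E w F "\<lambda>_. c"] assms by simp

lemma bern_union_disjoint:
  assumes "finite E" "finite E'" "E \<inter> E' = {}"
  shows "bern (E \<union> E') w F = bern E w (\<lambda>\<omega>. bern E' w (\<lambda>\<omega>'. F (\<omega> \<union> \<omega>')))"
  using assms
proof (induction E arbitrary: F rule: finite_induct)
  case (insert e E)
  then have "insert e E \<union> E' = insert e (E \<union> E')" "e \<notin> E \<union> E'" by auto
  with insert show ?case by (simp add: bern_insert)
qed simp

lemma bern_restrict:
  assumes "finite E" "E' \<subseteq> E"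
  shows "bern E w (\<lambda>\<omega>. F (\<omega> \<inter> E')) = bern E' w F"
proof -
  have fin: "finite E'" using assms finite_subset by auto
  have "bern (E' \<union> (E - E')) w (\<lambda>\<omega>. F (\<omega> \<inter> E'))
      = bern E' w (\<lambda>\<omega>. bern (E - E') w (\<lambda>\<omega>'. F ((\<omega> \<union> \<omega>') \<inter> E')))"
    using assms fin by (intro bern_union_disjoint) auto
  also have "\<dots> = bern E' w (\<lambda>\<omega>. bern (E - E') w (\<lambda>\<omega>'. F \<omega>))"
  proof (intro bern_cong refl)
    fix \<omega> \<omega>' assume "\<omega> \<subseteq> E'" "\<omega>' \<subseteq> E - E'"
    then have "(\<omega> \<union> \<omega>') \<inter> E' = \<omega>" by auto
    then show "F ((\<omega> \<union> \<omega>') \<inter> E') = F \<omega>" by simp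
  qed
  also have "\<dots> = bern E' w F" using assms by (simp add: bern_def[of E'])
  also have "E' \<union> (E - E') = E" using assms by auto
  finally show ?thesis .
qed

lemma bern_product:
  assumes "finite E" "A \<subseteq> E" "B \<subseteq> E" "A \<inter> B = {}"
  shows "bern E w (\<lambda>\<omega>. F (\<omega> \<inter> A) * G (\<omega> \<inter> B)) = bern A w F * bern B w G"
proof -
  have fin: "finite A" "finite B" using assms by (auto intro: finite_subset)
  have "bern E w (\<lambda>\<omega>. F (\<omega> \<inter> A) * G (\<omega> \<inter> B))
      = bern E w (\<lambda>\<omega>. (\<lambda>\<omega>. F (\<omega> \<inter> A) * G (\<omega> \<inter> B)) (\<omega> \<inter> (A \<union> B)))"
    by (intro bern_cong refl) (auto simp: Int_assoc Int_Un_distrib2 Int_absorb1 Int_absorb2)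
  also have "\<dots> = bern (A \<union> B) w (\<lambda>\<omega>. F (\<omega> \<inter> A) * G (\<omega> \<inter> B))"
    using assms by (intro bern_restrict) auto
  also have "\<dots> = bern A w (\<lambda>\<omega>. bern B w (\<lambda>\<omega>'. F ((\<omega> \<union> \<omega>') \<inter> A) * G ((\<omega> \<union> \<omega>') \<inter> B)))"
    using assms fin by (intro bern_union_disjoint) auto
  also have "\<dots> = bern A w (\<lambda>\<omega>. bern B w (\<lambda>\<omega>'. F \<omega> * G \<omega>'))"
  proof (intro bern_cong refl)
    fix \<omega> \<omega>' assume "\<omega> \<subseteq> A" "\<omega>' \<subseteq> B"
    then have "(\<omega> \<union> \<omega>') \<inter> A = \<omega>" "(\<omega> \<union> \<omega>') \<inter> B = \<omega>'" using assms by auto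
    then show "F ((\<omega> \<union> \<omega>') \<inter> A) * G ((\<omega> \<union> \<omega>') \<inter> B) = F \<omega> * G \<omega>'" by simp
  qed
  also have "\<dots> = bern A w F * bern B w G"
    by (simp add: bern_cmult bern_multc)
  finally show ?thesis .
qed

text \<open>In the union of two independent configurations an edge is closed with probability
  \<open>exp (- w e) * exp (- w' e)\<close>, so superposition adds the weights. This is the reason
  for the exponential parametrisation, and sprinkling rests on it.\<close>

lemma bern_add_weights:
  assumes "finite E"
  shows "bern E (\<lambda>e. w e + w' e) F = bern E w (\<lambda>\<omega>. bern E w' (\<lambda>\<omega>'. F (\<omega> \<union> \<omega>')))"
  using assms
proof (induction E arbitrary: F rule: finite_induct)
  case (insert e E)
  let ?B = "bern E (\<lambda>e. w e + w' e)"
  have 1: "bern (insert e E) w' (\<lambda>\<omega>'. F (\<omega> \<union> \<omega>')) =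
      exp (- w' e) * bern E w' (\<lambda>\<omega>'. F (\<omega> \<union> \<omega>'))
      + (1 - exp (- w' e)) * bern E w' (\<lambda>\<omega>'. F (insert e (\<omega> \<union> \<omega>')))" for \<omega>
    using insert by (simp add: bern_insert)
  have 2: "bern (insert e E) w' (\<lambda>\<omega>'. F (insert e \<omega> \<union> \<omega>')) = bern E w' (\<lambda>\<omega>'. F (insert e (\<omega> \<union> \<omega>')))" for \<omega>
    using insert by (simp add: bern_insert algebra_simps)
  have *: "bern (insert e E) w (\<lambda>\<omega>. bern (insert e E) w' (\<lambda>\<omega>'. F (\<omega> \<union> \<omega>'))) =
    exp (- w e) * (exp (- w' e) * ?B F + (1 - exp (- w' e)) * ?B (\<lambda>\<omega>. F (insert e \<omega>)))
    + (1 - exp (- w e)) * ?B (\<lambda>\<omega>. F (insert e \<omega>))"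
    unfolding bern_insert[OF insert.hyps, of w] 2 unfolding 1 insert.IH bern_add bern_cmult ..
  have "bern (insert e E) (\<lambda>e. w e + w' e) F
      = exp (- w e) * exp (- w' e) * bern E (\<lambda>e. w e + w' e) F
        + (1 - exp (- w e) * exp (- w' e)) * bern E (\<lambda>e. w e + w' e) (\<lambda>\<omega>. F (insert e \<omega>))"
    using insert by (simp add: bern_insert exp_add[symmetric])
  then show ?case unfolding * by (simp only: algebra_simps)
qed simp

text \<open>Monotone coupling: the configuration of weight \<open>w'\<close> is the one of weight
  \<open>w\<close> together with an independent sprinkling of weight
  \<open>w' e - w e\<close>.\<close>

lemma bern_mono_weights:
  assumes "finite E" "\<And>e. e \<in> E \<Longrightarrow> 0 \<le> w e" "\<And>e. e \<in> E \<Longrightarrow> w e \<le> w' e"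
    and "\<And>\<omega> \<omega>'. \<omega> \<subseteq> \<omega>' \<Longrightarrow> \<omega>' \<subseteq> E \<Longrightarrow> F \<omega> \<le> F \<omega>'"
  shows "bern E w F \<le> bern E w' F"
proof -
  have "bern E w F = bern E w (\<lambda>\<omega>. bern E (\<lambda>e. w' e - w e) (\<lambda>\<omega>'. F \<omega>))"
    using assms by simp
  also have "\<dots> \<le> bern E w (\<lambda>\<omega>. bern E (\<lambda>e. w' e - w e) (\<lambda>\<omega>'. F (\<omega> \<union> \<omega>')))"
    using assms by (intro bern_mono) auto
  also have "\<dots> = bern E w' F"
    using bern_add_weights[OF assms(1), of w "\<lambda>e. w' e - w e" F] by simp
  finally show ?thesis .
qed

lemma bern_image:
  assumes "inj_on f E" "finite E"
  shows "bern (f ` E) w F = bern E (\<lambda>e. w (f e)) (\<lambda>\<omega>. F (f ` \<omega>))"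
  using assms(2,1)
proof (induction E arbitrary: F rule: finite_induct)
  case (insert e E)
  then have "f e \<notin> f ` E" by auto
  with insert show ?case by (simp add: bern_insert)
qed simp

lemma continuous_bern:
  assumes "\<And>e. e \<in> E \<Longrightarrow> continuous_on S (\<lambda>t. w t e)"
  shows "continuous_on S (\<lambda>t. bern E (w t) F)"
  unfolding bern_def using assms by (intro continuous_intros) auto

text \<open>Adding edges at unit rate is a Markov process, and this is its Kolmogorov equation.\<close>

lemma bern_Kolmogorov:
  assumes "finite E"
  shows "((\<lambda>t. bern E (\<lambda>_. t) F) has_real_derivative
    bern E (\<lambda>_. t) (\<lambda>\<omega>. \<Sum>e\<in>E. F (insert e \<omega>) - F \<omega>)) (at t)"
  using assms
proof (induction E arbitrary: F rule: finite_induct)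
  case (insert e E)
  let ?B = "bern E (\<lambda>_. t)"
  have 1: "(\<lambda>t. bern (insert e E) (\<lambda>_. t) F)
      = (\<lambda>t. exp (- t) * bern E (\<lambda>_. t) F + (1 - exp (- t)) * bern E (\<lambda>_. t) (\<lambda>\<omega>. F (insert e \<omega>)))"
    using insert by (simp add: bern_insert)
  let ?L = "\<lambda>F \<omega>. \<Sum>e\<in>E. F (insert e \<omega>) - F \<omega>"
  \<comment> \<open>On configurations that already contain \<open>e\<close>, inserting
    \<open>e\<close> changes nothing; its term drops out and only the generator over
    \<open>E\<close> remains.\<close>
  have L: "(\<Sum>e'\<in>insert e E. F (insert e' \<omega>) - F \<omega>) = (F (insert e \<omega>) - F \<omega>) + ?L F \<omega>"
    "(\<Sum>e'\<in>insert e E. F (insert e' (insert e \<omega>)) - F (insert e \<omega>)) = ?L (\<lambda>\<omega>. F (insert e \<omega>)) \<omega>" for \<omega>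
    using insert by (simp_all add: insert_commute)
  have 2: "bern (insert e E) (\<lambda>_. t) (\<lambda>\<omega>. \<Sum>e\<in>insert e E. F (insert e \<omega>) - F \<omega>) =
      exp (- t) * (?B (\<lambda>\<omega>. F (insert e \<omega>)) - ?B F + ?B (?L F)) +
      (1 - exp (- t)) * ?B (?L (\<lambda>\<omega>. F (insert e \<omega>)))"
    unfolding bern_insert[OF insert.hyps] unfolding L bern_add bern_diff by (simp add: insert_commute)
  have "((\<lambda>t. exp (- t) * bern E (\<lambda>_. t) F + (1 - exp (- t)) * bern E (\<lambda>_. t) (\<lambda>\<omega>. F (insert e \<omega>)))
    has_real_derivative
      (exp (- t) * ?B (?L F) + exp (- t) * (- 1) * ?B F) +
      ((1 - exp (- t)) * ?B (?L (\<lambda>\<omega>. F (insert e \<omega>)))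
        + (0 - exp (- t) * (- 1)) * ?B (\<lambda>\<omega>. F (insert e \<omega>)))) (at t)"
    by (intro DERIV_add DERIV_mult' DERIV_diff DERIV_const insert.IH
        DERIV_fun_exp DERIV_minus DERIV_ident)
  moreover have "x * a + x * (- 1) * b + ((1 - x) * c + (0 - x * (- 1)) * d)
      = x * (d - b + a) + (1 - x) * c" for x a b c d :: real
    by (simp add: algebra_simps)
  ultimately show ?case unfolding 1 2 by (rule DERIV_cong)
qed simp

section \<open>The van den Berg--Kesten inequality\<close>

text \<open>An edge used by the witness \<open>I\<close> or by the witness \<open>J\<close>, but not by both, may be resampled
  independently for \<open>J\<close> without decreasing the probability.  Working with a relation \<open>D\<close> between the
  witnesses, instead of a product of two events, keeps the induction closed under unions.\<close>

lemma bern_BK: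
  fixes D :: "'e set \<Rightarrow> 'e set \<Rightarrow> bool"
  assumes "finite E" "\<And>e. e \<in> E \<Longrightarrow> 0 \<le> w e"
    and "\<And>I J I' J'. D I J \<Longrightarrow> I \<subseteq> I' \<Longrightarrow> J \<subseteq> J' \<Longrightarrow> D I' J'"
  shows "bern E w (\<lambda>\<omega>. of_bool (\<exists>I J. I \<subseteq> \<omega> \<and> J \<subseteq> \<omega> \<and> I \<inter> J = {} \<and> D I J))
    \<le> bern E w (\<lambda>\<omega>. bern E w (\<lambda>\<omega>'. of_bool (D \<omega> \<omega>')))"
  using assms
proof (induction E arbitrary: D rule: finite_induct)
  case (insert e E)
  note mono = insert.prems(2)
  have w: "0 \<le> w e" "\<And>e. e \<in> E \<Longrightarrow> 0 \<le> w e" using insert.prems by auto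
  let ?S = "\<lambda>D \<omega>. of_bool (\<exists>I J. I \<subseteq> \<omega> \<and> J \<subseteq> \<omega> \<and> I \<inter> J = {} \<and> D I J) :: real"
  let ?Q = "\<lambda>D. bern E w (\<lambda>\<omega>. bern E w (\<lambda>\<omega>'. of_bool (D \<omega> \<omega>') :: real))"
  define D10 where "D10 = (\<lambda>I J. D (insert e I) J)"
  define D01 where "D01 = (\<lambda>I J. D I (insert e J))"
  define D11 where "D11 = (\<lambda>I J. D (insert e I) (insert e J))"
  \<comment> \<open>When \<open>e\<close> is open, disjoint witnesses may give it to one side but
    not to both. \<open>U\<close> is the resulting relation on the remaining edges; it is again
    monotone, so the induction hypothesis applies to it.\<close>
  define U where "U = (\<lambda>I J. D10 I J \<or> D01 I J)"
  define p where "p = 1 - exp (- w e)"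
  have p: "0 \<le> p" "p \<le> 1" using w by (auto simp: p_def)
  have monoU: "U I J \<Longrightarrow> I \<subseteq> I' \<Longrightarrow> J \<subseteq> J' \<Longrightarrow> U I' J'" for I J I' J'
    using mono[of "insert e I" J "insert e I'" J'] mono[of I "insert e J" I' "insert e J'"]
    by (auto simp: U_def D10_def D01_def)
  have S1: "bern E w (\<lambda>\<omega>. ?S D (insert e \<omega>)) \<le> bern E w (?S U)"
  proof (rule bern_mono)
    fix \<omega> assume "\<omega> \<subseteq> E"
    then have ne: "e \<notin> \<omega>" using insert by auto
    have "\<exists>I J. I \<subseteq> \<omega> \<and> J \<subseteq> \<omega> \<and> I \<inter> J = {} \<and> U I J"
      if IJ: "I \<subseteq> insert e \<omega>" "J \<subseteq> insert e \<omega>" "I \<inter> J = {}" "D I J" for I J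
    proof -
      have "U (I - {e}) (J - {e})"
      proof (cases "e \<in> I")
        case True
        then have "J - {e} = J" "insert e (I - {e}) = I" using IJ by auto
        then show ?thesis using IJ by (simp add: U_def D10_def)
      next
        case False
        then have "I - {e} = I" by auto
        moreover have "D I (insert e (J - {e}))" using IJ(4) by (rule mono) auto
        ultimately show ?thesis by (simp add: U_def D01_def)
      qed
      moreover have "I - {e} \<subseteq> \<omega>" "J - {e} \<subseteq> \<omega>" "(I - {e}) \<inter> (J - {e}) = {}" using IJ by auto
      ultimately show ?thesis by blast
    qed
    then show "?S D (insert e \<omega>) \<le> ?S U \<omega>" by auto
  qed (use w in auto)
  have IHU: "bern E w (?S U) \<le> ?Q U" by (rule insert.IH) (use w monoU in auto)
  have IHD: "bern E w (?S D) \<le> ?Q D" by (rule insert.IH) (use w mono in auto)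
  have L: "bern (insert e E) w (?S D) \<le> (1 - p) * ?Q D + p * ?Q U"
  proof -
    have "bern (insert e E) w (?S D) = (1 - p) * bern E w (?S D) + p * bern E w (\<lambda>\<omega>. ?S D (insert e \<omega>))"
      using insert by (simp add: bern_insert p_def)
    also have "\<dots> \<le> (1 - p) * ?Q D + p * ?Q U"
      using p S1 IHU IHD by (intro add_mono mult_left_mono) auto
    finally show ?thesis .
  qed
  have U1: "?Q U \<le> ?Q D11"
  proof (intro bern_mono)
    fix \<omega> \<omega>'
    have "U \<omega> \<omega>' \<Longrightarrow> D11 \<omega> \<omega>'"
      using mono[of "insert e \<omega>" \<omega>' "insert e \<omega>" "insert e \<omega>'"] mono[of \<omega> "insert e \<omega>'" "insert e \<omega>" "insert e \<omega>'"]
      by (auto simp: U_def D11_def D10_def D01_def)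
    then show "of_bool (U \<omega> \<omega>') \<le> (of_bool (D11 \<omega> \<omega>') :: real)" by simp
  qed (use w in auto)
  have U2: "?Q U \<le> ?Q D10 + ?Q D01 - ?Q D"
  proof -
    have "?Q U \<le> bern E w (\<lambda>\<omega>. bern E w (\<lambda>\<omega>'. of_bool (D10 \<omega> \<omega>') + of_bool (D01 \<omega> \<omega>') - of_bool (D \<omega> \<omega>')))"
    proof (intro bern_mono)
      fix \<omega> \<omega>'
      have "D \<omega> \<omega>' \<Longrightarrow> D10 \<omega> \<omega>' \<and> D01 \<omega> \<omega>'" 
        using mono[of \<omega> \<omega>' "insert e \<omega>" \<omega>'] mono[of \<omega> \<omega>' \<omega> "insert e \<omega>'"]
        by (auto simp: D10_def D01_def)
      then show "of_bool (U \<omega> \<omega>') \<le> of_bool (D10 \<omega> \<omega>') + of_bool (D01 \<omega> \<omega>') - (of_bool (D \<omega> \<omega>') :: real)"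
        by (auto simp: U_def)
    qed (use w in auto)
    then show ?thesis by (simp add: bern_add bern_diff)
  qed
  have R: "bern (insert e E) w (\<lambda>\<omega>. bern (insert e E) w (\<lambda>\<omega>'. of_bool (D \<omega> \<omega>')))
     = (1 - p) * ((1 - p) * ?Q D + p * ?Q D10) + p * ((1 - p) * ?Q D01 + p * ?Q D11)"
    unfolding bern_insert[OF insert.hyps] bern_add bern_cmult D10_def D01_def D11_def p_def by simp
  \<comment> \<open>On the left \<open>e\<close> is a single shared resource, on the right it has
    two independent copies. Splitting \<open>p * u\<close> into shares \<open>1 - p\<close> and
    \<open>p\<close>, the first is paid by inclusion-exclusion (\<open>U2\<close>), the second by
    \<open>U1\<close>.\<close>
  have final: "(1 - p) * q + p * u \<le> (1 - p) * ((1 - p) * q + p * a) + p * ((1 - p) * b + p * c)"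
    if "u \<le> c" "u \<le> a + b - q" for q u a b c :: real
  proof -
    have "p * u = p * ((1 - p) * u + p * u)" by (simp add: algebra_simps)
    also have "\<dots> \<le> p * ((1 - p) * (a + b - q) + p * c)"
      using p that by (intro mult_left_mono add_mono) auto
    finally show ?thesis by (simp add: algebra_simps)
  qed
  show ?case using L final[OF U1 U2] unfolding R by linarith
qed auto

lemma bern_BK_events:
  assumes "finite E" "\<And>e. e \<in> E \<Longrightarrow> 0 \<le> w e"
    and "\<And>I I'. P I \<Longrightarrow> I \<subseteq> I' \<Longrightarrow> P I'" "\<And>I I'. Q I \<Longrightarrow> I \<subseteq> I' \<Longrightarrow> Q I'"
  shows "bern E w (\<lambda>\<omega>. of_bool (\<exists>I J. I \<subseteq> \<omega> \<and> J \<subseteq> \<omega> \<and> I \<inter> J = {} \<and> P I \<and> Q J))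
    \<le> bern E w (\<lambda>\<omega>. of_bool (P \<omega>)) * bern E w (\<lambda>\<omega>. of_bool (Q \<omega>))"
proof -
  have "bern E w (\<lambda>\<omega>. of_bool (\<exists>I J. I \<subseteq> \<omega> \<and> J \<subseteq> \<omega> \<and> I \<inter> J = {} \<and> P I \<and> Q J))
    \<le> bern E w (\<lambda>\<omega>. bern E w (\<lambda>\<omega>'. of_bool (P \<omega> \<and> Q \<omega>')))"
    by (rule bern_BK[where D = "\<lambda>I J. P I \<and> Q J"]) (use assms in blast)+
  then show ?thesis by (simp add: of_bool_conj bern_cmult bern_multc)
qed

section \<open>Finite graphs and their clusters\<close>

definition edges :: "'v set \<Rightarrow> 'v set set" where
  "edges B = {e. e \<subseteq> B \<and> card e = 2}"

abbreviation clus :: "'v set set \<Rightarrow> 'v \<Rightarrow> 'v set" where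
  "clus \<omega> \<equiv> cluster (\<lambda>e. e \<in> \<omega>)"

lemma finite_edges: "finite B \<Longrightarrow> finite (edges B)"
  unfolding edges_def by (rule finite_subset[of _ "Pow B"]) auto

lemma edges_mono: "A \<subseteq> B \<Longrightarrow> edges A \<subseteq> edges B"
  by (auto simp: edges_def)

lemma edges_pair_iff: "{u, v} \<in> edges B \<longleftrightarrow> u \<in> B \<and> v \<in> B \<and> u \<noteq> v"
  by (auto simp: edges_def card_insert_if)

lemma edgesE:
  assumes "e \<in> edges B"
  obtains u v where "e = {u, v}" "u \<in> B" "v \<in> B" "u \<noteq> v"
  using assms unfolding edges_def by (auto simp: card_2_iff)

lemma edges_disjoint: "A \<inter> B = {} \<Longrightarrow> edges A \<inter> edges B = {}"
  unfolding edges_def by (force simp: card_2_iff)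

lemma cluster_refl [simp]: "x \<in> cluster \<omega> x"
  by (simp add: cluster_def)

lemma cluster_sym: "y \<in> cluster \<omega> x \<longleftrightarrow> x \<in> cluster \<omega> y"
proof -
  have "sym {(u, v). u \<noteq> v \<and> \<omega> {u, v}}" by (auto simp: sym_def insert_commute)
  then have "sym ({(u, v). u \<noteq> v \<and> \<omega> {u, v}}\<^sup>*)" by (rule sym_rtrancl)
  then show ?thesis unfolding cluster_def by (auto dest: symD)
qed

lemma cluster_trans: "y \<in> cluster \<omega> x \<Longrightarrow> z \<in> cluster \<omega> y \<Longrightarrow> z \<in> cluster \<omega> x"
  unfolding cluster_def by auto

lemma cluster_eq:
  assumes "y \<in> cluster \<omega> x" shows "cluster \<omega> y = cluster \<omega> x"
proof -
  have "x \<in> cluster \<omega> y" using assms cluster_sym by metis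
  then show ?thesis using assms by (auto intro: cluster_trans)
qed

lemma cluster_step: "y \<in> cluster \<omega> x \<Longrightarrow> y \<noteq> z \<Longrightarrow> \<omega> {y, z} \<Longrightarrow> z \<in> cluster \<omega> x"
  unfolding cluster_def by (auto intro: rtrancl_into_rtrancl)

lemma cluster_mono:
  assumes "\<And>e. \<omega> e \<Longrightarrow> \<omega>' e" shows "cluster \<omega> x \<subseteq> cluster \<omega>' x"
  using rtrancl_mono[of "{(u, v). u \<noteq> v \<and> \<omega> {u, v}}" "{(u, v). u \<noteq> v \<and> \<omega>' {u, v}}"] assms
  unfolding cluster_def by blast

lemma clus_mono: "\<omega> \<subseteq> \<omega>' \<Longrightarrow> clus \<omega> x \<subseteq> clus \<omega>' x"
  by (rule cluster_mono) auto

lemma cluster_induct [consumes 1, case_names refl step]: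
  assumes "y \<in> cluster \<omega> x" "P x"
    and "\<And>y z. y \<in> cluster \<omega> x \<Longrightarrow> P y \<Longrightarrow> y \<noteq> z \<Longrightarrow> \<omega> {y, z} \<Longrightarrow> P z"
  shows "P y"
proof -
  have "(x, y) \<in> {(u, v). u \<noteq> v \<and> \<omega> {u, v}}\<^sup>*" using assms(1) by (simp add: cluster_def)
  then show ?thesis
    by (induction rule: rtrancl_induct) (use assms(2,3) in \<open>auto simp: cluster_def\<close>)
qed

lemma clus_subset:
  assumes "\<omega> \<subseteq> edges B" "x \<in> B" shows "clus \<omega> x \<subseteq> B"
proof
  fix y assume "y \<in> clus \<omega> x"
  then show "y \<in> B"
    by (induction rule: cluster_induct) (use assms in \<open>auto simp: subset_eq edges_pair_iff dest!: bspec\<close>)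
qed

lemma cluster_exit:
  assumes "y \<in> cluster \<omega> x" "x \<in> C" "y \<notin> C"
  obtains u v where "u \<in> C" "v \<notin> C" "\<omega> {u, v}" "u \<in> cluster \<omega> x" "v \<in> cluster \<omega> x"
proof -
  have "y \<in> C \<or> (\<exists>u v. u \<in> C \<and> v \<notin> C \<and> \<omega> {u, v} \<and> u \<in> cluster \<omega> x \<and> v \<in> cluster \<omega> x)"
    using assms(1) by (induction rule: cluster_induct) (use assms(2) in \<open>auto intro: cluster_step\<close>)
  then show ?thesis using assms that by auto
qed

subsection \<open>Splitting a large cluster\<close>

text \<open>Hanging one tree below the root of another splits off one child subtree at a time. This
  binary decomposition gives an induction for cutting trees that does not depend on the
  degrees.\<close>

inductive rooted_tree :: "'v \<Rightarrow> 'v set \<Rightarrow> 'v set set \<Rightarrow> bool" where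
  single: "rooted_tree r {r} {}"
| join: "rooted_tree r V E \<Longrightarrow> rooted_tree r' V' E' \<Longrightarrow> V \<inter> V' = {}
    \<Longrightarrow> rooted_tree r (V \<union> V') (insert {r, r'} (E \<union> E'))"

lemma rooted_tree_props:
  "rooted_tree r V E \<Longrightarrow> finite V \<and> r \<in> V \<and> E \<subseteq> edges V \<and> V \<subseteq> clus E r"
proof (induction rule: rooted_tree.induct)
  case (join r V E r' V' E')
  let ?E = "insert {r, r'} (E \<union> E')"
  have "r \<noteq> r'" using join by auto
  have "r' \<in> clus ?E r" by (rule cluster_step[of r]) (use \<open>r \<noteq> r'\<close> in auto)
  moreover have "clus E r \<subseteq> clus ?E r" "clus E' r' \<subseteq> clus ?E r'" by (intro clus_mono; auto)+
  ultimately have "V \<union> V' \<subseteq> clus ?E r" using join cluster_eq[of r' _ r] by blast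
  moreover have "?E \<subseteq> edges (V \<union> V')"
    using join edges_mono[of V "V \<union> V'"] edges_mono[of V' "V \<union> V'"] by (auto simp: edges_pair_iff)
  ultimately show ?case using join by auto
qed auto

lemma rooted_tree_add_leaf:
  "rooted_tree r V E \<Longrightarrow> u \<in> V \<Longrightarrow> w \<notin> V \<Longrightarrow> rooted_tree r (insert w V) (insert {u, w} E)"
proof (induction rule: rooted_tree.induct)
  case (single r)
  then show ?case using rooted_tree.join[OF rooted_tree.single[of r] rooted_tree.single[of w]]
    by (auto simp: insert_commute)
next
  case (join r V E r' V' E')
  show ?case
  proof (cases "u \<in> V")
    case True
    then have "rooted_tree r (insert w V) (insert {u, w} E)" using join by auto
    from rooted_tree.join[OF this join.hyps(2)] show ?thesis
      using join by (simp add: insert_commute)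
  next
    case False
    then have "rooted_tree r' (insert w V') (insert {u, w} E')" using join by auto
    from rooted_tree.join[OF join.hyps(1) this] show ?thesis
      using join by (simp add: insert_commute)
  qed
qed

text \<open>Among the trees inside the cluster, one with the most vertices spans it: otherwise an
  open edge leaves the tree and adds a leaf.\<close>

lemma spanning_tree:
  assumes "finite (clus \<omega> x)"
  obtains E where "E \<subseteq> \<omega>" "rooted_tree x (clus \<omega> x) E"
proof -
  let ?P = "\<lambda>V. V \<subseteq> clus \<omega> x \<and> (\<exists>E\<subseteq>\<omega>. rooted_tree x V E)"
  have "?P {x}" using rooted_tree.single[of x] by auto
  moreover have "\<forall>V. ?P V \<longrightarrow> card V < Suc (card (clus \<omega> x))"
    using assms card_mono less_Suc_eq_le by blast
  ultimately have "\<exists>V. ?P V \<and> (\<forall>V'. ?P V' \<longrightarrow> card V' \<le> card V)"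
    by (rule ex_has_greatest_nat)
  then obtain V where V: "?P V" "\<And>V'. ?P V' \<Longrightarrow> card V' \<le> card V" by blast
  then obtain E where E: "E \<subseteq> \<omega>" "rooted_tree x V E" by auto
  have fin: "finite V" "x \<in> V" using rooted_tree_props[OF E(2)] by auto
  have "clus \<omega> x \<subseteq> V"
  proof
    fix y assume y: "y \<in> clus \<omega> x"
    show "y \<in> V"
    proof (rule ccontr)
      assume "y \<notin> V"
      from cluster_exit[OF y fin(2) this] obtain u v
        where uv: "u \<in> V" "v \<notin> V" "{u, v} \<in> \<omega>" "v \<in> clus \<omega> x" by metis
      then have "?P (insert v V)"
        using rooted_tree_add_leaf[OF E(2) uv(1,2)] E V(1) by (meson insert_subset)
      from V(2)[OF this] show False using fin uv by auto
    qed
  qed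
  with V(1) have "V = clus \<omega> x" by auto
  with E that show ?thesis by auto
qed

text \<open>Descend into a subtree that still has \<open>m\<close> vertices until both halves of a
  join are smaller than \<open>m\<close>. That join has fewer than \<open>2 * m\<close> vertices,
  and what is left after removing it stays attached to the root.\<close>

lemma rooted_tree_cut:
  assumes "rooted_tree r V E" "m \<le> card V" "1 \<le> m"
  shows "\<exists>V1 V2 E1 E2 s. E1 \<union> E2 \<subseteq> E \<and> E1 \<inter> E2 = {} \<and> V1 \<subseteq> V \<and> V2 \<subseteq> V \<and> s \<in> V \<and>
    V1 \<subseteq> clus E1 s \<and> V2 \<subseteq> clus E2 r \<and> m \<le> card V1 \<and> card V \<le> 2 * m + card V2"
  using assms(1,2)
proof (induction rule: rooted_tree.induct)
  case (single r)
  show ?case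
    using single assms(3) by (intro exI[of _ "{r}"] exI[of _ "{}"] exI[of _ r]) auto
next
  case (join r V E r' V' E')
  let ?E = "insert {r, r'} (E \<union> E')"
  note T = rooted_tree_props[OF join.hyps(1)] and T' = rooted_tree_props[OF join.hyps(2)]
  have T'': "V \<union> V' \<subseteq> clus ?E r"
    using rooted_tree_props[OF rooted_tree.join[OF join.hyps]] by auto
  have card: "card (V \<union> V') = card V + card V'" using T T' join.hyps by (simp add: card_Un_disjoint)
  have ne: "r \<noteq> r'" using T T' join.hyps by auto
  have EE: "E \<inter> E' = {}" using edges_disjoint[OF join.hyps(3)] T T' by blast
  have rr: "{r, r'} \<notin> E" "{r, r'} \<notin> E'"
    using T T' join.hyps(3) by (auto simp: subset_eq edges_pair_iff dest!: bspec)
  consider "m \<le> card V'" | "m \<le> card V" | "card V < m" "card V' < m" by linarith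
  then show ?case
  proof cases
    case 1
    from join.IH(2)[OF 1] obtain V1 V2 E1 E2 s where
      *: "E1 \<union> E2 \<subseteq> E'" "E1 \<inter> E2 = {}" "V1 \<subseteq> V'" "V2 \<subseteq> V'" "s \<in> V'" "V1 \<subseteq> clus E1 s"
      "V2 \<subseteq> clus E2 r'" "m \<le> card V1" "card V' \<le> 2 * m + card V2" by auto
    \<comment> \<open>The joining edge goes to \<open>?E2\<close>, so that the remainder of the
      lower tree stays connected to the new root.\<close>
    let ?E2 = "insert {r, r'} (E \<union> E2)"
    have eq: "clus ?E2 r' = clus ?E2 r"
      by (rule cluster_eq, rule cluster_step[of r]) (use ne in auto)
    have "clus E r \<subseteq> clus ?E2 r" "clus E2 r' \<subseteq> clus ?E2 r'" by (intro clus_mono; auto)+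
    then have "V \<union> V2 \<subseteq> clus ?E2 r" using T *(7) unfolding eq by (meson Un_least order_trans)
    moreover have "card (V \<union> V2) = card V + card V2"
      using T T' * join.hyps(3) by (intro card_Un_disjoint) (auto intro: finite_subset)
    ultimately show ?thesis
      using * card EE rr by (intro exI[of _ V1] exI[of _ "V \<union> V2"] exI[of _ E1] exI[of _ ?E2] exI[of _ s]) auto
  next
    case 2
    from join.IH(1)[OF 2] obtain V1 V2 E1 E2 s where
      *: "E1 \<union> E2 \<subseteq> E" "E1 \<inter> E2 = {}" "V1 \<subseteq> V" "V2 \<subseteq> V" "s \<in> V" "V1 \<subseteq> clus E1 s"
      "V2 \<subseteq> clus E2 r" "m \<le> card V1" "card V \<le> 2 * m + card V2" by auto
    let ?E2 = "insert {r, r'} (E2 \<union> E')"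
    have eq: "clus ?E2 r' = clus ?E2 r"
      by (rule cluster_eq, rule cluster_step[of r]) (use ne in auto)
    have "clus E2 r \<subseteq> clus ?E2 r" "clus E' r' \<subseteq> clus ?E2 r'" by (intro clus_mono; auto)+
    then have "V2 \<union> V' \<subseteq> clus ?E2 r" using T' *(7) unfolding eq by (meson Un_least order_trans)
    moreover have "card (V2 \<union> V') = card V2 + card V'"
      using T T' * join.hyps(3) by (intro card_Un_disjoint) (auto intro: finite_subset)
    ultimately show ?thesis
      using * card EE rr by (intro exI[of _ V1] exI[of _ "V2 \<union> V'"] exI[of _ E1] exI[of _ ?E2] exI[of _ s]) auto
  next
    \<comment> \<open>The whole tree is the piece cut off and the root alone remains. The two parts
      share the vertex \<open>r\<close>; only their edge sets have to be disjoint.\<close>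
    case 3
    then show ?thesis using join.prems card T T''
      by (intro exI[of _ "V \<union> V'"] exI[of _ "{r}"] exI[of _ ?E] exI[of _ "{}"] exI[of _ r]) auto
  qed
qed

text \<open>The intersection with the finite set \<open>B\<close> keeps the cardinality monotone in \<open>\<omega>\<close>, since
  infinite sets have cardinality 0.\<close>

definition big :: "'v set \<Rightarrow> nat \<Rightarrow> 'v set set \<Rightarrow> bool" where
  "big B m \<omega> \<longleftrightarrow> (\<exists>x\<in>B. m \<le> card (clus \<omega> x \<inter> B))"

lemma big_mono:
  assumes "finite B" "big B m \<omega>" "\<omega> \<subseteq> \<omega>'" shows "big B m \<omega>'"
proof -
  from assms obtain x where x: "x \<in> B" "m \<le> card (clus \<omega> x \<inter> B)" by (auto simp: big_def)
  note x(2)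
  also have "card (clus \<omega> x \<inter> B) \<le> card (clus \<omega>' x \<inter> B)"
    using clus_mono[OF assms(3)] assms(1) by (intro card_mono) auto
  finally show ?thesis using x by (auto simp: big_def)
qed

text \<open>Cutting off one piece of a spanning tree costs the root side at most
  \<open>2 * m\<close> vertices; hence the tripled threshold.\<close>

lemma big_split:
  assumes "finite B" "\<omega> \<subseteq> edges B" "big B (3 * m) \<omega>" "1 \<le> m"
  shows "\<exists>I J. I \<subseteq> \<omega> \<and> J \<subseteq> \<omega> \<and> I \<inter> J = {} \<and> big B m I \<and> big B m J"
proof -
  from assms obtain x where x: "x \<in> B" "3 * m \<le> card (clus \<omega> x \<inter> B)" by (auto simp: big_def)
  have sub: "clus \<omega> x \<subseteq> B" by (rule clus_subset) (use assms x in auto)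
  then have fin: "finite (clus \<omega> x)" and c: "3 * m \<le> card (clus \<omega> x)"
    using assms x finite_subset by (auto simp: Int_absorb2)
  from spanning_tree[OF fin] obtain E where E: "E \<subseteq> \<omega>" "rooted_tree x (clus \<omega> x) E" .
  have "m \<le> card (clus \<omega> x)" using c by auto
  from rooted_tree_cut[OF E(2) this assms(4)] obtain V1 V2 E1 E2 s where
    *: "E1 \<union> E2 \<subseteq> E" "E1 \<inter> E2 = {}" "V1 \<subseteq> clus \<omega> x" "V2 \<subseteq> clus \<omega> x" "s \<in> clus \<omega> x"
    "V1 \<subseteq> clus E1 s" "V2 \<subseteq> clus E2 x" "m \<le> card V1" "card (clus \<omega> x) \<le> 2 * m + card V2"
    by auto
  have "card V1 \<le> card (clus E1 s \<inter> B)" "card V2 \<le> card (clus E2 x \<inter> B)"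
    using * sub assms(1) by (intro card_mono; auto)+
  then have "m \<le> card (clus E1 s \<inter> B)" "m \<le> card (clus E2 x \<inter> B)" "s \<in> B"
    using * c sub by auto
  then have "big B m E1" "big B m E2" using x(1) by (auto simp: big_def)
  then show ?thesis
    by (intro exI[of _ E1] exI[of _ E2]) (use *(1,2) E(1) in auto)
qed

lemma bern_big_triple:
  assumes "finite B" "\<And>e. e \<in> edges B \<Longrightarrow> 0 \<le> w e" "1 \<le> m"
  shows "bern (edges B) w (\<lambda>\<omega>. of_bool (big B (3 * m) \<omega>))
    \<le> (bern (edges B) w (\<lambda>\<omega>. of_bool (big B m \<omega>)))\<^sup>2"
proof -
  have "bern (edges B) w (\<lambda>\<omega>. of_bool (big B (3 * m) \<omega>)) \<le>
    bern (edges B) w (\<lambda>\<omega>. of_bool (\<exists>I J. I \<subseteq> \<omega> \<and> J \<subseteq> \<omega> \<and> I \<inter> J = {} \<and> big B m I \<and> big B m J))"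
  proof (rule bern_mono)
    fix \<omega> assume \<omega>: "\<omega> \<subseteq> edges B"
    show "of_bool (big B (3 * m) \<omega>) \<le> (of_bool (\<exists>I J. I \<subseteq> \<omega> \<and> J \<subseteq> \<omega> \<and> I \<inter> J = {} \<and> big B m I \<and> big B m J) :: real)"
      using big_split[OF assms(1) \<omega> _ assms(3)] by (cases "big B (3 * m) \<omega>") simp_all
  qed (use assms in auto)
  also have "\<dots> \<le> bern (edges B) w (\<lambda>\<omega>. of_bool (big B m \<omega>)) * bern (edges B) w (\<lambda>\<omega>. of_bool (big B m \<omega>))"
    using assms big_mono[OF assms(1)] by (intro bern_BK_events finite_edges) auto
  finally show ?thesis by (simp add: power2_eq_square)
qed

text \<open>The probability is squared whenever the size is tripled. This decay is doubly
  exponential in \<open>k\<close>, which later beats the factor \<open>9 ^ k\<close> of a second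
  moment.\<close>

lemma bern_big_power:
  assumes "finite B" "\<And>e. e \<in> edges B \<Longrightarrow> 0 \<le> w e" "1 \<le> m"
  shows "bern (edges B) w (\<lambda>\<omega>. of_bool (big B (3 ^ k * m) \<omega>))
    \<le> bern (edges B) w (\<lambda>\<omega>. of_bool (big B m \<omega>)) ^ (2 ^ k)"
proof (induction k)
  case (Suc k)
  have "bern (edges B) w (\<lambda>\<omega>. of_bool (big B (3 ^ Suc k * m) \<omega>))
      \<le> (bern (edges B) w (\<lambda>\<omega>. of_bool (big B (3 ^ k * m) \<omega>)))\<^sup>2"
    using bern_big_triple[OF assms(1,2), of _ "3 ^ k * m"] assms(3) by (simp add: mult.assoc)
  also have "\<dots> \<le> (bern (edges B) w (\<lambda>\<omega>. of_bool (big B m \<omega>)) ^ (2 ^ k))\<^sup>2"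
    using Suc assms by (intro power_mono bern_nonneg) auto
  finally show ?case by (simp add: power_mult[symmetric] mult.commute)
qed simp

subsection \<open>Sprinkling creates a large cluster\<close>

text \<open>Each cluster is counted once for each of its vertices in \<open>B\<close>, so this is
  the sum of the squared cluster sizes in \<open>B\<close>, an unnormalised susceptibility.\<close>

definition sus :: "'v set \<Rightarrow> 'v set set \<Rightarrow> real" where
  "sus B \<omega> = (\<Sum>x\<in>B. real (card (clus \<omega> x \<inter> B)))"

lemma sus_mono:
  assumes "finite B" "\<omega> \<subseteq> \<omega>'" shows "sus B \<omega> \<le> sus B \<omega>'"
  unfolding sus_def using assms clus_mono[OF assms(2)]
  by (intro sum_mono of_nat_mono card_mono) auto

lemma sum_edges:
  fixes g :: "'v set \<Rightarrow> real"
  assumes "finite B"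
  shows "(\<Sum>u\<in>B. \<Sum>v\<in>B - {u}. g {u, v}) = 2 * (\<Sum>e\<in>edges B. g e)"
proof -
  let ?P = "Sigma B (\<lambda>u. B - {u})"
  have img: "(\<lambda>(u, v). {u, v}) ` ?P = edges B"
    by (auto simp: image_iff edges_pair_iff elim!: edgesE)
  have "(\<Sum>u\<in>B. \<Sum>v\<in>B - {u}. g {u, v}) = (\<Sum>(u, v)\<in>?P. g {u, v})"
    using assms by (simp add: sum.Sigma)
  also have "\<dots> = (\<Sum>e\<in>edges B. \<Sum>z | z \<in> ?P \<and> (\<lambda>(u, v). {u, v}) z = e. (\<lambda>(u, v). g {u, v}) z)"
    using assms by (subst sum.image_gen[where g = "\<lambda>(u, v). {u, v}"]) (auto simp: img)
  also have "\<dots> = (\<Sum>e\<in>edges B. 2 * g e)"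
  proof (rule sum.cong[OF refl])
    fix e assume "e \<in> edges B"
    then obtain a b where e: "e = {a, b}" "a \<in> B" "b \<in> B" "a \<noteq> b" by (rule edgesE)
    have "{z. z \<in> ?P \<and> (\<lambda>(u, v). {u, v}) z = e} = {(a, b), (b, a)}"
      using e by (auto simp: doubleton_eq_iff)
    then show "(\<Sum>z | z \<in> ?P \<and> (\<lambda>(u, v). {u, v}) z = e. (\<lambda>(u, v). g {u, v}) z) = 2 * g e"
      using e by (simp add: insert_commute)
  qed
  finally show ?thesis by (simp add: sum_distrib_left)
qed

lemma sum_if_mem:
  fixes k :: real
  assumes "finite B"
  shows "(\<Sum>x\<in>B. if x \<in> C then k else 0) = real (card (C \<inter> B)) * k"
  using sum.inter_restrict[OF assms, of "\<lambda>_. k" C] by (simp add: Int_commute)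

text \<open>Merging clusters of sizes \<open>a\<close> and \<open>b\<close> raises the sum of
  squares by \<open>(a + b)^2 - a^2 - b^2 = 2 * a * b\<close>.\<close>

lemma sus_insert:
  assumes "finite B" "\<omega> \<subseteq> edges B" "u \<in> B" "v \<in> B" "v \<notin> clus \<omega> u"
  shows "sus B \<omega> + 2 * real (card (clus \<omega> u \<inter> B)) * real (card (clus \<omega> v \<inter> B))
    \<le> sus B (insert {u, v} \<omega>)"
proof -
  let ?c = "\<lambda>x. clus \<omega> x \<inter> B" and ?\<omega> = "insert {u, v} \<omega>"
  let ?a = "real (card (?c u))" and ?b = "real (card (?c v))"
  have "u \<noteq> v" using assms by auto
  have disj: "clus \<omega> u \<inter> clus \<omega> v = {}" using assms(5) cluster_eq[of _ "\<lambda>e. e \<in> \<omega>"] by (metis cluster_refl disjoint_iff)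
  have "v \<in> clus ?\<omega> u" by (rule cluster_step[of u]) (use \<open>u \<noteq> v\<close> in auto)
  then have eq: "clus ?\<omega> v = clus ?\<omega> u" by (rule cluster_eq)
  have mono: "clus \<omega> x \<subseteq> clus ?\<omega> x" for x by (rule clus_mono) auto
  have uv: "?a + ?b \<le> real (card (clus ?\<omega> u \<inter> B))"
  proof -
    have "card (?c u) + card (?c v) = card (?c u \<union> ?c v)"
      using assms disj by (subst card_Un_disjoint) auto
    also have "\<dots> \<le> card (clus ?\<omega> u \<inter> B)"
      using assms mono[of u] mono[of v] eq by (intro card_mono) auto
    finally show ?thesis by simp
  qed
  have "real (card (?c x)) + (if x \<in> clus \<omega> u then ?b else 0) + (if x \<in> clus \<omega> v then ?a else 0)
      \<le> real (card (clus ?\<omega> x \<inter> B))" if "x \<in> B" for x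
  proof -
    consider "x \<in> clus \<omega> u" "x \<notin> clus \<omega> v" | "x \<in> clus \<omega> v" "x \<notin> clus \<omega> u" | "x \<notin> clus \<omega> v" "x \<notin> clus \<omega> u"
      using disj by auto
    then show ?thesis
    proof cases
      case 1
      then have "clus \<omega> x = clus \<omega> u" "clus ?\<omega> x = clus ?\<omega> u"
        using mono[of u] by (auto intro!: cluster_eq)
      then show ?thesis using 1 uv by simp
    next
      case 2
      then have "clus \<omega> x = clus \<omega> v" "clus ?\<omega> x = clus ?\<omega> u"
        using mono[of v] unfolding eq[symmetric] by (auto intro!: cluster_eq)
      then show ?thesis using 2 uv by simp
    next
      case 3
      then show ?thesis using mono[of x] assms(1) by (auto intro!: card_mono)
    qed
  qed
  then have "(\<Sum>x\<in>B. real (card (?c x)) + (if x \<in> clus \<omega> u then ?b else 0) + (if x \<in> clus \<omega> v then ?a else 0))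
    \<le> sus B ?\<omega>" unfolding sus_def by (rule sum_mono)
  also have "(\<Sum>x\<in>B. real (card (?c x)) + (if x \<in> clus \<omega> u then ?b else 0) + (if x \<in> clus \<omega> v then ?a else 0))
    = sus B \<omega> + ?a * ?b + ?b * ?a"
    unfolding sum.distrib sum_if_mem[OF assms(1)] sus_def ..
  finally show ?thesis by (simp add: algebra_simps)
qed

text \<open>As long as no cluster reaches size \<open>m\<close>, the inverse of the sum of squared cluster sizes drifts
  downwards at least at rate \<open>1/4\<close> when edges are added at unit rate; as it stays nonnegative, a
  large cluster has to appear.\<close>

definition inv_sus :: "'v set \<Rightarrow> nat \<Rightarrow> 'v set set \<Rightarrow> real" where
  "inv_sus B m \<omega> = (if big B m \<omega> then 0 else 1 / sus B \<omega>)"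

lemma inv_sus_drift:
  assumes "finite B" "\<omega> \<subseteq> edges B" "\<not> big B m \<omega>" "2 * (real m)\<^sup>2 \<le> sus B \<omega>" "0 < sus B \<omega>"
  shows "(\<Sum>e\<in>edges B. inv_sus B m (insert e \<omega>) - inv_sus B m \<omega>) \<le> - 1 / 4"
proof -
  define S where "S = sus B \<omega>"
  define c where "c = (\<lambda>x. real (card (clus \<omega> x \<inter> B)))"
  define h where "h = (\<lambda>u v. if v \<in> clus \<omega> u then 0 else c u * c v)"
  have S: "S > 0" "2 * (real m)\<^sup>2 \<le> S" using assms by (auto simp: S_def)
  have c: "0 \<le> c x" for x by (simp add: c_def)
  have cm: "c x \<le> m" if "x \<in> B" for x using assms(3) that by (auto simp: c_def big_def not_le)
  have F: "inv_sus B m \<omega> = 1 / S" using assms by (simp add: inv_sus_def S_def)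
  have step: "inv_sus B m (insert {u, v} \<omega>) - inv_sus B m \<omega> \<le> - h u v / S\<^sup>2"
    if uv: "u \<in> B" "v \<in> B" "u \<noteq> v" for u v
  proof (cases "v \<in> clus \<omega> u")
    case True
    have "sus B \<omega> \<le> sus B (insert {u, v} \<omega>)" using assms by (intro sus_mono) auto
    then show ?thesis unfolding F using True S by (auto simp: h_def inv_sus_def S_def frac_le)
  next
    case False
    have "c u * c v \<le> (real m)\<^sup>2"
      unfolding power2_eq_square using c cm uv by (intro mult_mono) auto
    then have ab: "2 * (c u * c v) \<le> S" "0 \<le> c u * c v" using S c by auto
    show ?thesis
    proof (cases "big B m (insert {u, v} \<omega>)")
      case True
      have "c u * c v / S\<^sup>2 \<le> S / S\<^sup>2" using ab S by (intro divide_right_mono) auto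
      then show ?thesis unfolding F using True False S by (simp add: inv_sus_def h_def power2_eq_square)
    next
      case nb: False
      have "S + 2 * (c u * c v) \<le> sus B (insert {u, v} \<omega>)"
        using sus_insert[OF assms(1,2) uv(1,2) False] by (simp add: S_def c_def algebra_simps)
      then have "1 / sus B (insert {u, v} \<omega>) \<le> 1 / (S + 2 * (c u * c v))"
        using S ab by (intro frac_le) auto
      \<comment> \<open>With \<open>h = c u * c v\<close>, the product
        \<open>(S - h) * (S + 2 * h)\<close> equals \<open>S^2 + h * (S - 2 * h)\<close>, and
        \<open>2 * h \<le> S\<close> because neither cluster exceeds \<open>m\<close>.\<close>
      also have "\<dots> \<le> 1 / S - c u * c v / S\<^sup>2"
      proof -
        have "c u * c v * (2 * (c u * c v)) \<le> c u * c v * S" using ab by (intro mult_left_mono) auto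
        then have "S\<^sup>2 \<le> (S - c u * c v) * (S + 2 * (c u * c v))"
          by (simp add: algebra_simps power2_eq_square)
        then show ?thesis using S ab by (simp add: field_simps power2_eq_square)
      qed
      finally show ?thesis unfolding F using nb False by (simp add: inv_sus_def h_def)
    qed
  qed
  \<comment> \<open>All ordered pairs give \<open>S^2\<close>; pairs within one cluster remove the
    sum of \<open>c u ^ 3\<close>, at most half of it since
    \<open>(c u)^2 \<le> m^2 \<le> S / 2\<close>. Each edge comes from two ordered pairs, whence the
    final \<open>1 / 4\<close>.\<close>
  have hsum: "S\<^sup>2 / 2 \<le> (\<Sum>u\<in>B. \<Sum>v\<in>B - {u}. h u v)"
  proof -
    have "(\<Sum>v\<in>B - {u}. h u v) = c u * S - c u * (c u)\<^sup>2" if u: "u \<in> B" for u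
    proof -
      have "(\<Sum>v\<in>B - {u}. h u v) = (\<Sum>v\<in>B. h u v)"
        using assms(1) u by (simp add: sum.remove[of B u] h_def)
      also have "\<dots> = (\<Sum>v\<in>B. c u * c v - (if v \<in> clus \<omega> u then c u * c u else 0))"
      proof (rule sum.cong[OF refl])
        fix v
        have "c v = c u" if "v \<in> clus \<omega> u" using cluster_eq[OF that] by (simp add: c_def)
        then show "h u v = c u * c v - (if v \<in> clus \<omega> u then c u * c u else 0)" by (simp add: h_def)
      qed
      also have "\<dots> = c u * S - c u * (c u * c u)"
        unfolding sum_subtractf sum_distrib_left[symmetric] sum_if_mem[OF assms(1)] by (simp add: S_def sus_def c_def)
      finally show ?thesis by (simp add: power2_eq_square)
    qed
    then have "(\<Sum>u\<in>B. \<Sum>v\<in>B - {u}. h u v) = (\<Sum>u\<in>B. c u * S - c u * (c u)\<^sup>2)" by simp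
    also have "\<dots> \<ge> (\<Sum>u\<in>B. c u * (S / 2))"
    proof (rule sum_mono)
      fix u assume u: "u \<in> B"
      have "(c u)\<^sup>2 \<le> (real m)\<^sup>2" using cm[OF u] c by (intro power_mono) auto
      then have "S / 2 \<le> S - (c u)\<^sup>2" using S by linarith
      then have "c u * (S / 2) \<le> c u * (S - (c u)\<^sup>2)" using c by (intro mult_left_mono) auto
      then show "c u * (S / 2) \<le> c u * S - c u * (c u)\<^sup>2" by (simp add: algebra_simps)
    qed
    finally show ?thesis
      by (simp add: sum_distrib_right[symmetric] sum_divide_distrib[symmetric] S_def sus_def c_def power2_eq_square)
  qed
  have "2 * (\<Sum>e\<in>edges B. inv_sus B m (insert e \<omega>) - inv_sus B m \<omega>)
      = (\<Sum>u\<in>B. \<Sum>v\<in>B - {u}. inv_sus B m (insert {u, v} \<omega>) - inv_sus B m \<omega>)"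
    using sum_edges[OF assms(1), of "\<lambda>e. inv_sus B m (insert e \<omega>) - inv_sus B m \<omega>"] by simp
  also have "\<dots> \<le> (\<Sum>u\<in>B. \<Sum>v\<in>B - {u}. - h u v / S\<^sup>2)" using step by (intro sum_mono) auto
  also have "\<dots> = - (\<Sum>u\<in>B. \<Sum>v\<in>B - {u}. h u v) / S\<^sup>2"
    by (simp add: sum_negf sum_divide_distrib)
  also have "\<dots> \<le> - (S\<^sup>2 / 2) / S\<^sup>2" using hsum by (intro divide_right_mono) auto
  also have "\<dots> = - 1 / 2" using S by simp
  finally show ?thesis by simp
qed

text \<open>The potential \<open>inv_sus\<close> starts at most at \<open>q / 8\<close> and
  decreases at least at rate \<open>1 / 4\<close> times the probability that no big cluster has
  appeared. That probability is nonincreasing in time, so up to time \<open>q\<close> the loss is at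
  least \<open>q / 4\<close> times its final value; since the potential stays nonnegative, this
  value is at most \<open>1 / 2\<close>.\<close>

lemma sprinkling_fixed:
  assumes "finite B" "\<omega>0 \<subseteq> edges B" "0 < q" "q * (real m)\<^sup>2 \<le> 4" "8 / q \<le> sus B \<omega>0"
  shows "bern (edges B) (\<lambda>_. q) (\<lambda>\<omega>. of_bool (\<not> big B m (\<omega>0 \<union> \<omega>))) \<le> 1 / 2"
proof -
  let ?E = "edges B"
  define F where "F = (\<lambda>\<omega>. inv_sus B m (\<omega>0 \<union> \<omega>))"
  define g where "g = (\<lambda>t. bern ?E (\<lambda>_. t) F)"
  define P where "P = (\<lambda>t. bern ?E (\<lambda>_. t) (\<lambda>\<omega>. of_bool (\<not> big B m (\<omega>0 \<union> \<omega>)) :: real))"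
  have fin: "finite ?E" using assms finite_edges by auto
  have S0: "0 < sus B \<omega>0" using assms by (meson divide_pos_pos less_le_trans zero_less_numeral)
  have "2 * (real m)\<^sup>2 \<le> 8 / q" using assms by (simp add: field_simps)
  then have S1: "2 * (real m)\<^sup>2 \<le> sus B \<omega>0" using assms by linarith
  have S: "sus B \<omega>0 \<le> sus B (\<omega>0 \<union> \<omega>)" for \<omega> using assms by (intro sus_mono) auto
  have nn: "0 \<le> F \<omega>" for \<omega>
    using S[of \<omega>] S0 by (simp add: F_def inv_sus_def)
  have F0: "F {} \<le> q / 8"
  proof -
    have "1 / sus B \<omega>0 \<le> 1 / (8 / q)" using assms by (intro frac_le) auto
    then show ?thesis using assms by (auto simp: F_def inv_sus_def)
  qed
  have drift: "(\<Sum>e\<in>?E. F (insert e \<omega>) - F \<omega>) \<le> (- 1 / 4) * of_bool (\<not> big B m (\<omega>0 \<union> \<omega>))"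
    if "\<omega> \<subseteq> ?E" for \<omega>
  proof (cases "big B m (\<omega>0 \<union> \<omega>)")
    case True
    then have "F (insert e \<omega>) - F \<omega> = 0" for e
      using big_mono[OF assms(1) True, of "\<omega>0 \<union> insert e \<omega>"] by (auto simp: F_def inv_sus_def)
    then show ?thesis using True by simp
  next
    case False
    have "(\<Sum>e\<in>?E. inv_sus B m (insert e (\<omega>0 \<union> \<omega>)) - inv_sus B m (\<omega>0 \<union> \<omega>)) \<le> - 1 / 4"
      by (rule inv_sus_drift) (use assms that False S[of \<omega>] S0 S1 in auto)
    then show ?thesis using False by (simp add: F_def)
  qed
  have deriv: "(g has_real_derivative bern ?E (\<lambda>_. t) (\<lambda>\<omega>. \<Sum>e\<in>?E. F (insert e \<omega>) - F \<omega>)) (at t)" for t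
    unfolding g_def by (rule bern_Kolmogorov[OF fin])
  obtain t where t: "0 < t" "t < q"
    "g q - g 0 = (q - 0) * bern ?E (\<lambda>_. t) (\<lambda>\<omega>. \<Sum>e\<in>?E. F (insert e \<omega>) - F \<omega>)"
    using MVT2[OF assms(3) deriv] by blast
  have "bern ?E (\<lambda>_. t) (\<lambda>\<omega>. \<Sum>e\<in>?E. F (insert e \<omega>) - F \<omega>) \<le> (- 1 / 4) * P t"
    unfolding P_def bern_cmult[symmetric] using t drift by (intro bern_mono) auto
  also have "\<dots> \<le> (- 1 / 4) * P q"
  proof -
    have "bern ?E (\<lambda>_. t) (\<lambda>\<omega>. - of_bool (\<not> big B m (\<omega>0 \<union> \<omega>)))
        \<le> bern ?E (\<lambda>_. q) (\<lambda>\<omega>. - of_bool (\<not> big B m (\<omega>0 \<union> \<omega>)))"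
    proof (rule bern_mono_weights[OF fin])
      fix \<omega> \<omega>' :: "'a set set" assume "\<omega> \<subseteq> \<omega>'"
      then have "big B m (\<omega>0 \<union> \<omega>) \<Longrightarrow> big B m (\<omega>0 \<union> \<omega>')" 
        using big_mono[OF assms(1), of m "\<omega>0 \<union> \<omega>" "\<omega>0 \<union> \<omega>'"] by auto
      then show "- of_bool (\<not> big B m (\<omega>0 \<union> \<omega>)) \<le> (- of_bool (\<not> big B m (\<omega>0 \<union> \<omega>')) :: real)" by auto
    qed (use t in auto)
    then show ?thesis using bern_cmult[of ?E _ "-1"] by (simp add: P_def)
  qed
  finally have "g q - g 0 \<le> q * ((- 1 / 4) * P q)"
    unfolding t(3) diff_0_right using assms(3) by (intro mult_left_mono) auto
  moreover have "g 0 = F {}"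
  proof -
    have "bern E (\<lambda>_. 0) G = G {}" if "finite E" for E and G :: "'a set set \<Rightarrow> real"
      using that by (induction E arbitrary: G rule: finite_induct) (auto simp: bern_insert)
    then show ?thesis using fin by (simp add: g_def)
  qed
  moreover have "0 \<le> g q" unfolding g_def using assms nn by (intro bern_nonneg) auto
  ultimately have "q * (P q / 4) \<le> q * (1 / 8)" using F0 by simp
  then have "P q \<le> 1 / 2" using assms(3) by (subst (asm) mult_le_cancel_left_pos) auto
  then show ?thesis by (simp add: P_def)
qed

lemma sprinkling:
  assumes "finite B" "\<And>e. e \<in> edges B \<Longrightarrow> 0 \<le> w e" "0 < q" "q * (real m)\<^sup>2 \<le> 4"
  shows "bern (edges B) w (\<lambda>\<omega>. of_bool (8 / q \<le> sus B \<omega>))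
    \<le> 2 * bern (edges B) (\<lambda>e. w e + q) (\<lambda>\<omega>. of_bool (big B m \<omega>))"
proof -
  have fin: "finite (edges B)" using assms finite_edges by auto
  have "bern (edges B) w (\<lambda>\<omega>. of_bool (8 / q \<le> sus B \<omega>))
    \<le> bern (edges B) w (\<lambda>\<omega>. 2 * bern (edges B) (\<lambda>_. q) (\<lambda>\<omega>'. of_bool (big B m (\<omega> \<union> \<omega>'))))"
  proof (rule bern_mono)
    fix \<omega> assume \<omega>: "\<omega> \<subseteq> edges B"
    let ?b = "\<lambda>\<omega>'. of_bool (big B m (\<omega> \<union> \<omega>')) :: real"
    have "bern (edges B) (\<lambda>_. q) ?b = 1 - bern (edges B) (\<lambda>_. q) (\<lambda>\<omega>'. of_bool (\<not> big B m (\<omega> \<union> \<omega>')))"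
      using fin by (simp add: of_bool_not_iff bern_diff)
    moreover have "0 \<le> bern (edges B) (\<lambda>_. q) ?b" using assms by (intro bern_nonneg) auto
    ultimately show "of_bool (8 / q \<le> sus B \<omega>) \<le> 2 * bern (edges B) (\<lambda>_. q) ?b"
      using sprinkling_fixed[OF assms(1) \<omega> assms(3,4)] by auto
  qed (use assms in auto)
  also have "\<dots> = 2 * bern (edges B) (\<lambda>e. w e + q) (\<lambda>\<omega>. of_bool (big B m \<omega>))"
    using bern_add_weights[OF fin, of w "\<lambda>_. q"] by (simp add: bern_cmult)
  finally show ?thesis .
qed

section \<open>One step of renormalisation\<close>

lemma bern_avoid:
  assumes "finite E" "X \<subseteq> E"
  shows "bern E w (\<lambda>\<omega>. of_bool (\<omega> \<inter> X = {})) = exp (- (\<Sum>e\<in>X. w e))"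
proof -
  have fin: "finite X" using assms finite_subset by auto
  have "bern E w (\<lambda>\<omega>. of_bool (\<omega> \<inter> X = {})) = bern X w (\<lambda>\<omega>. of_bool (\<omega> = {}))"
    by (rule bern_restrict[OF assms])
  also have "\<dots> = exp (- (\<Sum>e\<in>X. w e))"
    using fin by (induction X rule: finite_induct)
      (auto simp: bern_insert bern_def[of _ _ "\<lambda>_. 0"] exp_add[symmetric] algebra_simps)
  finally show ?thesis .
qed

lemma clus_star:
  assumes "finite U" "\<And>i. i \<in> G \<Longrightarrow> C i \<subseteq> U" "disjoint_family_on C G" "finite G" "s \<in> G"
    and "\<And>i. i \<in> G \<Longrightarrow> x i \<in> C i" "\<And>i. i \<in> G \<Longrightarrow> C i \<subseteq> clus \<omega> (x i)" "\<And>i. i \<in> G \<Longrightarrow> m \<le> card (C i)"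
    and "\<And>i. i \<in> G - {s} \<Longrightarrow> \<exists>u\<in>C s. \<exists>v\<in>C i. {u, v} \<in> \<omega>"
  shows "big U (card G * m) \<omega>"
proof -
  have "C i \<subseteq> clus \<omega> (x s)" if i: "i \<in> G" for i
  proof (cases "i = s")
    case False
    then obtain u v where uv: "u \<in> C s" "v \<in> C i" "{u, v} \<in> \<omega>" using assms(9)[of i] i by auto
    have "u \<noteq> v" using uv i assms(3,5) False by (auto simp: disjoint_family_on_def)
    have "u \<in> clus \<omega> (x s)" using uv assms(5,7) by auto
    then have "v \<in> clus \<omega> (x s)" by (rule cluster_step) (use \<open>u \<noteq> v\<close> uv in auto)
    then have "clus \<omega> v = clus \<omega> (x s)" by (rule cluster_eq)
    moreover have "clus \<omega> v = clus \<omega> (x i)" using uv i assms(7) by (intro cluster_eq) auto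
    ultimately show ?thesis using assms(7)[OF i] by simp
  qed (use assms i in auto)
  then have "(\<Union>i\<in>G. C i) \<subseteq> clus \<omega> (x s) \<inter> U" using assms(2) by auto
  then have "card (\<Union>i\<in>G. C i) \<le> card (clus \<omega> (x s) \<inter> U)" using assms(1) by (intro card_mono) auto
  moreover have "card (\<Union>i\<in>G. C i) = (\<Sum>i\<in>G. card (C i))"
    using assms finite_subset[OF assms(2) assms(1)] by (intro card_UN_disjoint) (auto simp: disjoint_family_on_def)
  moreover have "card G * m \<le> (\<Sum>i\<in>G. card (C i))"
    using sum_bounded_below[of G m "\<lambda>i. card (C i)"] assms(8) by simp
  moreover have "x s \<in> U" using assms by auto
  ultimately show ?thesis unfolding big_def by (metis le_trans)
qed

text \<open>With at most one bad sub-box, the large cluster of one good sub-box is joined directly to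
  those of all the other good ones.\<close>

lemma renormalisation_step:
  assumes I: "finite I" "2 \<le> card I" and B: "\<And>i. i \<in> I \<Longrightarrow> finite (B i)" "disjoint_family_on B I"
    and U: "U = (\<Union>i\<in>I. B i)" and w: "\<And>e. e \<in> edges U \<Longrightarrow> t \<le> w e" "0 \<le> t"
    and \<epsilon>: "\<And>i. i \<in> I \<Longrightarrow> bern (edges (B i)) w (\<lambda>\<omega>. of_bool (\<not> big (B i) m \<omega>)) \<le> \<epsilon>"
  shows "bern (edges U) w (\<lambda>\<omega>. of_bool (\<not> big U ((card I - 1) * m) \<omega>))
    \<le> (real (card I))\<^sup>2 * \<epsilon>\<^sup>2 + real (card I) * exp (- t * (real m)\<^sup>2)"
proof -
  define bad where "bad = (\<lambda>i \<omega>. \<not> big (B i) m (\<omega> \<inter> edges (B i)))"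
  \<comment> \<open>The edges inside the sub-boxes decide which of them are good; the cross edges
    are independent of this information and are revealed second.\<close>
  define Ein where "Ein = (\<Union>i\<in>I. edges (B i))"
  define Ecr where "Ecr = edges U - Ein"
  define M where "M = (card I - 1) * m"
  define one where "one = (\<lambda>\<omega>. \<forall>i\<in>I. \<forall>j\<in>I. i \<noteq> j \<longrightarrow> \<not> (bad i \<omega> \<and> bad j \<omega>))"
  have finU: "finite U" using U I B by auto
  have fin: "finite (edges U)" "finite Ein" "finite Ecr"
    using finite_edges I B finU by (auto simp: Ein_def Ecr_def)
  have sub: "edges (B i) \<subseteq> edges U" if "i \<in> I" for i using that U by (intro edges_mono) auto
  then have Ein: "Ein \<subseteq> edges U" by (auto simp: Ein_def)
  have w0: "0 \<le> w e" if "e \<in> edges U" for e using w(1)[OF that] w(2) by linarith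
  have \<epsilon>0: "0 \<le> \<epsilon>"
  proof -
    obtain i where i: "i \<in> I" using I by fastforce
    have "0 \<le> bern (edges (B i)) w (\<lambda>\<omega>. of_bool (\<not> big (B i) m \<omega>))"
      using w0 sub[OF i] by (intro bern_nonneg) auto
    then show ?thesis using \<epsilon>[OF i] by linarith
  qed
  let ?b = "bern (edges U) w"
  have two: "?b (\<lambda>\<omega>. of_bool (bad i \<omega>) * of_bool (bad j \<omega>)) \<le> \<epsilon>\<^sup>2" if ij: "i \<in> I" "j \<in> I" "i \<noteq> j" for i j
  proof -
    have "?b (\<lambda>\<omega>. of_bool (bad i \<omega>) * of_bool (bad j \<omega>))
      = bern (edges (B i)) w (\<lambda>\<omega>. of_bool (\<not> big (B i) m \<omega>)) * bern (edges (B j)) w (\<lambda>\<omega>. of_bool (\<not> big (B j) m \<omega>))"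
      unfolding bad_def using sub ij B(2)
      by (intro bern_product fin edges_disjoint) (auto simp: disjoint_family_on_def)
    also have "\<dots> \<le> \<epsilon> * \<epsilon>"
      using \<epsilon> \<epsilon>0 ij w0 sub by (intro mult_mono bern_nonneg) auto
    finally show ?thesis by (simp add: power2_eq_square)
  qed
  have star: "bern Ecr w (\<lambda>\<omega>2. of_bool (\<not> big U M (\<omega>1 \<union> \<omega>2))) \<le> real (card I) * exp (- t * (real m)\<^sup>2)"
    if \<omega>1: "\<omega>1 \<subseteq> Ein" "one \<omega>1" for \<omega>1
  proof -
    define G where "G = {i\<in>I. \<not> bad i \<omega>1}"
    have "card (I - G) \<le> 1"
    proof (rule ccontr)
      assume "\<not> card (I - G) \<le> 1"
      then obtain i j where "i \<in> I - G" "j \<in> I - G" "i \<noteq> j"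
        by (metis One_nat_def card.infinite card_le_Suc0_iff_eq zero_le)
      then show False using \<omega>1(2) by (auto simp: one_def G_def)
    qed
    moreover have "card (I - G) = card I - card G" using I by (intro card_Diff_subset) (auto simp: G_def)
    ultimately have cG: "card I - 1 \<le> card G" by linarith
    have finG: "finite G" using I by (auto simp: G_def)
    have "G \<noteq> {}" using cG I by auto
    then obtain i0 where i0: "i0 \<in> G" by auto
    have "\<forall>i\<in>G. \<exists>x\<in>B i. m \<le> card (clus (\<omega>1 \<inter> edges (B i)) x \<inter> B i)"
      by (auto simp: G_def bad_def big_def)
    then obtain x where x: "\<And>i. i \<in> G \<Longrightarrow> x i \<in> B i"
      "\<And>i. i \<in> G \<Longrightarrow> m \<le> card (clus (\<omega>1 \<inter> edges (B i)) (x i) \<inter> B i)" by metis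
    define C where "C = (\<lambda>i. clus (\<omega>1 \<inter> edges (B i)) (x i) \<inter> B i)"
    have CB: "C i \<subseteq> B i" for i by (auto simp: C_def)
    have GI: "i \<in> I" if "i \<in> G" for i using that by (auto simp: G_def)
    have finC: "finite (C i)" if "i \<in> G" for i using B(1)[OF GI[OF that]] CB[of i] finite_subset by auto
    have disjC: "disjoint_family_on C G"
      using B(2) GI CB unfolding disjoint_family_on_def by blast
    \<comment> \<open>The potential direct edges between the cluster of the centre \<open>i0\<close>
      and that of \<open>i\<close>. There are at least \<open>m * m\<close> of them, each of weight
      at least \<open>t\<close>, so all are closed with probability at most
      \<open>exp (- t * m^2)\<close>.\<close>
    define X where "X = (\<lambda>i. (\<lambda>(u, v). {u, v}) ` (C i0 \<times> C i))"
    have Xsub: "X i \<subseteq> Ecr" if i: "i \<in> G - {i0}" for i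
    proof
      fix e assume "e \<in> X i"
      then obtain u v where e: "e = {u, v}" "u \<in> C i0" "v \<in> C i" by (auto simp: X_def)
      have d: "B i0 \<inter> B i = {}" using B(2) i i0 GI by (auto simp: disjoint_family_on_def)
      have uv: "u \<in> B i0" "v \<in> B i" using e CB by auto
      have "e \<notin> edges (B j)" if j: "j \<in> I" for j
      proof
        assume "e \<in> edges (B j)"
        then have "u \<in> B j" "v \<in> B j" using e by (auto simp: edges_pair_iff)
        then have "j = i0" "j = i" using uv B(2) i i0 GI j unfolding disjoint_family_on_def by blast+
        then show False using i by auto
      qed
      moreover have "e \<in> edges U" using e uv d i i0 GI U by (auto simp: edges_pair_iff)
      ultimately show "e \<in> Ecr" by (auto simp: Ecr_def Ein_def)
    qed
    have Xavoid: "bern Ecr w (\<lambda>\<omega>2. of_bool (\<omega>2 \<inter> X i = {})) \<le> exp (- t * (real m)\<^sup>2)" if i: "i \<in> G - {i0}" for i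
    proof -
      have inj: "inj_on (\<lambda>(u, v). {u, v}) (C i0 \<times> C i)"
      proof -
        have "B i0 \<inter> B i = {}" using B(2) i i0 GI by (auto simp: disjoint_family_on_def)
        then show ?thesis using CB[of i] CB[of i0] by (auto simp: inj_on_def doubleton_eq_iff)
      qed
      have "m * m \<le> card (C i0) * card (C i)" using x(2) i i0 by (intro mult_le_mono) (auto simp: C_def)
      also have "\<dots> = card (X i)" unfolding X_def using inj by (simp add: card_image card_cartesian_product)
      finally have "t * (real m)\<^sup>2 \<le> t * real (card (X i))"
        using w(2) by (intro mult_left_mono) (auto simp: power2_eq_square simp flip: of_nat_mult)
      also have "\<dots> \<le> (\<Sum>e\<in>X i. w e)"
        using sum_bounded_below[of "X i" t w] w(1) Xsub[OF i] by (auto simp: Ecr_def mult.commute)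
      finally show ?thesis using bern_avoid[OF fin(3) Xsub[OF i], of w] by simp
    qed
    have "bern Ecr w (\<lambda>\<omega>2. of_bool (\<not> big U M (\<omega>1 \<union> \<omega>2)))
        \<le> bern Ecr w (\<lambda>\<omega>2. \<Sum>i\<in>G - {i0}. of_bool (\<omega>2 \<inter> X i = {}))"
    proof (rule bern_mono)
      fix \<omega>2 assume "\<omega>2 \<subseteq> Ecr"
      show "of_bool (\<not> big U M (\<omega>1 \<union> \<omega>2)) \<le> (\<Sum>i\<in>G - {i0}. of_bool (\<omega>2 \<inter> X i = {}) :: real)"
      proof (cases "\<exists>i\<in>G - {i0}. \<omega>2 \<inter> X i = {}")
        case True
        then obtain i where i: "i \<in> G - {i0}" "\<omega>2 \<inter> X i = {}" by auto
        have "of_bool (\<not> big U M (\<omega>1 \<union> \<omega>2)) \<le> (of_bool (\<omega>2 \<inter> X i = {}) :: real)" using i by simp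
        also have "\<dots> \<le> (\<Sum>i\<in>G - {i0}. of_bool (\<omega>2 \<inter> X i = {}))"
          using i finG by (intro member_le_sum) auto
        finally show ?thesis .
      next
        case False
        have "big U (card G * m) (\<omega>1 \<union> \<omega>2)"
        proof (rule clus_star[where C = C and x = x and s = i0])
          fix i assume i: "i \<in> G - {i0}"
          then have "\<omega>2 \<inter> X i \<noteq> {}" using False by auto
          then show "\<exists>u\<in>C i0. \<exists>v\<in>C i. {u, v} \<in> \<omega>1 \<union> \<omega>2" by (auto simp: X_def)
        next
          fix i assume i: "i \<in> G"
          show "C i \<subseteq> U" using CB[of i] GI[OF i] U by auto
          show "x i \<in> C i" using x(1)[OF i] by (simp add: C_def)
          show "C i \<subseteq> clus (\<omega>1 \<union> \<omega>2) (x i)"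
            using clus_mono[of "\<omega>1 \<inter> edges (B i)" "\<omega>1 \<union> \<omega>2" "x i"] by (auto simp: C_def)
          show "m \<le> card (C i)" using x(2)[OF i] by (simp add: C_def)
        qed (use finU finG disjC i0 in auto)
        moreover have "M \<le> card G * m" using cG by (simp add: M_def)
        ultimately have "big U M (\<omega>1 \<union> \<omega>2)" unfolding big_def by (meson le_trans)
        then show ?thesis by (simp add: sum_nonneg)
      qed
    qed (use w0 in \<open>auto simp: Ecr_def\<close>)
    also have "\<dots> \<le> (\<Sum>i\<in>G - {i0}. exp (- t * (real m)\<^sup>2))"
      unfolding bern_sum using Xavoid by (intro sum_mono) auto
    also have "\<dots> \<le> real (card I) * exp (- t * (real m)\<^sup>2)"
    proof -
      have "card (G - {i0}) \<le> card I" using I by (intro card_mono) (auto simp: G_def)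
      then show ?thesis by simp
    qed
    finally show ?thesis .
  qed
  \<comment> \<open>Either two sub-boxes are bad, which independence and a sum over pairs control,
    or at most one is bad and \<open>star\<close> applies.\<close>
  have "?b (\<lambda>\<omega>. of_bool (\<not> big U M \<omega>)) \<le>
     ?b (\<lambda>\<omega>. (\<Sum>i\<in>I. \<Sum>j\<in>I - {i}. of_bool (bad i \<omega>) * of_bool (bad j \<omega>)) + of_bool (one \<omega>) * of_bool (\<not> big U M \<omega>))"
  proof (rule bern_mono)
    fix \<omega> 
    let ?s = "\<Sum>i\<in>I. \<Sum>j\<in>I - {i}. of_bool (bad i \<omega>) * of_bool (bad j \<omega>) :: real"
    have "1 \<le> ?s" if "\<not> one \<omega>"
    proof -
      from that obtain i j where ij: "i \<in> I" "j \<in> I" "i \<noteq> j" "bad i \<omega>" "bad j \<omega>" by (auto simp: one_def)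
      have "1 = (of_bool (bad i \<omega>) * of_bool (bad j \<omega>) :: real)" using ij by simp
      also have "\<dots> \<le> (\<Sum>j\<in>I - {i}. of_bool (bad i \<omega>) * of_bool (bad j \<omega>))"
        using ij I by (intro member_le_sum) auto
      also have "\<dots> \<le> ?s" using ij I by (intro member_le_sum sum_nonneg) auto
      finally show ?thesis .
    qed
    moreover have "0 \<le> ?s" by (intro sum_nonneg) auto
    ultimately show "of_bool (\<not> big U M \<omega>) \<le> ?s + of_bool (one \<omega>) * of_bool (\<not> big U M \<omega>)"
      by (cases "one \<omega>"; cases "big U M \<omega>") auto
  qed (use w0 in auto)
  also have "\<dots> = (\<Sum>i\<in>I. \<Sum>j\<in>I - {i}. ?b (\<lambda>\<omega>. of_bool (bad i \<omega>) * of_bool (bad j \<omega>)))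
     + ?b (\<lambda>\<omega>. of_bool (one \<omega>) * of_bool (\<not> big U M \<omega>))"
    unfolding bern_add bern_sum ..
  also have "(\<Sum>i\<in>I. \<Sum>j\<in>I - {i}. ?b (\<lambda>\<omega>. of_bool (bad i \<omega>) * of_bool (bad j \<omega>))) \<le> (\<Sum>i\<in>I. \<Sum>j\<in>I - {i}. \<epsilon>\<^sup>2)"
    using two by (intro sum_mono) auto
  also have "\<dots> \<le> (\<Sum>i\<in>I. \<Sum>j\<in>I. \<epsilon>\<^sup>2)" using I by (intro sum_mono sum_mono2) auto
  also have "\<dots> = (real (card I))\<^sup>2 * \<epsilon>\<^sup>2" by (simp add: power2_eq_square)
  also have "?b (\<lambda>\<omega>. of_bool (one \<omega>) * of_bool (\<not> big U M \<omega>))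
      = bern (Ein \<union> Ecr) w (\<lambda>\<omega>. of_bool (one \<omega>) * of_bool (\<not> big U M \<omega>))"
    using Ein by (simp add: Ecr_def Un_absorb1)
  also have "\<dots> = bern Ein w (\<lambda>\<omega>1. bern Ecr w (\<lambda>\<omega>2. of_bool (one (\<omega>1 \<union> \<omega>2)) * of_bool (\<not> big U M (\<omega>1 \<union> \<omega>2))))"
    by (rule bern_union_disjoint) (use fin in \<open>auto simp: Ecr_def\<close>)
  also have "\<dots> = bern Ein w (\<lambda>\<omega>1. of_bool (one \<omega>1) * bern Ecr w (\<lambda>\<omega>2. of_bool (\<not> big U M (\<omega>1 \<union> \<omega>2))))"
  proof (rule bern_cong[OF refl])
    fix \<omega>1 assume "\<omega>1 \<subseteq> Ein"
    have "one (\<omega>1 \<union> \<omega>2) = one \<omega>1" if "\<omega>2 \<subseteq> Ecr" for \<omega>2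
    proof -
      have "(\<omega>1 \<union> \<omega>2) \<inter> edges (B i) = \<omega>1 \<inter> edges (B i)" if "i \<in> I" for i
        using that \<open>\<omega>2 \<subseteq> Ecr\<close> by (auto simp: Ecr_def Ein_def)
      then show ?thesis unfolding one_def bad_def by simp
    qed
    then show "bern Ecr w (\<lambda>\<omega>2. of_bool (one (\<omega>1 \<union> \<omega>2)) * of_bool (\<not> big U M (\<omega>1 \<union> \<omega>2)))
       = of_bool (one \<omega>1) * bern Ecr w (\<lambda>\<omega>2. of_bool (\<not> big U M (\<omega>1 \<union> \<omega>2)))"
      unfolding bern_cmult[symmetric] by (intro bern_cong) auto
  qed
  also have "\<dots> \<le> real (card I) * exp (- t * (real m)\<^sup>2)"
    using star w0 Ein by (intro bern_le_const fin) (auto simp: of_bool_def)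
  finally show ?thesis by (simp add: M_def)
qed

section \<open>Second moment of the cluster sizes\<close>

text \<open>The ratio of consecutive terms is \<open>9 * \<rho> ^ (2 ^ k)\<close>, which tends to
  0.\<close>

lemma summable_doubly_exponential:
  fixes \<rho> :: real
  assumes "0 \<le> \<rho>" "\<rho> < 1"
  shows "summable (\<lambda>k. 9 ^ k * \<rho> ^ (2 ^ k))"
proof -
  have "(\<lambda>n. \<rho> ^ n) \<longlonglongrightarrow> 0" using assms by (intro LIMSEQ_power_zero) auto
  then have "eventually (\<lambda>n. \<rho> ^ n < 1 / 18) sequentially" by (rule order_tendstoD) auto
  then obtain N where N: "\<And>n. n \<ge> N \<Longrightarrow> \<rho> ^ n < 1 / 18" by (auto simp: eventually_sequentially)
  show ?thesis
  proof (rule summable_ratio_test[where c = "1/2" and N = N])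
    fix k assume k: "N \<le> k"
    have "k \<le> 2 ^ k" by (simp add: less_imp_le)
    with k have "N \<le> 2 ^ k" by (rule le_trans)
    then have "\<rho> ^ (2 ^ k) \<le> 1 / 18" using N by (intro less_imp_le)
    then have "9 ^ k * \<rho> ^ (2 ^ k) * (9 * \<rho> ^ (2 ^ k)) \<le> 9 ^ k * \<rho> ^ (2 ^ k) * (1 / 2)"
      using assms by (intro mult_left_mono) auto
    moreover have "\<rho> ^ (2 ^ Suc k) = \<rho> ^ (2 ^ k) * \<rho> ^ (2 ^ k)" by (simp add: mult_2 power_add)
    ultimately show "norm (9 ^ Suc k * \<rho> ^ (2 ^ Suc k)) \<le> 1 / 2 * norm (9 ^ k * \<rho> ^ (2 ^ k))"
      using assms by (simp add: algebra_simps)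
  qed auto
qed

text \<open>A layer-cake bound along powers of 9, because squared sizes grow by 9 when sizes triple.
  The cap on \<open>x\<close> keeps the sum finite.\<close>

lemma le_sum_geometric_levels:
  fixes x y :: real
  assumes "0 < y" "x < y * 9 ^ K"
  shows "x \<le> y + (\<Sum>k<K. y * 9 ^ Suc k * of_bool (y * 9 ^ k \<le> x))"
  using assms(2)
proof (induction K)
  case (Suc K)
  show ?case
  proof (cases "x < y * 9 ^ K")
    case True
    then show ?thesis using Suc.IH assms by simp
  next
    case False
    have "0 \<le> (\<Sum>k<K. y * 9 ^ Suc k * of_bool (y * 9 ^ k \<le> x))" using assms by (intro sum_nonneg) auto
    then show ?thesis using False Suc.prems assms by simp
  qed
qed simp

lemma sus_le: "finite B \<Longrightarrow> sus B \<omega> \<le> (real (card B))\<^sup>2"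
proof -
  assume B: "finite B"
  have "sus B \<omega> \<le> (\<Sum>x\<in>B. real (card B))"
    unfolding sus_def using B by (intro sum_mono of_nat_mono card_mono) auto
  then show ?thesis by (simp add: power2_eq_square)
qed

text \<open>A large second moment at level \<open>k\<close> would be turned by sprinkling into a
  cluster of size \<open>3 ^ k * m\<close>, whose probability is at most
  \<open>\<rho> ^ (2 ^ k)\<close> by repeated splitting. The sprinkling rates for all
  \<open>k\<close> fit under the one gap \<open>4 / m^2\<close> between \<open>w\<close> and
  \<open>w'\<close>.\<close>

lemma bern_sus_le:
  assumes B: "finite B" and w: "\<And>e. e \<in> edges B \<Longrightarrow> 0 \<le> w e" "\<And>e. e \<in> edges B \<Longrightarrow> w e + 4 / (real m)\<^sup>2 \<le> w' e"
    and m: "1 \<le> m" and \<rho>: "bern (edges B) w' (\<lambda>\<omega>. of_bool (big B m \<omega>)) \<le> \<rho>" "\<rho> < 1"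
  shows "bern (edges B) w (sus B) \<le> (2 + 36 * (\<Sum>k. 9 ^ k * \<rho> ^ (2 ^ k))) * (real m)\<^sup>2"
proof -
  define y where "y = 2 * (real m)\<^sup>2"
  have "1 \<le> (real m)\<^sup>2" using m by (intro one_le_power) simp
  then have y: "1 \<le> y" by (simp add: y_def)
  have w': "0 \<le> w' e" if "e \<in> edges B" for e
  proof -
    have "0 \<le> 4 / (real m)\<^sup>2" by simp
    then show ?thesis using w[OF that] by linarith
  qed
  have fin: "finite (edges B)" using B finite_edges by auto
  have \<rho>0: "0 \<le> \<rho>"
    using \<rho>(1) bern_nonneg[of "edges B" w' "\<lambda>\<omega>. of_bool (big B m \<omega>)"] w' by fastforce
  have tail: "bern (edges B) w (\<lambda>\<omega>. of_bool (y * 9 ^ k \<le> sus B \<omega>)) \<le> 2 * \<rho> ^ (2 ^ k)" for k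
  proof -
    \<comment> \<open>The largest rate allowed by \<open>sprinkling\<close> for clusters of size
      \<open>3 ^ k * m\<close>; the matching threshold \<open>8 / q\<close> is exactly
      \<open>y * 9 ^ k\<close>.\<close>
    define q where "q = 4 / (real (3 ^ k * m))\<^sup>2"
    have q: "0 < q" "q * (real (3 ^ k * m))\<^sup>2 \<le> 4" using m by (auto simp: q_def)
    have nine: "((3::real) ^ k)\<^sup>2 = 9 ^ k" by (simp add: power_mult[symmetric] power_mult mult.commute[of k])
    have "8 / q = y * 9 ^ k" using m by (simp add: q_def y_def power_mult_distrib nine)
    then have "bern (edges B) w (\<lambda>\<omega>. of_bool (y * 9 ^ k \<le> sus B \<omega>))
        \<le> 2 * bern (edges B) (\<lambda>e. w e + q) (\<lambda>\<omega>. of_bool (big B (3 ^ k * m) \<omega>))"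
      using sprinkling[OF B w(1) q] by simp
    also have "bern (edges B) (\<lambda>e. w e + q) (\<lambda>\<omega>. of_bool (big B (3 ^ k * m) \<omega>))
       \<le> bern (edges B) w' (\<lambda>\<omega>. of_bool (big B (3 ^ k * m) \<omega>))"
    proof (rule bern_mono_weights[OF fin])
      fix e assume e: "e \<in> edges B"
      have "m \<le> 3 ^ k * m" by simp
      then have "(real m)\<^sup>2 \<le> (real (3 ^ k * m))\<^sup>2" by (intro power_mono of_nat_mono) auto
      then have "q \<le> 4 / (real m)\<^sup>2" unfolding q_def using m by (intro divide_left_mono) auto
      then show "w e + q \<le> w' e" using w(2)[OF e] by linarith
    next
      fix \<omega> \<omega>' :: "'a set set" assume "\<omega> \<subseteq> \<omega>'"
      then show "of_bool (big B (3 ^ k * m) \<omega>) \<le> (of_bool (big B (3 ^ k * m) \<omega>') :: real)"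
        using big_mono[OF B, of _ \<omega> \<omega>'] by auto
    qed (use w q in \<open>auto intro: add_nonneg_nonneg\<close>)
    also have "\<dots> \<le> bern (edges B) w' (\<lambda>\<omega>. of_bool (big B m \<omega>)) ^ (2 ^ k)"
      by (rule bern_big_power[OF B w' m])
    also have "\<dots> \<le> \<rho> ^ (2 ^ k)" using \<rho> w' by (intro power_mono bern_nonneg) auto
    finally show ?thesis by simp
  qed
  obtain K where K: "(real (card B))\<^sup>2 < 9 ^ K" using real_arch_pow[of 9 "(real (card B))\<^sup>2"] by auto
  have "bern (edges B) w (sus B)
      \<le> bern (edges B) w (\<lambda>\<omega>. y + (\<Sum>k<K. y * 9 ^ Suc k * of_bool (y * 9 ^ k \<le> sus B \<omega>)))"
  proof (intro bern_mono le_sum_geometric_levels)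
    fix \<omega>
    have "sus B \<omega> < 9 ^ K" using sus_le[OF B, of \<omega>] K by linarith
    also have "\<dots> \<le> y * 9 ^ K" using y by simp
    finally show "sus B \<omega> < y * 9 ^ K" .
  qed (use w y in auto)
  also have "\<dots> = y + (\<Sum>k<K. y * 9 ^ Suc k * bern (edges B) w (\<lambda>\<omega>. of_bool (y * 9 ^ k \<le> sus B \<omega>)))"
    unfolding bern_add bern_sum bern_cmult using fin by simp
  also have "\<dots> \<le> y + (\<Sum>k<K. y * 9 ^ Suc k * (2 * \<rho> ^ (2 ^ k)))"
    using tail y by (intro add_left_mono sum_mono mult_left_mono) auto
  also have "\<dots> = y + 18 * y * (\<Sum>k<K. 9 ^ k * \<rho> ^ (2 ^ k))"
    by (simp add: sum_distrib_left algebra_simps)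
  also have "\<dots> \<le> y + 18 * y * (\<Sum>k. 9 ^ k * \<rho> ^ (2 ^ k))"
    using y \<rho>0 summable_doubly_exponential[OF \<rho>0 \<rho>(2)]
    by (intro add_left_mono mult_left_mono sum_le_suminf) auto
  finally show ?thesis by (simp add: y_def algebra_simps)
qed

section \<open>The Simon--Lieb inequality and its iteration\<close>

definition conn :: "'v set \<Rightarrow> ('v set \<Rightarrow> real) \<Rightarrow> 'v \<Rightarrow> 'v \<Rightarrow> real" where
  "conn V w x y = bern (edges V) w (\<lambda>\<omega>. of_bool (y \<in> clus \<omega> x))"

lemma conn_nonneg:
  assumes "\<And>e. e \<in> edges V \<Longrightarrow> 0 \<le> w e" shows "0 \<le> conn V w x y"
  unfolding conn_def using assms by (intro bern_nonneg) auto

lemma conn_le_1: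
  assumes "finite V" "\<And>e. e \<in> edges V \<Longrightarrow> 0 \<le> w e" shows "conn V w x y \<le> 1"
  unfolding conn_def using assms by (intro bern_le_const finite_edges) auto

lemma conn_outside:
  assumes "x \<in> V" "y \<notin> V" shows "conn V w x y = 0"
proof -
  have "conn V w x y = bern (edges V) w (\<lambda>_. 0)"
    unfolding conn_def using clus_subset[OF _ assms(1)] assms(2) by (intro bern_cong) auto
  then show ?thesis by (simp add: bern_def)
qed

lemma conn_mono:
  assumes "finite V" "V' \<subseteq> V" "\<And>e. e \<in> edges V \<Longrightarrow> 0 \<le> w e"
  shows "conn V' w x y \<le> conn V w x y"
proof -
  have "conn V' w x y = bern (edges V) w (\<lambda>\<omega>. of_bool (y \<in> clus (\<omega> \<inter> edges V') x))"
    unfolding conn_def using assms by (intro bern_restrict[symmetric] finite_edges edges_mono)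
  also have "\<dots> \<le> conn V w x y"
    unfolding conn_def
  proof (rule bern_mono)
    fix \<omega> show "of_bool (y \<in> clus (\<omega> \<inter> edges V') x) \<le> (of_bool (y \<in> clus \<omega> x) :: real)"
      using clus_mono[of "\<omega> \<inter> edges V'" \<omega> x] by auto
  qed (use assms in auto)
  finally show ?thesis .
qed

lemma sum_conn:
  assumes "finite V"
  shows "(\<Sum>y\<in>V. conn V w x y) = bern (edges V) w (\<lambda>\<omega>. real (card (clus \<omega> x \<inter> V)))"
proof -
  have "real (card (clus \<omega> x \<inter> V)) = (\<Sum>y\<in>V. of_bool (y \<in> clus \<omega> x))" for \<omega>
    using sum_if_mem[OF assms, of "clus \<omega> x" 1] by (simp add: of_bool_def)
  then show ?thesis unfolding conn_def by (simp add: bern_sum)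
qed

lemma sum_conn_sus:
  assumes "finite V"
  shows "(\<Sum>x\<in>V. \<Sum>y\<in>V. conn V w x y) = bern (edges V) w (sus V)"
  unfolding sum_conn[OF assms] sus_def[abs_def] bern_sum ..

text \<open>\<open>{a, b}\<close> is the edge by which a path from \<open>u\<close> to \<open>x\<close> leaves, for the last time, the cluster
  of \<open>u\<close> inside \<open>S\<close>.\<close>

lemma conn_witness:
  assumes "\<omega> \<subseteq> edges V" "S \<subseteq> V" "u \<in> S" "x \<in> V" "x \<in> clus \<omega> u" "x \<notin> clus (\<omega> \<inter> edges S) u"
  obtains a b I J where "a \<in> S" "b \<in> V - S" "I \<subseteq> \<omega>" "J \<subseteq> \<omega>" "I \<inter> J = {}"
    "a \<in> clus (I \<inter> edges S) u" "{a, b} \<in> I" "x \<in> clus J b"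
proof -
  define C where "C = clus (\<omega> \<inter> edges S) u"
  \<comment> \<open>Disjointness of the witnesses comes from \<open>C\<close>: edges of
    \<open>J\<close> avoid it, whereas every edge put into \<open>I\<close> below meets it.\<close>
  define J where "J = \<omega> \<inter> edges (V - C)"
  define D where "D = clus J x"
  have CS: "C \<subseteq> S" unfolding C_def by (rule clus_subset) (use assms in auto)
  have xVC: "x \<in> V - C" using assms by (simp add: C_def)
  have DV: "D \<subseteq> V - C" unfolding D_def by (rule clus_subset) (use xVC in \<open>auto simp: J_def\<close>)
  have "u \<in> C" by (simp add: C_def)
  then have "u \<notin> D" using DV by auto
  moreover have "u \<in> clus \<omega> x" using assms(5) cluster_sym by metis
  moreover have "x \<in> D" by (simp add: D_def)
  ultimately obtain b a where ba: "b \<in> D" "a \<notin> D" "{b, a} \<in> \<omega>"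
    using cluster_exit[of u "\<lambda>e. e \<in> \<omega>" x D] by metis
  have "b \<in> V - C" using ba DV by auto
  have "{b, a} \<in> edges V" using ba assms(1) by auto
  then have ab: "a \<in> V" "b \<noteq> a" by (auto simp: edges_pair_iff)
  have aC: "a \<in> C"
  proof (rule ccontr)
    assume "a \<notin> C"
    then have "{b, a} \<in> J" using ba ab \<open>b \<in> V - C\<close> by (auto simp: J_def edges_pair_iff)
    then have "a \<in> D" unfolding D_def by - (rule cluster_step[of b], use ba ab in \<open>auto simp: D_def\<close>)
    then show False using ba by auto
  qed
  have bS: "b \<notin> S"
  proof
    assume "b \<in> S"
    then have "{a, b} \<in> \<omega> \<inter> edges S" using ba ab aC CS by (auto simp: edges_pair_iff insert_commute)
    then have "b \<in> C" unfolding C_def by - (rule cluster_step[of a], use aC ab in \<open>auto simp: C_def\<close>)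
    then show False using \<open>b \<in> V - C\<close> by auto
  qed
  define I where "I = insert {a, b} {e \<in> \<omega> \<inter> edges S. e \<inter> C \<noteq> {}}"
  have "y \<in> clus (I \<inter> edges S) u" if "y \<in> C" for y
    using that unfolding C_def
  proof (induction rule: cluster_induct)
    case (step y z)
    have "y \<in> C" using step(1) by (simp add: C_def)
    then have "{y, z} \<in> I \<inter> edges S" using step by (auto simp: I_def)
    then show ?case using step by (auto intro: cluster_step)
  qed simp
  then have 1: "a \<in> clus (I \<inter> edges S) u" using aC by auto
  have 2: "x \<in> clus J b" using ba(1) cluster_sym unfolding D_def by metis
  have 3: "I \<inter> J = {}" using aC by (auto simp: I_def J_def edges_def)
  have 4: "I \<subseteq> \<omega>" "J \<subseteq> \<omega>" "{a, b} \<in> I" using ba by (auto simp: I_def J_def insert_commute)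
  show ?thesis
    by (rule that[of a b I J]) (use 1 2 3 4 aC CS bS \<open>b \<in> V - C\<close> in auto)
qed

text \<open>For each exit edge \<open>{a, b}\<close> the two disjoint witnesses are separated by the
  van den Berg--Kesten inequality. The first one factorises further because \<open>{a, b}\<close> is
  not an edge inside \<open>S\<close>.\<close>

lemma Simon_Lieb:
  assumes V: "finite V" and S: "S \<subseteq> V" "u \<in> S" and x: "x \<in> V"
    and w: "\<And>e. e \<in> edges V \<Longrightarrow> 0 \<le> w e"
  shows "conn V w u x \<le> conn S w u x +
    (\<Sum>a\<in>S. \<Sum>b\<in>V - S. conn S w u a * (1 - exp (- w {a, b})) * conn V w b x)"
proof -
  let ?b = "bern (edges V) w"
  have fin: "finite (edges V)" using V finite_edges by auto
  have finS: "finite S" using V S finite_subset by auto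
  define W where "W = (\<lambda>a b \<omega>. \<exists>I J. I \<subseteq> \<omega> \<and> J \<subseteq> \<omega> \<and> I \<inter> J = {} \<and>
    (a \<in> clus (I \<inter> edges S) u \<and> {a, b} \<in> I) \<and> x \<in> clus J b)"
  have "conn V w u x \<le> ?b (\<lambda>\<omega>. of_bool (x \<in> clus (\<omega> \<inter> edges S) u) + (\<Sum>a\<in>S. \<Sum>b\<in>V - S. of_bool (W a b \<omega>)))"
    unfolding conn_def
  proof (rule bern_mono)
    fix \<omega> assume \<omega>: "\<omega> \<subseteq> edges V"
    show "of_bool (x \<in> clus \<omega> u) \<le> of_bool (x \<in> clus (\<omega> \<inter> edges S) u) + (\<Sum>a\<in>S. \<Sum>b\<in>V - S. of_bool (W a b \<omega>) :: real)"
    proof (cases "x \<in> clus \<omega> u \<and> x \<notin> clus (\<omega> \<inter> edges S) u")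
      case True
      then obtain a b I J where *: "a \<in> S" "b \<in> V - S" "I \<subseteq> \<omega>" "J \<subseteq> \<omega>" "I \<inter> J = {}"
        "a \<in> clus (I \<inter> edges S) u" "{a, b} \<in> I" "x \<in> clus J b"
        using conn_witness[OF \<omega> S x] by metis
      then have "W a b \<omega>" unfolding W_def by auto
      then have "1 \<le> (of_bool (W a b \<omega>) :: real)" by simp
      also have "\<dots> \<le> (\<Sum>b\<in>V - S. of_bool (W a b \<omega>))"
        using * V by (intro member_le_sum) auto
      also have "\<dots> \<le> (\<Sum>a\<in>S. \<Sum>b\<in>V - S. of_bool (W a b \<omega>))"
        using * finS by (intro member_le_sum[of a S "\<lambda>a. \<Sum>b\<in>V - S. of_bool (W a b \<omega>)"] sum_nonneg) auto
      finally show ?thesis by (simp add: True)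
    next
      case False
      have "0 \<le> (\<Sum>a\<in>S. \<Sum>b\<in>V - S. of_bool (W a b \<omega>) :: real)" by (intro sum_nonneg) auto
      then show ?thesis using False by auto
    qed
  qed (use w in auto)
  also have "\<dots> = conn S w u x + (\<Sum>a\<in>S. \<Sum>b\<in>V - S. ?b (\<lambda>\<omega>. of_bool (W a b \<omega>)))"
    unfolding bern_add bern_sum conn_def
    using bern_restrict[OF fin edges_mono[OF S(1)], of w "\<lambda>\<omega>. of_bool (x \<in> clus \<omega> u)"] by simp
  also have "\<dots> \<le> conn S w u x + (\<Sum>a\<in>S. \<Sum>b\<in>V - S. conn S w u a * (1 - exp (- w {a, b})) * conn V w b x)"
  proof (intro add_left_mono sum_mono)
    fix a b assume a: "a \<in> S" and b: "b \<in> V - S"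
    have "?b (\<lambda>\<omega>. of_bool (W a b \<omega>)) \<le>
      ?b (\<lambda>\<omega>. of_bool (a \<in> clus (\<omega> \<inter> edges S) u \<and> {a, b} \<in> \<omega>)) * ?b (\<lambda>\<omega>. of_bool (x \<in> clus \<omega> b))"
      unfolding W_def
    proof (rule bern_BK_events[OF fin w])
      fix I I' :: "'a set set" assume I: "I \<subseteq> I'"
      show "a \<in> clus (I \<inter> edges S) u \<and> {a, b} \<in> I \<Longrightarrow> a \<in> clus (I' \<inter> edges S) u \<and> {a, b} \<in> I'"
        using I clus_mono[of "I \<inter> edges S" "I' \<inter> edges S" u] by auto
      show "x \<in> clus I b \<Longrightarrow> x \<in> clus I' b" using clus_mono[OF I] by auto
    qed
    also have "?b (\<lambda>\<omega>. of_bool (a \<in> clus (\<omega> \<inter> edges S) u \<and> {a, b} \<in> \<omega>))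
      = ?b (\<lambda>\<omega>. of_bool (a \<in> clus (\<omega> \<inter> edges S) u) * of_bool (\<omega> \<inter> {{a, b}} \<noteq> {}))"
      by (simp add: of_bool_conj)
    also have "\<dots> = conn S w u a * bern {{a, b}} w (\<lambda>\<omega>. of_bool (\<omega> \<noteq> {}))"
      unfolding conn_def
      by (rule bern_product[OF fin edges_mono[OF S(1)]])
        (use a b S in \<open>auto simp: edges_pair_iff\<close>)
    also have "bern {{a, b}} w (\<lambda>\<omega>. of_bool (\<omega> \<noteq> {})) = 1 - exp (- w {a, b})"
      using bern_insert[of "{}" "{a, b}" w "\<lambda>\<omega>. of_bool (\<omega> \<noteq> {})"] by simp
    finally show "?b (\<lambda>\<omega>. of_bool (W a b \<omega>)) \<le> conn S w u a * (1 - exp (- w {a, b})) * conn V w b x"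
      by (simp add: conn_def)
  qed
  finally show ?thesis .
qed

text \<open>The sum in \<open>\<phi>\<close> is the expected number of open edges from the cluster
  of \<open>u\<close> inside its block to outside vertices in \<open>Z\<close>. By
  \<open>range\<close> an exit of positive weight lands within distance \<open>D\<close> of
  \<open>u\<close>. So each step of the iteration costs a factor \<open>1 / 2\<close> and advances
  by at most \<open>D\<close>.\<close>

locale sub_critical_blocks =
  fixes w :: "'v set \<Rightarrow> real" and S :: "'v \<Rightarrow> 'v set" and \<delta> :: "'v \<Rightarrow> 'v \<Rightarrow> real" and D :: real and M :: nat
  assumes w_nonneg: "0 \<le> w e"
    and S: "u \<in> S u" "finite (S u)" "card (S u) \<le> M"
    and \<delta>: "\<delta> x z \<le> \<delta> x y + \<delta> y z"
    and S_radius: "a \<in> S u \<Longrightarrow> \<delta> u a < D" and D: "0 < D"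
    and range: "a \<in> S u \<Longrightarrow> b \<notin> S u \<Longrightarrow> D < \<delta> u b \<Longrightarrow> w {a, b} = 0"
    and \<phi>: "finite Z \<Longrightarrow> (\<Sum>a\<in>S u. \<Sum>b\<in>Z - S u. conn (S u) w u a * (1 - exp (- w {a, b}))) \<le> 1 / 2"
begin

lemma conn_nn: "0 \<le> conn V w x y"
  by (rule conn_nonneg) (rule w_nonneg)

text \<open>The block is intersected with \<open>V\<close> to lie inside the finite volume. This
  only lowers the connection probabilities and leaves \<open>V - S u\<close> as the set of exit
  targets, so \<open>\<phi>\<close> still gives the factor \<open>1 / 2\<close>.\<close>

lemma Simon_Lieb_sum:
  assumes V: "finite V" "u \<in> V" and X: "X \<subseteq> V"
    and K: "\<And>b. b \<in> V \<Longrightarrow> \<delta> u b \<le> D \<Longrightarrow> (\<Sum>x\<in>X. conn V w b x) \<le> K" "0 \<le> K"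
  shows "(\<Sum>x\<in>X. conn V w u x) \<le> (\<Sum>x\<in>X. conn (S u \<inter> V) w u x) + K / 2"
proof -
  let ?S = "S u \<inter> V"
  have finS: "finite ?S" using V by auto
  have p: "0 \<le> 1 - exp (- w e)" for e using w_nonneg[of e] by simp
  have "(\<Sum>x\<in>X. conn V w u x) \<le>
      (\<Sum>x\<in>X. conn ?S w u x + (\<Sum>a\<in>?S. \<Sum>b\<in>V - ?S. conn ?S w u a * (1 - exp (- w {a, b})) * conn V w b x))"
    using V S X w_nonneg by (intro sum_mono Simon_Lieb) auto
  also have "\<dots> = (\<Sum>x\<in>X. conn ?S w u x) +
      (\<Sum>a\<in>?S. \<Sum>b\<in>V - ?S. conn ?S w u a * (1 - exp (- w {a, b})) * (\<Sum>x\<in>X. conn V w b x))"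
    unfolding sum.distrib sum_distrib_left
    by (subst sum.swap, subst (2) sum.swap) simp
  also have "(\<Sum>a\<in>?S. \<Sum>b\<in>V - ?S. conn ?S w u a * (1 - exp (- w {a, b})) * (\<Sum>x\<in>X. conn V w b x))
      \<le> (\<Sum>a\<in>?S. \<Sum>b\<in>V - ?S. conn (S u) w u a * (1 - exp (- w {a, b})) * K)"
  proof (intro sum_mono)
    fix a b assume a: "a \<in> ?S" and b: "b \<in> V - ?S"
    show "conn ?S w u a * (1 - exp (- w {a, b})) * (\<Sum>x\<in>X. conn V w b x)
      \<le> conn (S u) w u a * (1 - exp (- w {a, b})) * K"
    proof (cases "\<delta> u b \<le> D")
      case True
      have "conn ?S w u a \<le> conn (S u) w u a"
        using S w_nonneg by (intro conn_mono) auto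
      then show ?thesis using True b K p conn_nn by (intro mult_mono) (auto intro!: sum_nonneg mult_nonneg_nonneg)
    next
      case False
      then have "w {a, b} = 0" using a b by (intro range) auto
      then show ?thesis by simp
    qed
  qed
  also have "\<dots> \<le> (\<Sum>a\<in>S u. \<Sum>b\<in>V - ?S. conn (S u) w u a * (1 - exp (- w {a, b})) * K)"
    using S p conn_nn K by (intro sum_mono2) (auto intro!: sum_nonneg mult_nonneg_nonneg)
  also have "V - ?S = V - S u" by auto
  also have "(\<Sum>a\<in>S u. \<Sum>b\<in>V - S u. conn (S u) w u a * (1 - exp (- w {a, b})) * K)
      = (\<Sum>a\<in>S u. \<Sum>b\<in>V - S u. conn (S u) w u a * (1 - exp (- w {a, b}))) * K"
    by (simp add: sum_distrib_right)
  also have "\<dots> \<le> 1 / 2 * K" using \<phi>[OF V(1)] K by (intro mult_right_mono) auto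
  finally show ?thesis by simp
qed

text \<open>In a finite volume the maximum of these sums over the starting point is finite, so the
  half of it that Simon--Lieb returns can be absorbed. The resulting bound is uniform in
  \<open>V\<close>.\<close>

lemma sum_conn_bound:
  assumes V: "finite V" "u \<in> V"
  shows "(\<Sum>x\<in>V. conn V w u x) \<le> 2 * real M"
proof -
  define K where "K = Max ((\<lambda>u. \<Sum>x\<in>V. conn V w u x) ` V)"
  have K: "(\<Sum>x\<in>V. conn V w b x) \<le> K" if "b \<in> V" for b
    unfolding K_def using V that by (intro Max_ge) auto
  have K0: "0 \<le> K" using K[OF V(2)] sum_nonneg[of V "conn V w u"] conn_nn by (meson order_trans)
  have "K \<in> (\<lambda>u. \<Sum>x\<in>V. conn V w u x) ` V"
    unfolding K_def using V by (intro Max_in) auto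
  then obtain v where v: "v \<in> V" "K = (\<Sum>x\<in>V. conn V w v x)" by auto
  have "K \<le> (\<Sum>x\<in>V. conn (S v \<inter> V) w v x) + K / 2"
    unfolding v(2) by (rule Simon_Lieb_sum[OF V(1) v(1)]) (use K K0 v in auto)
  also have "(\<Sum>x\<in>V. conn (S v \<inter> V) w v x) = (\<Sum>x\<in>S v \<inter> V. conn (S v \<inter> V) w v x)"
    using V S v(1) by (intro sum.mono_neutral_right ballI conn_outside) auto
  also have "\<dots> \<le> (\<Sum>x\<in>S v \<inter> V. 1)"
    using V w_nonneg by (intro sum_mono conn_le_1) auto
  also have "\<dots> \<le> real M"
  proof -
    have "card (S v \<inter> V) \<le> card (S v)" using S by (intro card_mono) auto
    then show ?thesis using S(3)[of v] by simp
  qed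
  finally have "K \<le> 2 * real M" by simp
  then show ?thesis using K[OF V(2)] by linarith
qed

text \<open>Vertices at distance at least \<open>D\<close> lie outside the block, so reaching them
  requires an exit, which halves the bound and uses up a distance of at most \<open>D\<close>. The
  constant \<open>c\<close> is left free so that it can later be the expected cluster size rather
  than the crude \<open>2 * M\<close>.\<close>

lemma sum_conn_far:
  assumes V: "finite V" and c: "\<And>u. u \<in> V \<Longrightarrow> (\<Sum>x\<in>V. conn V w u x) \<le> c" and u: "u \<in> V"
  shows "(\<Sum>x | x \<in> V \<and> real j * D \<le> \<delta> u x. conn V w u x) \<le> c / 2 ^ j"
  using u
proof (induction j arbitrary: u)
  case 0
  have "(\<Sum>x | x \<in> V \<and> real 0 * D \<le> \<delta> u x. conn V w u x) \<le> (\<Sum>x\<in>V. conn V w u x)"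
    using V conn_nn by (intro sum_mono2) auto
  then show ?case using c[OF 0] by simp
next
  case (Suc j)
  let ?X = "{x. x \<in> V \<and> real (Suc j) * D \<le> \<delta> u x}"
  have c0: "0 \<le> c" using c[OF Suc.prems] sum_nonneg[of V "conn V w u"] conn_nn by (meson order_trans)
  have "(\<Sum>x\<in>?X. conn V w u x) \<le> (\<Sum>x\<in>?X. conn (S u \<inter> V) w u x) + c / 2 ^ j / 2"
  proof (rule Simon_Lieb_sum[OF V Suc.prems])
    fix b assume b: "b \<in> V" "\<delta> u b \<le> D"
    have "?X \<subseteq> {x. x \<in> V \<and> real j * D \<le> \<delta> b x}"
    proof
      fix x assume "x \<in> ?X"
      then show "x \<in> {x. x \<in> V \<and> real j * D \<le> \<delta> b x}" using \<delta>[of u x b] b by (simp add: algebra_simps)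
    qed
    then have "(\<Sum>x\<in>?X. conn V w b x) \<le> (\<Sum>x | x \<in> V \<and> real j * D \<le> \<delta> b x. conn V w b x)"
      using V conn_nn by (intro sum_mono2) auto
    then show "(\<Sum>x\<in>?X. conn V w b x) \<le> c / 2 ^ j" using Suc.IH[OF b(1)] by linarith
  qed (use c0 in auto)
  also have "(\<Sum>x\<in>?X. conn (S u \<inter> V) w u x) = 0"
  proof (intro sum.neutral ballI conn_outside)
    fix x assume "x \<in> ?X"
    then have "D \<le> \<delta> u x" using D by (auto simp: algebra_simps intro: order_trans[rotated])
    then show "x \<notin> S u \<inter> V" using S_radius[of x u] by auto
  qed (use S Suc.prems in auto)
  finally show ?case by simp
qed

end

section \<open>Boxes in the lattice\<close>

lemma clus_image:
  assumes "inj f" shows "clus ((`) f ` \<omega>) (f x) = f ` clus \<omega> x"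
proof
  have "\<exists>z. y = f z \<and> z \<in> clus \<omega> x" if "y \<in> clus ((`) f ` \<omega>) (f x)" for y
    using that
  proof (induction rule: cluster_induct)
    case (step y y')
    then obtain z e where z: "y = f z" "z \<in> clus \<omega> x" "e \<in> \<omega>" "f ` e = {y, y'}" by auto
    then obtain z' where z': "y' = f z'" "z' \<in> e" by (metis imageE insertCI)
    then have "e = {z, z'}" using z assms
      by (metis image_empty image_insert inj_image_eq_iff)
    then show ?case using z z' step(3) by (auto intro: cluster_step)
  qed auto
  then show "clus ((`) f ` \<omega>) (f x) \<subseteq> f ` clus \<omega> x" by auto
next
  have "f y \<in> clus ((`) f ` \<omega>) (f x)" if "y \<in> clus \<omega> x" for y
    using that
  proof (induction rule: cluster_induct)
    case (step y z)
    have "{f y, f z} \<in> (`) f ` \<omega>" using step by (intro image_eqI[of _ _ "{y, z}"]) auto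
    moreover have "f y \<noteq> f z" using step assms by (auto dest: injD)
    ultimately show ?case using step by (auto intro: cluster_step)
  qed auto
  then show "f ` clus \<omega> x \<subseteq> clus ((`) f ` \<omega>) (f x)" by auto
qed

lemma edges_image:
  assumes "inj f" shows "edges (f ` B) = (`) f ` edges B"
proof -
  have c: "card (f ` e) = card e" for e
    using inj_on_subset[OF assms subset_UNIV] by (rule card_image)
  show ?thesis
  proof (intro equalityI subsetI)
    fix e assume "e \<in> edges (f ` B)"
    then have e: "e \<subseteq> f ` B" "card e = 2" by (simp_all add: edges_def)
    from e(1) obtain e' where e': "e' \<subseteq> B" "e = f ` e'" by (rule subset_imageE)
    then have "e' \<in> edges B" using e(2) c[of e'] by (simp add: edges_def)
    then show "e \<in> (`) f ` edges B" using e'(2) by (rule rev_image_eqI)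
  next
    fix e assume "e \<in> (`) f ` edges B"
    then obtain e' where "e' \<subseteq> B" "card e' = 2" "e = f ` e'" unfolding edges_def by blast
    then show "e \<in> edges (f ` B)" using c[of e'] by (simp add: edges_def image_mono)
  qed
qed

lemma bern_edges_image:
  assumes "inj f" "finite B"
  shows "bern (edges (f ` B)) w F = bern (edges B) (\<lambda>e. w (f ` e)) (\<lambda>\<omega>. F ((`) f ` \<omega>))"
  unfolding edges_image[OF assms(1)]
proof (rule bern_image)
  show "inj_on ((`) f) (edges B)"
    by (rule inj_onI) (use inj_image_eq_iff[OF assms(1)] in blast)
qed (rule finite_edges[OF assms(2)])

lemma conn_image:
  assumes "inj f" "finite B"
  shows "conn (f ` B) w (f x) (f y) = conn B (\<lambda>e. w (f ` e)) x y"
  unfolding conn_def bern_edges_image[OF assms] clus_image[OF assms(1)]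
  using assms(1) by (simp add: inj_image_mem_iff)

lemma big_image:
  assumes "inj f" shows "big (f ` B) m ((`) f ` \<omega>) = big B m \<omega>"
proof -
  have "card (clus ((`) f ` \<omega>) (f x) \<inter> f ` B) = card (clus \<omega> x \<inter> B)" for x
    unfolding clus_image[OF assms] image_Int[OF assms, symmetric]
    using assms by (intro card_image) (auto intro: inj_on_subset)
  then show ?thesis by (simp add: big_def)
qed

definition lbox :: "int ^ 'd \<Rightarrow> nat \<Rightarrow> (int ^ 'd) set" where
  "lbox a n = {x. \<forall>i. a $ i \<le> x $ i \<and> x $ i < a $ i + int n}"

lemma vec_product_card:
  fixes A :: "'d::finite \<Rightarrow> int set"
  assumes "\<And>i. finite (A i)"
  shows "finite {x :: int ^ 'd. \<forall>i. x $ i \<in> A i}" "card {x :: int ^ 'd. \<forall>i. x $ i \<in> A i} = (\<Prod>i\<in>UNIV. card (A i))"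
proof -
  have bij: "bij_betw vec_lambda (Pi\<^sub>E UNIV A) {x :: int ^ 'd. \<forall>i. x $ i \<in> A i}"
    by (rule bij_betw_byWitness[where f' = vec_nth]) auto
  have "finite (Pi\<^sub>E UNIV A)" using assms by (intro finite_PiE) auto
  then show "finite {x :: int ^ 'd. \<forall>i. x $ i \<in> A i}" using bij bij_betw_finite by blast
  show "card {x :: int ^ 'd. \<forall>i. x $ i \<in> A i} = (\<Prod>i\<in>UNIV. card (A i))"
    using bij_betw_same_card[OF bij] by (simp add: card_PiE)
qed

lemma finite_lbox [simp]: "finite (lbox (a :: int ^ 'd) n)"
  and card_lbox [simp]: "card (lbox (a :: int ^ 'd) n) = n ^ CARD('d)"
proof -
  have *: "lbox a n = {x. \<forall>i. x $ i \<in> {a $ i..<a $ i + int n}}" by (auto simp: lbox_def)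
  show "finite (lbox a n)" unfolding * by (rule vec_product_card) auto
  show "card (lbox a n) = n ^ CARD('d)" unfolding * by (subst vec_product_card) auto
qed

lemma lbox_translate: "(+) v ` lbox a n = lbox (v + a) n"
proof
  show "lbox (v + a) n \<subseteq> (+) v ` lbox a n"
  proof
    fix x assume "x \<in> lbox (v + a) n"
    then have "x - v \<in> lbox a n" by (auto simp: lbox_def algebra_simps)
    then show "x \<in> (+) v ` lbox a n" by (intro image_eqI[of _ _ "x - v"]) auto
  qed
qed (auto simp: lbox_def algebra_simps)

lemma lbox_subdivide:
  fixes a :: "int ^ 'd"
  assumes "0 < n"
  shows "lbox a (s * n) = (\<Union>j\<in>lbox 0 s. lbox (a + int n *s j) n)"
    and "disjoint_family_on (\<lambda>j. lbox (a + int n *s j) n) (lbox 0 s)"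
proof -
  have div: "(x - b) div int n = j" if "b + int n * j \<le> x" "x < b + int n * j + int n" for x b j
  proof -
    have "x - b = int n * j + (x - b - int n * j)" "0 \<le> x - b - int n * j" "x - b - int n * j < int n"
      using that by auto
    then show ?thesis using assms by (metis add_cancel_right_right div_mult_self4 div_pos_pos_trivial mult.commute less_imp_of_nat_less of_nat_0 not_less_iff_gr_or_eq add.commute)
  qed
  show "disjoint_family_on (\<lambda>j. lbox (a + int n *s j) n) (lbox 0 s)"
    unfolding disjoint_family_on_def
  proof (intro ballI impI, rule ccontr)
    fix j k assume "j \<noteq> k" "lbox (a + int n *s j) n \<inter> lbox (a + int n *s k) n \<noteq> {}"
    then obtain x where x: "x \<in> lbox (a + int n *s j) n" "x \<in> lbox (a + int n *s k) n" by auto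
    then have "(x $ i - a $ i) div int n = j $ i" "(x $ i - a $ i) div int n = k $ i" for i
      by (auto simp: lbox_def intro!: div)
    then have "j = k" by (simp add: vec_eq_iff)
    with \<open>j \<noteq> k\<close> show False by simp
  qed
  show "lbox a (s * n) = (\<Union>j\<in>lbox 0 s. lbox (a + int n *s j) n)"
  proof (intro equalityI subsetI)
    fix x assume x: "x \<in> lbox a (s * n)"
    define j :: "int ^ 'd" where "j = (\<chi> i. (x $ i - a $ i) div int n)"
    have "x $ i - a $ i = int n * (j $ i) + (x $ i - a $ i) mod int n" for i by (simp add: j_def)
    moreover have "0 \<le> (x $ i - a $ i) mod int n" "(x $ i - a $ i) mod int n < int n" for i using assms by auto
    ultimately have "a $ i + int n * j $ i \<le> x $ i \<and> x $ i < a $ i + int n * j $ i + int n" for i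
      by (smt (verit))
    then have "x \<in> lbox (a + int n *s j) n" by (simp add: lbox_def)
    moreover have "j \<in> lbox 0 s"
    proof -
      have "0 \<le> j $ i \<and> j $ i < int s" for i
      proof -
        have "0 \<le> x $ i - a $ i" "x $ i - a $ i < int s * int n" using x by (auto simp: lbox_def diff_less_eq add.commute)
        moreover have "(x $ i - a $ i) div int n * int n \<le> x $ i - a $ i"
          using assms by (metis div_mult_mod_eq le_add_same_cancel1 of_nat_0_less_iff pos_mod_sign)
        ultimately have "(x $ i - a $ i) div int n * int n < int s * int n" by linarith
        then show ?thesis using assms \<open>0 \<le> x $ i - a $ i\<close> by (simp add: j_def pos_imp_zdiv_nonneg_iff)
      qed
      then show ?thesis by (simp add: lbox_def)
    qed
    ultimately show "x \<in> (\<Union>j\<in>lbox 0 s. lbox (a + int n *s j) n)" by auto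
  next
    fix x assume "x \<in> (\<Union>j\<in>lbox 0 s. lbox (a + int n *s j) n)"
    then obtain j where j: "j \<in> lbox 0 s" "x \<in> lbox (a + int n *s j) n" by auto
    show "x \<in> lbox a (s * n)"
      unfolding lbox_def mem_Collect_eq
    proof
      fix i
      have "0 \<le> j $ i \<and> j $ i < int s" using j(1) by (simp add: lbox_def)
      then have "0 \<le> j $ i" "j $ i + 1 \<le> int s" by auto
      then have "0 \<le> int n * (j $ i)" "int n * (j $ i + 1) \<le> int n * int s"
        by (simp, intro mult_left_mono) auto
      moreover have "a $ i + int n * j $ i \<le> x $ i \<and> x $ i < a $ i + int n * j $ i + int n"
        using j(2) by (simp add: lbox_def)
      ultimately show "a $ i \<le> x $ i \<and> x $ i < a $ i + int (s * n)"
        by (simp add: algebra_simps)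
    qed
  qed
qed

section \<open>The renormalisation scheme\<close>

text \<open>The scale factors grow like \<open>(K + k)^2\<close>. A constant factor would lose a
  fixed proportion of the vertices at every scale; here the losses multiply to a positive limit. The
  growth is also slow enough for \<open>\<epsilon> k\<close>, of order \<open>s k\<close> to the
  power \<open>- 2 * d\<close>, to at most halve from one scale to the next. The variable
  \<open>y\<close> stands for the exponent \<open>t * m^2\<close> of
  \<open>renormalisation_step\<close>.\<close>

lemma renormalisation_constants:
  fixes \<alpha> :: real and d :: nat
  assumes "0 < \<alpha>" "\<alpha> < d"
  obtains s :: "nat \<Rightarrow> nat" and L :: real and \<epsilon> :: "nat \<Rightarrow> real"
  where "0 < L" "\<And>k. 3 \<le> s k" "\<And>k. 0 < \<epsilon> k" "\<And>k. \<epsilon> k \<le> 1 / 4"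
    "\<And>k. (\<Prod>j<k. 1 - 1 / real (s j ^ d)) \<ge> 1 / 2"
    "\<And>k y. L / 4 * real (\<Prod>j<k. s j) powr (d - \<alpha>) * real (s k) powr (- (d + \<alpha>)) \<le> y \<Longrightarrow>
       (real (s k ^ d))\<^sup>2 * (\<epsilon> k)\<^sup>2 + real (s k ^ d) * exp (- y) \<le> \<epsilon> (Suc k)"
proof -
  have d: "1 \<le> d" using assms by linarith
  \<comment> \<open>Above \<open>x0\<close> the power \<open>x powr (d - \<alpha>)\<close> absorbs
    \<open>4 powr (4 * d + \<alpha>)\<close>. Together with \<open>s (Suc k) \<le> 4 * s k\<close>
    this makes \<open>g\<close> nonincreasing.\<close>
  define x0 :: real where "x0 = (4 powr (4 * d + \<alpha>)) powr (1 / (d - \<alpha>))"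
  have x0: "4 powr (4 * d + \<alpha>) \<le> x powr (d - \<alpha>)" if "x \<ge> x0" for x
  proof -
    have "4 powr (4 * d + \<alpha>) = x0 powr (d - \<alpha>)" using assms by (simp add: x0_def powr_powr)
    also have "\<dots> \<le> x powr (d - \<alpha>)" using assms that by (intro powr_mono2) (auto simp: x0_def)
    finally show ?thesis .
  qed
  define K :: nat where "K = max (8 * d) (nat \<lceil>x0\<rceil>)"
  have K: "8 * d \<le> K" "x0 \<le> real K" by (auto simp: K_def) linarith
  then have K8: "8 \<le> K" using d by linarith
  define s :: "nat \<Rightarrow> nat" where "s k = (K + k)\<^sup>2" for k
  define S where "S k = real (s k ^ d)" for k
  define \<epsilon> where "\<epsilon> k = 1 / (4 * (S k)\<^sup>2)" for k
  define P where "P k = real (\<Prod>j<k. s j)" for k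
  \<comment> \<open>Chosen so that \<open>S k ^ 3 = g k * P k powr (d - \<alpha>) * s k powr (- (d +
    \<alpha>))\<close>. With \<open>L = 64 * g 0\<close> the hypothesis on \<open>y\<close> becomes
    \<open>16 * S k ^ 3 \<le> y\<close>, enough to make \<open>S k * exp (- y)\<close> as small as
    \<open>1 / (16 * S k ^ 2)\<close>.\<close>
  define g where "g k = real (s k) powr (4 * d + \<alpha>) * P k powr (- (d - \<alpha>))" for k
  define L where "L = 64 * g 0"
  have sK: "K \<le> s k" for k
  proof -
    have "K * 1 \<le> (K + k) * (K + k)" using K8 by (intro mult_le_mono) auto
    then show ?thesis by (simp add: s_def power2_eq_square)
  qed
  have s2: "2 \<le> s k" for k using sK[of k] K8 by linarith
  have sS: "real (s k) \<le> S k" for k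
    unfolding S_def using d s2[of k] by (intro of_nat_mono self_le_power) auto
  have S2: "2 \<le> S k" for k using sS[of k] s2[of k] by linarith
  have P0: "0 < P k" for k unfolding P_def by (simp add: s_def) (use K8 in \<open>auto intro!: prod_pos\<close>)
  \<comment> \<open>\<open>K \<ge> 8 * d\<close> is made for this: \<open>(1 + 1 / x) ^ (4 * d)
    \<le> exp (4 * d / x) \<le> exp (1 / 2)\<close> for \<open>x \<ge> K\<close>.\<close>
  have SS: "(S (Suc k))\<^sup>2 \<le> 2 * (S k)\<^sup>2" for k
  proof -
    define x where "x = real (K + k)"
    have x: "8 * real d \<le> x" "0 < x" using K K8 by (auto simp: x_def)
    have Sx: "(S k)\<^sup>2 = x ^ (4 * d)" "(S (Suc k))\<^sup>2 = (x + 1) ^ (4 * d)"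
      by (simp_all add: S_def s_def x_def power_mult[symmetric] mult.commute algebra_simps)
    have "((x + 1) / x) ^ (4 * d) \<le> exp (1 / x) ^ (4 * d)"
      using exp_ge_add_one_self[of "1 / x"] x by (intro power_mono) (auto simp: field_simps)
    also have "\<dots> = exp (real (4 * d) * (1 / x))" by (rule exp_of_nat_mult[symmetric])
    also have "\<dots> \<le> exp (1 / 2)" using x by (simp add: field_simps)
    also have "\<dots> \<le> 2" by (rule exp_half_le2)
    finally show ?thesis unfolding Sx using x by (simp add: power_divide field_simps)
  qed
  have g: "g k \<le> g 0" for k
  proof (induction k)
    case (Suc k)
    have s0: "0 < real (s k)" using s2[of k] by simp
    have "s (Suc k) \<le> 4 * s k"
    proof -
      have "s (Suc k) \<le> (2 * (K + k))\<^sup>2" unfolding s_def using K8 by (intro power_mono) auto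
      also have "\<dots> = 4 * s k" by (simp only: s_def power_mult_distrib) simp
      finally show ?thesis .
    qed
    then have "real (s (Suc k)) powr (4 * d + \<alpha>) \<le> (4 * real (s k)) powr (4 * d + \<alpha>)"
      using assms by (intro powr_mono2) auto
    also have "\<dots> = 4 powr (4 * d + \<alpha>) * real (s k) powr (4 * d + \<alpha>)" by (simp add: powr_mult)
    also have "\<dots> \<le> real (s k) powr (d - \<alpha>) * real (s k) powr (4 * d + \<alpha>)"
      using x0[of "real (s k)"] K(2) sK[of k] by (intro mult_right_mono) auto
    finally have 1: "real (s (Suc k)) powr (4 * d + \<alpha>) \<le> real (s k) powr (d - \<alpha>) * real (s k) powr (4 * d + \<alpha>)" .
    have 2: "P (Suc k) powr (- (d - \<alpha>)) = P k powr (- (d - \<alpha>)) * real (s k) powr (- (d - \<alpha>))"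
      using P0[of k] s0 by (simp add: P_def powr_mult)
    have "g (Suc k) \<le> (real (s k) powr (d - \<alpha>) * real (s k) powr (4 * d + \<alpha>)) * (P k powr (- (d - \<alpha>)) * real (s k) powr (- (d - \<alpha>)))"
      unfolding g_def 2 by (intro mult_right_mono 1) auto
    also have "\<dots> = g k * (real (s k) powr (d - \<alpha>) * real (s k) powr (- (d - \<alpha>)))"
      by (simp add: g_def algebra_simps)
    also have "\<dots> = g k" using s0 by (simp add: powr_add[symmetric])
    finally show ?case using Suc by simp
  qed simp
  show ?thesis
  proof (rule that[of L s \<epsilon>])
    show "0 < L" using s2[of 0] by (auto simp: L_def g_def P_def)
    show "3 \<le> s k" for k using sK[of k] K8 by linarith
    show "0 < \<epsilon> k" for k using S2[of k] by (auto simp: \<epsilon>_def)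
    show "\<epsilon> k \<le> 1 / 4" for k
    proof -
      have "1 \<le> (S k)\<^sup>2" using S2[of k] by (intro one_le_power) auto
      then show ?thesis by (simp add: \<epsilon>_def divide_le_eq_1)
    qed
    show "(\<Prod>j<k. 1 - 1 / real (s j ^ d)) \<ge> 1 / 2" for k
    proof -
      \<comment> \<open>The left side is the telescoped product of \<open>1 - 1 / (K + j)^2\<close>,
        and \<open>S j \<ge> (K + j)^2\<close>.\<close>
      have "(real K - 1) / K * ((real K + k) / (real K + k - 1)) \<le> (\<Prod>j<k. 1 - 1 / S j)"
      proof (induction k)
        case (Suc k)
        define x where "x = real K + k"
        have x: "8 \<le> x" using K8 by (simp add: x_def)
        have "(x + 1) / x = x / (x - 1) * (1 - 1 / x\<^sup>2)" using x by (simp add: field_simps power2_eq_square)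
        also have "\<dots> \<le> x / (x - 1) * (1 - 1 / S k)"
        proof -
          have "x\<^sup>2 \<le> S k" using sS[of k] by (simp add: s_def x_def)
          then have "1 / S k \<le> 1 / x\<^sup>2" using x S2[of k] by (intro divide_left_mono) auto
          then show ?thesis using x by (intro mult_left_mono) auto
        qed
        finally have "(real K - 1) / K * ((x + 1) / x) \<le> (real K - 1) / K * (x / (x - 1)) * (1 - 1 / S k)"
          using K8 unfolding mult.assoc by (intro mult_left_mono) auto
        also have "\<dots> \<le> (\<Prod>j<k. 1 - 1 / S j) * (1 - 1 / S k)"
          using Suc S2[of k] by (intro mult_right_mono) (auto simp: x_def)
        finally show ?case by (simp add: x_def algebra_simps)
      qed (use K8 in simp)
      moreover have "1 / 2 \<le> (real K - 1) / K * ((real K + k) / (real K + k - 1))"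
      proof -
        have "1 / 2 * 1 \<le> (real K - 1) / K * ((real K + k) / (real K + k - 1))"
          using K8 by (intro mult_mono) (auto simp: field_simps)
        then show ?thesis by simp
      qed
      ultimately show ?thesis unfolding S_def by (rule order_trans[rotated])
    qed
    show "(real (s k ^ d))\<^sup>2 * (\<epsilon> k)\<^sup>2 + real (s k ^ d) * exp (- y) \<le> \<epsilon> (Suc k)"
      if y: "L / 4 * real (\<Prod>j<k. s j) powr (d - \<alpha>) * real (s k) powr (- (d + \<alpha>)) \<le> y" for k y
    proof -
      have s0: "0 < real (s k)" using s2[of k] by simp
      have "16 * (S k) ^ 3 = 16 * (g k * P k powr (d - \<alpha>) * real (s k) powr (- (d + \<alpha>)))"
      proof -
        have "(S k) ^ 3 = real (s k) ^ (3 * d)" by (simp add: S_def power_mult[symmetric] mult.commute)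
        also have "\<dots> = real (s k) powr (3 * d)" using powr_realpow[OF s0, of "3 * d"] by simp
        also have "\<dots> = real (s k) powr (4 * d + \<alpha>) * real (s k) powr (- (d + \<alpha>))"
          using s0 by (simp add: powr_add[symmetric])
        also have "\<dots> = real (s k) powr (4 * d + \<alpha>) * real (s k) powr (- (d + \<alpha>)) * (P k powr (- (d - \<alpha>)) * P k powr (d - \<alpha>))"
          using P0[of k] by (simp add: powr_add[symmetric])
        finally show ?thesis by (simp add: g_def mult_ac)
      qed
      also have "\<dots> \<le> 16 * (g 0 * P k powr (d - \<alpha>) * real (s k) powr (- (d + \<alpha>)))"
        using g[of k] by (intro mult_left_mono mult_right_mono) auto
      also have "\<dots> \<le> y" using y by (simp add: L_def P_def)
      also have "y \<le> exp y" using exp_ge_add_one_self[of y] by linarith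
      finally have "S k * exp (- y) \<le> 1 / (16 * (S k)\<^sup>2)"
        using S2[of k] by (simp add: exp_minus field_simps power2_eq_square power3_eq_cube)
      moreover have "(S k)\<^sup>2 * (\<epsilon> k)\<^sup>2 = 1 / (16 * (S k)\<^sup>2)"
        using S2[of k] by (simp add: \<epsilon>_def power2_eq_square)
      ultimately have "(S k)\<^sup>2 * (\<epsilon> k)\<^sup>2 + S k * exp (- y) \<le> 1 / (8 * (S k)\<^sup>2)" by simp
      also have "\<dots> \<le> \<epsilon> (Suc k)"
      proof -
        have "0 < (S (Suc k))\<^sup>2" using S2[of "Suc k"] by auto
        then show ?thesis unfolding \<epsilon>_def using SS[of k] S2[of k] by (intro divide_left_mono) auto
      qed
      finally show ?thesis by (simp add: S_def)
    qed
  qed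
qed

lemma bern_big_translate:
  fixes w :: "(int ^ 'd) set \<Rightarrow> real"
  assumes "\<And>v e. w ((+) v ` e) = w e" "finite B"
  shows "bern (edges ((+) v ` B)) w (\<lambda>\<omega>. F (big ((+) v ` B) m \<omega>)) = bern (edges B) w (\<lambda>\<omega>. F (big B m \<omega>))"
  using assms by (simp add: bern_edges_image big_image)

lemma conn_translate:
  fixes w :: "(int ^ 'd) set \<Rightarrow> real"
  assumes "\<And>v e. w ((+) v ` e) = w e" "finite B"
  shows "conn ((+) v ` B) w (v + x) (v + y) = conn B w x y"
  using conn_image[of "(+) v" B w x y] assms by simp

text \<open>Percolation expressed in finite volumes. The constant \<open>c\<close> is fixed before
  \<open>k\<close>, so it survives the limit that produces an infinite cluster.\<close>

definition large_clusters :: "((int ^ 'd) set \<Rightarrow> real) \<Rightarrow> bool" where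
  "large_clusters w \<longleftrightarrow> (\<exists>c>0. \<forall>k. \<exists>V. finite V \<and>
     c \<le> bern (edges V) w (\<lambda>\<omega>. of_bool (k \<le> card (clus \<omega> 0 \<inter> V))))"

text \<open>At scale \<open>k\<close> the side is \<open>n * P k\<close>, and the required cluster
  size is still of order \<open>m * P k ^ d\<close>. Squared size times edge weight therefore gains
  the power \<open>2 * d - (d + \<alpha>) = d - \<alpha> > 0\<close> of \<open>P k\<close>, which
  outweighs the next scale factor. \<open>L\<close> and \<open>\<epsilon>\<close> do not depend on
  the weights, so the criterion can be used along a family of parameters.\<close>

lemma finite_size_criterion:
  fixes \<alpha> :: real
  assumes "0 < \<alpha>" "\<alpha> < CARD('d)"
  obtains L \<epsilon> :: real where "0 < L" "0 < \<epsilon>"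
    "\<And>(w :: (int ^ 'd) set \<Rightarrow> real) Q n m. \<lbrakk>\<And>v e. w ((+) v ` e) = w e;
       \<And>a n e. 1 \<le> n \<Longrightarrow> e \<in> edges (lbox a n) \<Longrightarrow> Q * real n powr (- (CARD('d) + \<alpha>)) \<le> w e;
       0 \<le> Q; 1 \<le> n; 1 \<le> m; L * real n powr (CARD('d) + \<alpha>) \<le> Q * (real m)\<^sup>2;
       bern (edges (lbox 0 n)) w (\<lambda>\<omega>. of_bool (\<not> big (lbox 0 n) m \<omega>)) \<le> \<epsilon>\<rbrakk>
       \<Longrightarrow> large_clusters w"
proof -
  let ?d = "CARD('d)"
  obtain s :: "nat \<Rightarrow> nat" and L :: real and \<epsilon> :: "nat \<Rightarrow> real" where
    L: "0 < L" and s: "\<And>k. 3 \<le> s k" and \<epsilon>: "\<And>k. 0 < \<epsilon> k" "\<And>k. \<epsilon> k \<le> 1 / 4"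
    and prod: "\<And>k. (\<Prod>j<k. 1 - 1 / real (s j ^ ?d)) \<ge> 1 / 2"
    and step: "\<And>k y. L / 4 * real (\<Prod>j<k. s j) powr (?d - \<alpha>) * real (s k) powr (- (?d + \<alpha>)) \<le> y \<Longrightarrow>
       (real (s k ^ ?d))\<^sup>2 * (\<epsilon> k)\<^sup>2 + real (s k ^ ?d) * exp (- y) \<le> \<epsilon> (Suc k)"
    by (rule renormalisation_constants[OF assms]) (rule that)
  have S3: "3 \<le> s k ^ ?d" for k
  proof -
    have "s k \<le> s k ^ ?d" using s[of k] by (intro self_le_power) auto
    then show ?thesis using s[of k] by linarith
  qed
  show ?thesis
  proof (rule that[OF L \<epsilon>(1)[of 0]])
    fix w :: "(int ^ 'd) set \<Rightarrow> real" and Q n m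
    assume inv: "\<And>v e. w ((+) v ` e) = w e"
      and wQ: "\<And>a n e. 1 \<le> n \<Longrightarrow> e \<in> edges (lbox a n) \<Longrightarrow> Q * real n powr (- (?d + \<alpha>)) \<le> w e"
      and Q: "0 \<le> Q" and n: "1 \<le> n" and m: "1 \<le> m"
      and Lm: "L * real n powr (?d + \<alpha>) \<le> Q * (real m)\<^sup>2"
      and init: "bern (edges (lbox 0 n)) w (\<lambda>\<omega>. of_bool (\<not> big (lbox 0 n) m \<omega>)) \<le> \<epsilon> 0"
    define P where "P k = (\<Prod>j<k. s j)" for k
    define N where "N k = n * P k" for k
    define M where "M k = m * (\<Prod>j<k. s j ^ ?d - 1)" for k
    have "0 < s k" for k using s[of k] by linarith
    then have "0 < P k" for k unfolding P_def by (intro prod_pos) auto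
    then have P1: "1 \<le> P k" for k by (simp add: Suc_le_eq)
    have N1: "1 \<le> N k" for k using P1[of k] n by (auto simp: N_def Suc_le_eq)
    have NS: "N (Suc k) = s k * N k" for k by (simp add: N_def P_def)
    have MS: "M (Suc k) = (s k ^ ?d - 1) * M k" for k by (simp add: M_def)
    \<comment> \<open>One sub-box may be lost at each scale; the product of the losses is at least
      \<open>1 / 2\<close>. Squared, this is the \<open>1 / 4\<close> in the condition on
      \<open>L\<close>.\<close>
    have Mlow: "real m * real (P k) ^ ?d / 2 \<le> real (M k)" for k
    proof -
      have "real (M k) = real m * (\<Prod>j<k. real (s j ^ ?d) * (1 - 1 / real (s j ^ ?d)))"
      proof -
        have "real (s j ^ ?d - 1) = real (s j ^ ?d) * (1 - 1 / real (s j ^ ?d))" for j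
          using S3[of j] s[of j] by (simp add: of_nat_diff right_diff_distrib del: of_nat_power)
        then show ?thesis by (simp add: M_def)
      qed
      also have "\<dots> = real m * real (P k) ^ ?d * (\<Prod>j<k. 1 - 1 / real (s j ^ ?d))"
        by (simp add: prod.distrib P_def prod_power_distrib)
      also have "\<dots> \<ge> real m * real (P k) ^ ?d * (1 / 2)"
        using prod[of k] by (intro mult_left_mono) auto
      finally show ?thesis by simp
    qed
    have w0: "0 \<le> w e" if "1 \<le> n" "e \<in> edges (lbox a n)" for a n e
      using wQ[OF that] Q by (meson order_trans mult_nonneg_nonneg powr_ge_zero)
    have main: "bern (edges (lbox 0 (N k))) w (\<lambda>\<omega>. of_bool (\<not> big (lbox 0 (N k)) (M k) \<omega>)) \<le> \<epsilon> k" for k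
    proof (induction k)
      case 0
      then show ?case using init by (simp add: N_def P_def M_def)
    next
      case (Suc k)
      define t where "t = Q * real (N (Suc k)) powr (- (?d + \<alpha>))"
      let ?B = "\<lambda>j. lbox (0 + int (N k) *s j) (N k)" and ?I = "lbox 0 (s k) :: (int ^ 'd) set"
      let ?U = "lbox 0 (N (Suc k)) :: (int ^ 'd) set"
      have NN: "0 < N k" using N1[of k] by simp
      have "bern (edges ?U) w (\<lambda>\<omega>. of_bool (\<not> big ?U ((card ?I - 1) * M k) \<omega>))
          \<le> (real (card ?I))\<^sup>2 * (\<epsilon> k)\<^sup>2 + real (card ?I) * exp (- t * (real (M k))\<^sup>2)"
      proof (rule renormalisation_step[where B = ?B])
        show "2 \<le> card ?I" using S3[of k] by simp
        show "disjoint_family_on ?B ?I" by (rule lbox_subdivide[OF NN])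
        show "?U = (\<Union>j\<in>?I. ?B j)" unfolding NS by (rule lbox_subdivide[OF NN])
        show "t \<le> w e" if "e \<in> edges ?U" for e unfolding t_def by (rule wQ[OF N1 that])
        show "0 \<le> t" using Q by (simp add: t_def)
        show "bern (edges (?B j)) w (\<lambda>\<omega>. of_bool (\<not> big (?B j) (M k) \<omega>)) \<le> \<epsilon> k" for j
          using bern_big_translate[where F = "\<lambda>b. of_bool (\<not> b)" and v = "int (N k) *s j" and m = "M k",
              OF inv finite_lbox, of 0 "N k"] Suc
          by (simp add: lbox_translate)
      qed auto
      moreover have "(real (card ?I))\<^sup>2 * (\<epsilon> k)\<^sup>2 + real (card ?I) * exp (- (t * (real (M k))\<^sup>2)) \<le> \<epsilon> (Suc k)"
        unfolding card_lbox
      proof (rule step)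
        have pos: "0 < real n" "0 < real (P k)" "0 < real (s k)" using n P1[of k] s[of k] by auto
        have "real (N (Suc k)) powr (- (?d + \<alpha>)) = real n powr (- (?d + \<alpha>)) * real (P k) powr (- (?d + \<alpha>)) * real (s k) powr (- (?d + \<alpha>))"
          by (simp add: N_def P_def powr_mult)
        then have t: "t = Q * (real n powr (- (?d + \<alpha>)) * real (P k) powr (- (?d + \<alpha>)) * real (s k) powr (- (?d + \<alpha>)))"
          by (simp add: t_def)
        have Peq: "real (P k) powr (?d - \<alpha>) = real (P k) powr (- (?d + \<alpha>)) * (real (P k) ^ ?d)\<^sup>2"
        proof -
          have "(real (P k) ^ ?d)\<^sup>2 = real (P k) ^ (2 * ?d)" by (simp add: power_mult[symmetric] mult.commute)
          also have "\<dots> = real (P k) powr (2 * ?d)" using powr_realpow[OF pos(2), of "2 * ?d"] by simp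
          finally have "(real (P k) ^ ?d)\<^sup>2 = real (P k) powr (2 * ?d)" .
          moreover have "real ?d - \<alpha> = - (?d + \<alpha>) + 2 * ?d" by simp
          ultimately show ?thesis by (simp only: powr_add)
        qed
        have "L \<le> Q * (real m)\<^sup>2 * real n powr (- (?d + \<alpha>))"
        proof -
          have "real n powr (?d + \<alpha>) * real n powr (- (?d + \<alpha>)) = 1"
            using pos by (simp add: powr_add[symmetric])
          then have "L = L * real n powr (?d + \<alpha>) * real n powr (- (?d + \<alpha>))" by simp
          also have "\<dots> \<le> Q * (real m)\<^sup>2 * real n powr (- (?d + \<alpha>))"
            by (rule mult_right_mono[OF Lm]) simp
          finally show ?thesis .
        qed
        then have "L / 4 * real (P k) powr (?d - \<alpha>) * real (s k) powr (- (?d + \<alpha>))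
          \<le> (Q * (real m)\<^sup>2 * real n powr (- (?d + \<alpha>))) / 4 * real (P k) powr (?d - \<alpha>) * real (s k) powr (- (?d + \<alpha>))"
          by (intro mult_right_mono) auto
        also have "\<dots> = t * (real m * real (P k) ^ ?d / 2)\<^sup>2"
          unfolding Peq by (simp add: t power_mult_distrib power_divide mult_ac)
        also have "\<dots> \<le> t * (real (M k))\<^sup>2"
          using Mlow[of k] Q by (intro mult_left_mono power_mono) (auto simp: t_def)
        finally show "L / 4 * real (\<Prod>j<k. s j) powr (?d - \<alpha>) * real (s k) powr (- (?d + \<alpha>)) \<le> t * (real (M k))\<^sup>2"
          unfolding P_def .
      qed
      ultimately show ?case by (simp add: MS)
    qed
    have Mk: "k \<le> M k" for k
    proof -
      have "2 ^ k \<le> M k"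
      proof (induction k)
        case (Suc k)
        have "2 * 2 ^ k \<le> (s k ^ ?d - 1) * M k" using Suc S3[of k] by (intro mult_le_mono) auto
        then show ?case by (simp add: MS)
      qed (use m in \<open>simp add: M_def\<close>)
      then show ?thesis using less_exp[of k] by linarith
    qed
    \<comment> \<open>A cluster of size \<open>M k\<close> exists with probability at least
      \<open>3 / 4\<close>, so the mean number of vertices in such clusters is at least
      \<open>3 / 4 * M k\<close>. Divided by the volume \<open>(n * P k) ^ d\<close>, and with
      \<open>M k \<ge> m * P k ^ d / 2\<close>, this is a density not depending on \<open>k\<close>.
      Some vertex attains it and is moved to the origin.\<close>
    show "large_clusters w"
      unfolding large_clusters_def
    proof (intro exI[of _ "3 / 8 * real m / real n ^ ?d"] conjI allI)
      show "0 < 3 / 8 * real m / real n ^ ?d" using m n by auto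
      fix k
      let ?B = "lbox 0 (N k) :: (int ^ 'd) set"
      let ?p = "\<lambda>x. bern (edges ?B) w (\<lambda>\<omega>. of_bool (M k \<le> card (clus \<omega> x \<inter> ?B)))"
      have w0': "0 \<le> w e" if "e \<in> edges ?B" for e using w0[OF N1 that] .
      have "real (M k) * (3 / 4) \<le> real (M k) * bern (edges ?B) w (\<lambda>\<omega>. of_bool (big ?B (M k) \<omega>))"
        using main[of k] \<epsilon>(2)[of k] by (intro mult_left_mono) (auto simp: of_bool_not_iff bern_diff finite_edges)
      also have "\<dots> \<le> bern (edges ?B) w (\<lambda>\<omega>. \<Sum>x\<in>?B. of_bool (M k \<le> card (clus \<omega> x \<inter> ?B)))"
        unfolding bern_cmult[symmetric]
      proof (rule bern_mono[OF w0'])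
        fix \<omega> assume \<omega>: "\<omega> \<subseteq> edges ?B"
        show "real (M k) * of_bool (big ?B (M k) \<omega>) \<le> (\<Sum>x\<in>?B. of_bool (M k \<le> card (clus \<omega> x \<inter> ?B)))"
        proof (cases "big ?B (M k) \<omega>")
          case True
          then obtain x where x: "x \<in> ?B" "M k \<le> card (clus \<omega> x \<inter> ?B)" by (auto simp: big_def)
          have "real (M k) \<le> (\<Sum>y\<in>clus \<omega> x \<inter> ?B. 1)" using x by simp
          also have "\<dots> = (\<Sum>y\<in>clus \<omega> x \<inter> ?B. of_bool (M k \<le> card (clus \<omega> y \<inter> ?B)))"
          proof (rule sum.cong[OF refl])
            fix y assume "y \<in> clus \<omega> x \<inter> ?B"
            then have "clus \<omega> y = clus \<omega> x" by (intro cluster_eq) auto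
            then show "1 = (of_bool (M k \<le> card (clus \<omega> y \<inter> ?B)) :: real)" using x by simp
          qed
          also have "\<dots> \<le> (\<Sum>x\<in>?B. of_bool (M k \<le> card (clus \<omega> x \<inter> ?B)))"
            by (intro sum_mono2) auto
          finally show ?thesis using True by simp
        qed (simp add: sum_nonneg)
      qed
      also have "\<dots> = (\<Sum>x\<in>?B. ?p x)" by (rule bern_sum)
      finally have sum: "real (M k) * (3 / 4) \<le> (\<Sum>x\<in>?B. ?p x)" .
      have "\<exists>x\<in>?B. 3 / 8 * real m / real n ^ ?d \<le> ?p x"
      proof (rule ccontr)
        assume "\<not> (\<exists>x\<in>?B. 3 / 8 * real m / real n ^ ?d \<le> ?p x)"
        then have "?p x < 3 / 8 * real m / real n ^ ?d" if "x \<in> ?B" for x using that by auto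
        moreover have "?B \<noteq> {}" using card_lbox[of 0 "N k"] N1[of k] by (metis card.empty le_zero_eq not_one_le_zero power_eq_0_iff)
        ultimately have "(\<Sum>x\<in>?B. ?p x) < (\<Sum>x\<in>?B. 3 / 8 * real m / real n ^ ?d)"
          by (intro sum_strict_mono) auto
        also have "\<dots> = 3 / 8 * real m * real (P k) ^ ?d"
          using n by (simp add: N_def power_mult_distrib)
        also have "\<dots> \<le> real (M k) * (3 / 4)" using Mlow[of k] by simp
        finally show False using sum by simp
      qed
      then obtain x where x: "x \<in> ?B" "3 / 8 * real m / real n ^ ?d \<le> ?p x" by auto
      define f :: "int ^ 'd \<Rightarrow> int ^ 'd" where "f = (+) (- x)"
      have f: "inj f" "f x = 0" by (simp_all add: f_def)
      let ?V = "f ` ?B"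
      have "?p x = bern (edges ?V) w (\<lambda>\<omega>. of_bool (M k \<le> card (clus \<omega> 0 \<inter> ?V)))"
      proof -
        have "card (clus ((`) f ` \<omega>) 0 \<inter> ?V) = card (clus \<omega> x \<inter> ?B)" for \<omega>
        proof -
          have "clus ((`) f ` \<omega>) 0 = f ` clus \<omega> x" using clus_image[OF f(1), of \<omega> x] f(2) by simp
          then have "clus ((`) f ` \<omega>) 0 \<inter> ?V = f ` (clus \<omega> x \<inter> ?B)"
            using f(1) by (simp add: image_Int)
          then show ?thesis using f(1) by (simp add: card_image inj_on_subset)
        qed
        moreover have "w (f ` e) = w e" for e unfolding f_def by (rule inv)
        ultimately show ?thesis by (simp add: bern_edges_image[OF f(1)])
      qed
      also have "\<dots> \<le> bern (edges ?V) w (\<lambda>\<omega>. of_bool (k \<le> card (clus \<omega> 0 \<inter> ?V)))"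
      proof (rule bern_mono)
        show "0 \<le> w e" if "e \<in> edges ?V" for e
          using w0[OF N1, of e "- x + 0" k] that by (simp only: f_def lbox_translate)
        show "of_bool (M k \<le> card (clus \<omega> 0 \<inter> ?V)) \<le> (of_bool (k \<le> card (clus \<omega> 0 \<inter> ?V)) :: real)" for \<omega>
          using Mk[of k] by (simp add: of_bool_def)
      qed
      finally show "\<exists>V. finite V \<and> 3 / 8 * real m / real n ^ ?d \<le> bern (edges V) w (\<lambda>\<omega>. of_bool (k \<le> card (clus \<omega> 0 \<inter> V)))"
        using x by (intro exI[of _ ?V]) auto
    qed
  qed
qed

section \<open>Finite volumes and the infinite percolation measure\<close>

text \<open>\<open>edge_weight\<close> is unspecified on sets that are not pairs; those are given weight 0.\<close>

definition pweight :: "('v \<Rightarrow> 'v \<Rightarrow> real) \<Rightarrow> real \<Rightarrow> 'v set \<Rightarrow> real" where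
  "pweight k \<beta> e = (if card e = 2 then \<beta> * edge_weight k e else 0)"

definition opened :: "'v set set \<Rightarrow> ('v set \<Rightarrow> bool) \<Rightarrow> 'v set set" where
  "opened E \<omega> = {e \<in> E. \<omega> e}"

text \<open>The link between the product measure and \<open>bern\<close>. Nonnegative weights make
  \<open>1 - exp (- w)\<close> a genuine probability, which \<open>bernoulli_pmf\<close> leaves
  unchanged.\<close>

lemma percolation_cylinder:
  fixes k :: "'v \<Rightarrow> 'v \<Rightarrow> real"
  assumes E: "finite E" "E \<subseteq> {e. card e = 2}" and w: "\<And>e. e \<in> E \<Longrightarrow> 0 \<le> pweight k \<beta> e"
  defines "M \<equiv> percolation k \<beta>"
  shows "{\<omega> \<in> space M. P (opened E \<omega>)} \<in> sets M"
    and "measure M {\<omega> \<in> space M. P (opened E \<omega>)} = bern E (pweight k \<beta>) (\<lambda>\<omega>. of_bool (P \<omega>))"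
proof -
  let ?I = "{e :: 'v set. card e = 2}"
  let ?N = "\<lambda>e. measure_pmf (bernoulli_pmf (1 - exp (- \<beta> * edge_weight k e)))"
  interpret product_prob_space ?N ?I
    by unfold_locales
  have M: "M = PiM ?I ?N" by (simp add: M_def percolation_def)
  define cyl where "cyl F = {\<omega> \<in> space M. opened E \<omega> = F}" for F
  have cyl_emb: "cyl F = emb ?I E (\<Pi>\<^sub>E e\<in>E. {e \<in> F})" if "F \<subseteq> E" for F
    using that E(2) by (auto simp: cyl_def M opened_def prod_emb_def space_PiM PiE_iff extensional_def)
  have cyl_sets: "cyl F \<in> sets M" if "F \<subseteq> E" for F
    unfolding cyl_emb[OF that] M using E by (intro sets_PiM_I) auto
  have cyl_measure: "measure M (cyl F) = (\<Prod>e\<in>F. 1 - exp (- pweight k \<beta> e)) * (\<Prod>e\<in>E - F. exp (- pweight k \<beta> e))"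
    if "F \<subseteq> E" for F
  proof -
    have "measure M (cyl F) = (\<Prod>e\<in>E. measure (?N e) {e \<in> F})"
      unfolding cyl_emb[OF that] M using E by (intro measure_PiM_emb) auto
    also have "\<dots> = (\<Prod>e\<in>E. if e \<in> F then 1 - exp (- pweight k \<beta> e) else exp (- pweight k \<beta> e))"
    proof (rule prod.cong[OF refl])
      fix e assume e: "e \<in> E"
      then have "card e = 2" using E(2) by auto
      with w[OF e] show "measure (?N e) {e \<in> F} = (if e \<in> F then 1 - exp (- pweight k \<beta> e) else exp (- pweight k \<beta> e))"
        by (auto simp: measure_pmf_single pweight_def)
    qed
    also have "\<dots> = (\<Prod>e\<in>F. 1 - exp (- pweight k \<beta> e)) * (\<Prod>e\<in>E - F. exp (- pweight k \<beta> e))"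
    proof -
      have "E \<inter> {e. e \<in> F} = F" "E \<inter> - {e. e \<in> F} = E - F" using that by auto
      then show ?thesis using E(1) by (simp add: prod.If_cases)
    qed
    finally show ?thesis .
  qed
  let ?F = "{F \<in> Pow E. P F}"
  have eq: "{\<omega> \<in> space M. P (opened E \<omega>)} = (\<Union>F\<in>?F. cyl F)"
    by (auto simp: cyl_def opened_def)
  have fin: "finite ?F" using E by auto
  show "{\<omega> \<in> space M. P (opened E \<omega>)} \<in> sets M"
    unfolding eq using fin cyl_sets by (intro sets.finite_UN) auto
  have "measure M {\<omega> \<in> space M. P (opened E \<omega>)} = (\<Sum>F\<in>?F. measure M (cyl F))"
    unfolding eq unfolding M using fin cyl_sets
    by (intro P.finite_measure_finite_Union) (auto simp: M disjoint_family_on_def cyl_def)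
  also have "\<dots> = (\<Sum>F\<in>?F. (\<Prod>e\<in>F. 1 - exp (- pweight k \<beta> e)) * (\<Prod>e\<in>E - F. exp (- pweight k \<beta> e)))"
    using cyl_measure by (intro sum.cong) auto
  also have "\<dots> = bern E (pweight k \<beta>) (\<lambda>\<omega>. of_bool (P \<omega>))"
    unfolding bern_def using E by (intro sum.mono_neutral_cong_left) auto
  finally show "measure M {\<omega> \<in> space M. P (opened E \<omega>)} = bern E (pweight k \<beta>) (\<lambda>\<omega>. of_bool (P \<omega>))" .
qed

section \<open>Exhaustion of the lattice by cubes\<close>

definition cube :: "nat \<Rightarrow> (int ^ 'd) set" where
  "cube R = lbox (\<chi> i. - int R) (2 * R + 1)"

lemma finite_cube [simp]: "finite (cube R)"
  by (simp add: cube_def)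

lemma mem_cube_iff: "x \<in> cube R \<longleftrightarrow> (\<forall>i. \<bar>x $ i\<bar> \<le> int R)"
proof -
  have "- int R \<le> x $ i \<and> x $ i < - int R + int (2 * R + 1) \<longleftrightarrow> \<bar>x $ i\<bar> \<le> int R" for i
    by (auto simp: abs_le_iff)
  then show ?thesis by (simp add: cube_def lbox_def)
qed

lemma cube_mono: "R \<le> R' \<Longrightarrow> cube R \<subseteq> cube R'"
proof
  fix x :: "int ^ 'd" assume "R \<le> R'" "x \<in> cube R"
  then have "\<bar>x $ i\<bar> \<le> int R" "int R \<le> int R'" for i by (auto simp: mem_cube_iff)
  then show "x \<in> cube R'" unfolding mem_cube_iff by (meson order_trans)
qed

lemma zero_in_cube [simp]: "0 \<in> cube R"
  by (simp add: mem_cube_iff)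

lemma finite_subset_cube:
  fixes V :: "(int ^ 'd) set"
  assumes "finite V" obtains R where "V \<subseteq> cube R"
  using assms
proof (induction V arbitrary: thesis rule: finite_induct)
  case (insert x V)
  obtain R where R: "V \<subseteq> cube R" using insert.IH by blast
  define R' where "R' = nat (\<Sum>i\<in>UNIV. \<bar>x $ i\<bar>)"
  have "\<bar>x $ i\<bar> \<le> (\<Sum>i\<in>UNIV. \<bar>x $ i\<bar>)" for i by (rule member_le_sum) auto
  then have "\<bar>x $ i\<bar> \<le> int R'" for i by (simp add: R'_def sum_nonneg)
  then have "x \<in> cube R'" by (simp add: mem_cube_iff)
  then have "insert x V \<subseteq> cube (max R R')"
    using R cube_mono[of R "max R R'"] cube_mono[of R' "max R R'"] by auto
  then show ?case by (rule insert.prems)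
qed auto

abbreviation vol :: "nat \<Rightarrow> ((int ^ 'd) set \<Rightarrow> bool) \<Rightarrow> (int ^ 'd) set set" where
  "vol R \<equiv> opened (edges (cube R))"

lemma opened_mono: "E \<subseteq> E' \<Longrightarrow> opened E \<omega> \<subseteq> opened E' \<omega>"
  by (auto simp: opened_def)

lemma clus_vol_mono: "R \<le> R' \<Longrightarrow> clus (vol R \<omega>) x \<subseteq> clus (vol R' \<omega>) x"
  by (intro clus_mono opened_mono edges_mono cube_mono)

lemma clus_vol_le_cluster: "clus (vol R \<omega>) x \<subseteq> cluster \<omega> x"
  by (rule cluster_mono) (auto simp: opened_def)

lemma cluster_eq_Union_vol: "cluster \<omega> x = (\<Union>R. clus (vol R \<omega>) x \<inter> cube R)"
proof
  show "cluster \<omega> x \<subseteq> (\<Union>R. clus (vol R \<omega>) x \<inter> cube R)"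
  proof
    fix y assume "y \<in> cluster \<omega> x"
    then show "y \<in> (\<Union>R. clus (vol R \<omega>) x \<inter> cube R)"
    proof (induction rule: cluster_induct)
      case refl
      obtain R where "{x} \<subseteq> cube R" by (rule finite_subset_cube[of "{x}"]) auto
      then show ?case by auto
    next
      case (step y z)
      then obtain R where R: "y \<in> clus (vol R \<omega>) x" "y \<in> cube R" by auto
      obtain R' where R': "{z} \<subseteq> cube R'" by (rule finite_subset_cube[of "{z}"]) auto
      define r where "r = max R R'"
      have r: "y \<in> clus (vol r \<omega>) x" "y \<in> cube r" "z \<in> cube r"
        using R R' clus_vol_mono[of R r] cube_mono[of R r] cube_mono[of R' r] by (auto simp: r_def)
      have "z \<in> clus (vol r \<omega>) x"
        by (rule cluster_step[OF r(1)]) (use r step in \<open>auto simp: opened_def edges_pair_iff\<close>)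
      then show ?case using r by auto
    qed
  qed
qed (use clus_vol_le_cluster in auto)

text \<open>This writes an infinite cluster through countably many events of finitely many edges,
  which gives both measurability and the limit in \<open>k\<close>.\<close>

lemma infinite_cluster_iff:
  "infinite (cluster \<omega> x) \<longleftrightarrow> (\<forall>k. \<exists>R. k \<le> card (clus (vol R \<omega>) x \<inter> cube R))"
proof
  assume inf: "infinite (cluster \<omega> x)"
  show "\<forall>k. \<exists>R. k \<le> card (clus (vol R \<omega>) x \<inter> cube R)"
  proof
    fix k
    obtain F where F: "finite F" "card F = k" "F \<subseteq> cluster \<omega> x"
      using infinite_arbitrarily_large[OF inf] by metis
    have "\<exists>R. F \<subseteq> clus (vol R \<omega>) x \<inter> cube R"
      using F(1,3)
    proof (induction F rule: finite_induct)
      case (insert y F)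
      then obtain R where R: "F \<subseteq> clus (vol R \<omega>) x \<inter> cube R" by auto
      have "y \<in> (\<Union>R. clus (vol R \<omega>) x \<inter> cube R)" using insert.prems cluster_eq_Union_vol by blast
      then obtain R' where R': "y \<in> clus (vol R' \<omega>) x \<inter> cube R'" by auto
      show ?case
        using R R' clus_vol_mono[of R "max R R'" \<omega> x] clus_vol_mono[of R' "max R R'" \<omega> x]
          cube_mono[of R "max R R'"] cube_mono[of R' "max R R'"]
        by (intro exI[of _ "max R R'"]) auto
    qed auto
    then obtain R where "F \<subseteq> clus (vol R \<omega>) x \<inter> cube R" by auto
    then have "card F \<le> card (clus (vol R \<omega>) x \<inter> cube R)" by (intro card_mono) auto
    then show "\<exists>R. k \<le> card (clus (vol R \<omega>) x \<inter> cube R)" using F by auto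
  qed
next
  assume *: "\<forall>k. \<exists>R. k \<le> card (clus (vol R \<omega>) x \<inter> cube R)"
  show "infinite (cluster \<omega> x)"
  proof
    assume fin: "finite (cluster \<omega> x)"
    obtain R where "Suc (card (cluster \<omega> x)) \<le> card (clus (vol R \<omega>) x \<inter> cube R)" using * by blast
    moreover have "card (clus (vol R \<omega>) x \<inter> cube R) \<le> card (cluster \<omega> x)"
      using clus_vol_le_cluster[of R \<omega> x] fin by (intro card_mono) auto
    ultimately show False by simp
  qed
qed

lemma finite_edges_cube [simp]: "finite (edges (cube R))"
  by (simp add: finite_edges)

lemma edges_card2: "edges B \<subseteq> {e. card e = 2}"
  by (auto simp: edges_def)

lemma large_clusters_percolates:
  fixes k :: "int ^ 'd \<Rightarrow> int ^ 'd \<Rightarrow> real"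
  assumes w: "\<And>e. 0 \<le> pweight k \<beta> e" and "large_clusters (pweight k \<beta>)"
  shows "measure (percolation k \<beta>) {\<omega> \<in> space (percolation k \<beta>). \<exists>x. infinite (cluster \<omega> x)} > 0"
proof -
  let ?M = "percolation k \<beta>"
  interpret prob_space ?M by (rule prob_space_percolation)
  obtain c where c: "0 < c" "\<And>j. \<exists>V. finite V \<and> c \<le> bern (edges V) (pweight k \<beta>) (\<lambda>\<omega>. of_bool (j \<le> card (clus \<omega> 0 \<inter> V)))"
    using assms(2) unfolding large_clusters_def by auto
  define B where "B x j R = {\<omega> \<in> space ?M. j \<le> card (clus (vol R \<omega>) x \<inter> cube R)}" for x :: "int ^ 'd" and j R
  define A where "A x j = (\<Union>R. B x j R)" for x j
  have B: "B x j R \<in> sets ?M" for x j R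
    unfolding B_def by (rule percolation_cylinder) (use w edges_card2 in auto)
  have A: "A x j \<in> sets ?M" for x j
    unfolding A_def using B by auto
  have inf: "{\<omega> \<in> space ?M. infinite (cluster \<omega> x)} = (\<Inter>j. A x j)" for x
    by (auto simp: infinite_cluster_iff A_def B_def)
  \<comment> \<open>On a nonmeasurable set \<open>measure\<close> would have the default value 0, so
    measurability has to precede the lower bound.\<close>
  have meas: "{\<omega> \<in> space ?M. \<exists>x. infinite (cluster \<omega> x)} \<in> sets ?M"
  proof -
    have "{\<omega> \<in> space ?M. \<exists>x. infinite (cluster \<omega> x)} = (\<Union>x. {\<omega> \<in> space ?M. infinite (cluster \<omega> x)})" by auto
    also have "\<dots> \<in> sets ?M"
      unfolding inf using A by (intro sets.countable_UN image_subsetI sets.countable_INT) auto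
    finally show ?thesis .
  qed
  have Ac: "c \<le> measure ?M (A 0 j)" for j
  proof -
    obtain V where V: "finite V" "c \<le> bern (edges V) (pweight k \<beta>) (\<lambda>\<omega>. of_bool (j \<le> card (clus \<omega> 0 \<inter> V)))"
      using c(2) by blast
    obtain R where R: "V \<subseteq> cube R" by (rule finite_subset_cube[OF V(1)])
    note V(2)
    also have "bern (edges V) (pweight k \<beta>) (\<lambda>\<omega>. of_bool (j \<le> card (clus \<omega> 0 \<inter> V)))
      = bern (edges (cube R)) (pweight k \<beta>) (\<lambda>\<omega>. of_bool (j \<le> card (clus (\<omega> \<inter> edges V) 0 \<inter> V)))"
      by (rule bern_restrict[symmetric]) (use edges_mono[OF R] in auto)
    also have "\<dots> \<le> bern (edges (cube R)) (pweight k \<beta>) (\<lambda>\<omega>. of_bool (j \<le> card (clus \<omega> 0 \<inter> cube R)))"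
    proof (rule bern_mono[OF w])
      fix \<omega>
      have "card (clus (\<omega> \<inter> edges V) 0 \<inter> V) \<le> card (clus \<omega> 0 \<inter> cube R)"
        using R clus_mono[of "\<omega> \<inter> edges V" \<omega> 0] by (intro card_mono) auto
      then show "of_bool (j \<le> card (clus (\<omega> \<inter> edges V) 0 \<inter> V)) \<le> (of_bool (j \<le> card (clus \<omega> 0 \<inter> cube R)) :: real)"
        by auto
    qed
    also have "\<dots> = measure ?M (B 0 j R)"
      unfolding B_def by (rule percolation_cylinder(2)[symmetric]) (use w edges_card2 in auto)
    also have "\<dots> \<le> measure ?M (A 0 j)" using A by (intro finite_measure_mono) (auto simp: A_def)
    finally show ?thesis .
  qed
  \<comment> \<open>Continuity from above: the events decrease in \<open>j\<close> and all have
    probability at least \<open>c\<close>.\<close>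
  have "(\<lambda>j. measure ?M (A 0 j)) \<longlonglongrightarrow> measure ?M (\<Inter>j. A 0 j)"
  proof (rule finite_Lim_measure_decseq)
    show "range (A 0) \<subseteq> sets ?M" using A by auto
    show "decseq (A 0)" by (rule decseq_SucI) (auto simp: A_def B_def intro: Suc_leD)
  qed
  then have "c \<le> measure ?M (\<Inter>j. A 0 j)" using Ac by (intro LIMSEQ_le_const) auto
  also have "\<dots> \<le> measure ?M {\<omega> \<in> space ?M. \<exists>x. infinite (cluster \<omega> x)}"
    unfolding inf[symmetric] using meas by (intro finite_measure_mono) auto
  finally show ?thesis using c(1) by linarith
qed

text \<open>Monotone convergence is applied twice, to the sum over the cluster and to the
  expectation. For a fixed cube only finitely many connection events are involved.\<close>

lemma nn_integral_cluster:
  fixes k :: "int ^ 'd \<Rightarrow> int ^ 'd \<Rightarrow> real" and f :: "int ^ 'd \<Rightarrow> real"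
  assumes w: "\<And>e. 0 \<le> pweight k \<beta> e" and f: "\<And>x. 0 \<le> f x"
  shows "(\<integral>\<^sup>+ \<omega>. (\<integral>\<^sup>+ x. ennreal (f x) \<partial>count_space (cluster \<omega> 0)) \<partial>percolation k \<beta>)
    = (SUP R. ennreal (\<Sum>x\<in>cube R. f x * conn (cube R) (pweight k \<beta>) 0 x))"
proof -
  let ?M = "percolation k \<beta>"
  interpret prob_space ?M by (rule prob_space_percolation)
  define K where "K R \<omega> = clus (vol R \<omega>) 0 \<inter> cube R" for R and \<omega> :: "(int ^ 'd) set \<Rightarrow> bool"
  have K: "incseq (\<lambda>R. K R \<omega>)" for \<omega>
    unfolding K_def incseq_def using clus_vol_mono cube_mono by blast
  have KU: "cluster \<omega> 0 = (\<Union>R. K R \<omega>)" for \<omega> unfolding K_def by (rule cluster_eq_Union_vol)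
  have Kfin: "finite (K R \<omega>)" for R \<omega> by (simp add: K_def)
  have Kmeas: "{\<omega> \<in> space ?M. x \<in> K R \<omega>} \<in> sets ?M" for x R
    unfolding K_def by (rule percolation_cylinder) (use w edges_card2 in auto)
  define G where "G R \<omega> = (\<Sum>x\<in>cube R. ennreal (f x) * indicator {\<omega> \<in> space ?M. x \<in> K R \<omega>} \<omega>)" for R \<omega>
  have Gmeas: "G R \<in> borel_measurable ?M" for R
    unfolding G_def using Kmeas by measurable
  have GK: "G R \<omega> = (\<integral>\<^sup>+ x. ennreal (f x) * indicator (K R \<omega>) x \<partial>count_space UNIV)" if "\<omega> \<in> space ?M" for R \<omega>
  proof -
    have "(\<integral>\<^sup>+ x. ennreal (f x) * indicator (K R \<omega>) x \<partial>count_space UNIV)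
        = (\<Sum>x\<in>cube R. ennreal (f x) * indicator (K R \<omega>) x)"
      by (rule nn_integral_count_space') (auto simp: K_def)
    then show ?thesis using that by (simp add: G_def indicator_def)
  qed
  have "(\<integral>\<^sup>+ x. ennreal (f x) \<partial>count_space (cluster \<omega> 0)) = (SUP R. G R \<omega>)" if \<omega>: "\<omega> \<in> space ?M" for \<omega>
  proof -
    have "(\<integral>\<^sup>+ x. ennreal (f x) \<partial>count_space (cluster \<omega> 0))
        = (\<integral>\<^sup>+ x. ennreal (f x) * indicator (cluster \<omega> 0) x \<partial>count_space UNIV)"
      by (simp add: nn_integral_count_space_indicator)
    also have "\<dots> = (\<integral>\<^sup>+ x. (SUP R. ennreal (f x) * indicator (K R \<omega>) x) \<partial>count_space UNIV)"
    proof (rule nn_integral_cong)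
      fix x
      have "(SUP R. indicator (K R \<omega>) x :: ennreal) = indicator (cluster \<omega> 0) x"
      proof (cases "x \<in> cluster \<omega> 0")
        case True
        then obtain R where "x \<in> K R \<omega>" using KU by auto
        then have "(indicator (cluster \<omega> 0) x :: ennreal) \<le> (SUP R. indicator (K R \<omega>) x)"
          using True by (intro SUP_upper2[of R]) auto
        moreover have "(SUP R. indicator (K R \<omega>) x :: ennreal) \<le> indicator (cluster \<omega> 0) x"
          using True by (intro SUP_least) (simp add: indicator_def)
        ultimately show ?thesis by (rule antisym[rotated])
      next
        case False
        then have "x \<notin> K R \<omega>" for R using KU by auto
        then show ?thesis using False by simp
      qed
      then show "ennreal (f x) * indicator (cluster \<omega> 0) x = (SUP R. ennreal (f x) * indicator (K R \<omega>) x)"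
        by (subst SUP_mult_left_ennreal[symmetric]) simp
    qed
    also have "\<dots> = (SUP R. \<integral>\<^sup>+ x. ennreal (f x) * indicator (K R \<omega>) x \<partial>count_space UNIV)"
    proof (rule nn_integral_monotone_convergence_SUP)
      show "incseq (\<lambda>R x. ennreal (f x) * indicator (K R \<omega>) x)"
        using K[of \<omega>] by (auto simp: incseq_def le_fun_def indicator_def subset_eq)
    qed auto
    also have "\<dots> = (SUP R. G R \<omega>)" using GK[OF \<omega>] by simp
    finally show ?thesis .
  qed
  then have "(\<integral>\<^sup>+ \<omega>. (\<integral>\<^sup>+ x. ennreal (f x) \<partial>count_space (cluster \<omega> 0)) \<partial>?M) = (\<integral>\<^sup>+ \<omega>. (SUP R. G R \<omega>) \<partial>?M)"
    by (intro nn_integral_cong) auto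
  also have "\<dots> = (SUP R. \<integral>\<^sup>+ \<omega>. G R \<omega> \<partial>?M)"
  proof (rule nn_integral_monotone_convergence_SUP_AE)
    show "AE \<omega> in ?M. G R \<omega> \<le> G (Suc R) \<omega>" for R
    proof (rule AE_I2)
      fix \<omega> assume \<omega>: "\<omega> \<in> space ?M"
      have "K R \<omega> \<subseteq> K (Suc R) \<omega>" using K[of \<omega>] by (auto simp: incseq_def)
      then show "G R \<omega> \<le> G (Suc R) \<omega>"
        unfolding GK[OF \<omega>] by (intro nn_integral_mono mult_left_mono) (auto simp: indicator_def)
    qed
  qed (rule Gmeas)
  also have "(\<lambda>R. \<integral>\<^sup>+ \<omega>. G R \<omega> \<partial>?M) = (\<lambda>R. ennreal (\<Sum>x\<in>cube R. f x * conn (cube R) (pweight k \<beta>) 0 x))"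
  proof
    fix R
    have "(\<integral>\<^sup>+ \<omega>. G R \<omega> \<partial>?M) = (\<Sum>x\<in>cube R. ennreal (f x) * emeasure ?M {\<omega> \<in> space ?M. x \<in> K R \<omega>})"
      unfolding G_def using Kmeas
      by (subst nn_integral_sum) (auto intro!: sum.cong nn_integral_cmult_indicator)
    also have "\<dots> = (\<Sum>x\<in>cube R. ennreal (f x * conn (cube R) (pweight k \<beta>) 0 x))"
    proof (rule sum.cong[OF refl])
      fix x :: "int ^ 'd" assume x: "x \<in> cube R"
      have "measure ?M {\<omega> \<in> space ?M. x \<in> clus (vol R \<omega>) 0} = conn (cube R) (pweight k \<beta>) 0 x"
        unfolding conn_def by (rule percolation_cylinder(2)) (use w edges_card2 in auto)
      then have "emeasure ?M {\<omega> \<in> space ?M. x \<in> K R \<omega>} = ennreal (conn (cube R) (pweight k \<beta>) 0 x)"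
        using x by (simp add: K_def emeasure_eq_measure)
      then show "ennreal (f x) * emeasure ?M {\<omega> \<in> space ?M. x \<in> K R \<omega>} = ennreal (f x * conn (cube R) (pweight k \<beta>) 0 x)"
        using f by (simp add: ennreal_mult conn_nonneg w)
    qed
    also have "\<dots> = ennreal (\<Sum>x\<in>cube R. f x * conn (cube R) (pweight k \<beta>) 0 x)"
      using f by (intro sum_ennreal) (auto intro!: mult_nonneg_nonneg conn_nonneg w)
    finally show "(\<integral>\<^sup>+ \<omega>. G R \<omega> \<partial>?M) = ennreal (\<Sum>x\<in>cube R. f x * conn (cube R) (pweight k \<beta>) 0 x)" .
  qed
  finally show ?thesis .
qed

lemma expected_cluster_size_eq:
  assumes "\<And>e. 0 \<le> pweight k \<beta> e"
  shows "expected_cluster_size k \<beta> = (SUP R. ennreal (\<Sum>x\<in>cube R. conn (cube R) (pweight k \<beta>) 0 x))"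
proof -
  have eq: "emeasure (count_space UNIV) (cluster \<omega> (0 :: int ^ 'd)) = (\<integral>\<^sup>+ x. ennreal 1 \<partial>count_space (cluster \<omega> 0))"
    for \<omega> :: "(int ^ 'd) set \<Rightarrow> bool"
    by (subst nn_integral_count_space_indicator) simp_all
  show ?thesis
    unfolding expected_cluster_size_def eq using nn_integral_cluster[OF assms, of "\<lambda>_. 1"]
    by (simp only: mult_1_left zero_le_one)
qed

section \<open>Estimates for the kernels\<close>

lemma antimono_tendsto_0_nonneg:
  fixes h h' :: "real \<Rightarrow> real"
  assumes "\<And>x. R \<le> x \<Longrightarrow> (h has_real_derivative h' x) (at x)" "\<And>x. R \<le> x \<Longrightarrow> h' x \<le> 0"
    and "(h \<longlongrightarrow> 0) at_top" "R \<le> r"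
  shows "0 \<le> h r"
proof (rule tendsto_upperbound[OF assms(3)])
  have "h s \<le> h r" if "r \<le> s" for s
    by (rule DERIV_nonpos_imp_nonincreasing[OF that]) (use assms(1,2,4) in \<open>meson order_trans\<close>)
  then show "eventually (\<lambda>s. h s \<le> h r) at_top" using eventually_ge_at_top by (rule eventually_mono[rotated])
qed simp

lemma admissible_kernel_deriv:
  assumes "admissible_kernel d \<alpha> J" "0 < r"
  shows "(J has_real_derivative deriv J r) (at r)" "deriv J r \<le> 0"
proof -
  show D: "(J has_real_derivative deriv J r) (at r)"
    using assms by (simp add: admissible_kernel_def DERIV_deriv_iff_real_differentiable)
  have "mono_on {0<..} (\<lambda>x. - J x)"
    using assms(1) by (auto simp: admissible_kernel_def monotone_on_def)
  moreover have "((\<lambda>x. - J x) has_real_derivative - deriv J r) (at r)" by (intro DERIV_minus D)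
  ultimately have "- deriv J r \<ge> 0"
    by (rule mono_on_imp_deriv_nonneg) (use assms(2) in \<open>simp add: interior_open\<close>)
  then show "deriv J r \<le> 0" by simp
qed

lemma admissible_kernel_antimono:
  "admissible_kernel d \<alpha> J \<Longrightarrow> 0 < r \<Longrightarrow> r \<le> s \<Longrightarrow> J s \<le> J r"
  by (auto simp: admissible_kernel_def monotone_on_def)

text \<open>Once \<open>\<bar>\<delta> r\<bar> < 1 / 2\<close>, the derivative lies between two
  multiples of \<open>r powr (- a - 1)\<close>. Then \<open>J\<close> minus the corresponding
  multiple of \<open>r powr (- a)\<close> is monotone and tends to 0, which fixes its sign.\<close>

lemma admissible_kernel_bounds:
  assumes J: "admissible_kernel d \<alpha> J" and a: "0 < real d + \<alpha>" and r0: "0 < r0"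
  obtains c C where "0 < c" "0 < C"
    "\<And>r. r0 \<le> r \<Longrightarrow> c * r powr (- (d + \<alpha>)) \<le> J r"
    "\<And>r. r0 \<le> r \<Longrightarrow> J r \<le> C * r powr (- (d + \<alpha>))"
proof -
  define a where "a = d + \<alpha>"
  have a0: "0 < a" using a by (simp add: a_def)
  from J obtain C0 \<delta> where C0: "0 < C0" and \<delta>: "\<And>r. 0 < r \<Longrightarrow> \<bar>deriv J r\<bar> = C0 * (1 + \<delta> r) * r powr (- real d - \<alpha> - 1)"
    and lim: "(\<delta> \<longlongrightarrow> 0) at_top"
    unfolding admissible_kernel_def by blast
  have "eventually (\<lambda>r. dist (\<delta> r) 0 < 1 / 2) at_top" using lim by (rule tendstoD) simp
  then obtain R1 where R1: "\<And>r. r \<ge> R1 \<Longrightarrow> \<bar>\<delta> r\<bar> < 1 / 2" by (auto simp: eventually_at_top_linorder)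
  define R where "R = max r0 R1"
  have R: "0 < R" "r0 \<le> R" using r0 by (auto simp: R_def)
  have dJ: "C0 / 2 * r powr (- a - 1) \<le> - deriv J r" "- deriv J r \<le> 3 * C0 / 2 * r powr (- a - 1)" if "R \<le> r" for r
  proof -
    have r: "0 < r" "\<bar>\<delta> r\<bar> < 1 / 2" using that R R1[of r] by (auto simp: R_def)
    have e: "- deriv J r = C0 * (1 + \<delta> r) * r powr (- a - 1)"
      using \<delta>[OF r(1)] admissible_kernel_deriv(2)[OF J r(1)] by (simp add: a_def)
    have "1 / 2 \<le> 1 + \<delta> r" "1 + \<delta> r \<le> 3 / 2" using r(2) by linarith+
    from this[THEN mult_left_mono[OF _ less_imp_le[OF C0]]]
    have CC: "C0 / 2 \<le> C0 * (1 + \<delta> r)" "C0 * (1 + \<delta> r) \<le> 3 * C0 / 2" by simp_all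
    show "C0 / 2 * r powr (- a - 1) \<le> - deriv J r" "- deriv J r \<le> 3 * C0 / 2 * r powr (- a - 1)"
      unfolding e using CC by (intro mult_right_mono; simp)+
  qed
  have Jlim: "(J \<longlongrightarrow> 0) at_top" using J by (simp add: admissible_kernel_def)
  have plim: "((\<lambda>r. k * r powr (- a)) \<longlongrightarrow> 0) at_top" for k
    using tendsto_mult_right_zero[OF tendsto_neg_powr[of "- a" "\<lambda>x. x" at_top], of k] a0
    by (simp add: filterlim_ident)
  have pder: "((\<lambda>r. k * r powr (- a)) has_real_derivative k * (- a * r powr (- a - 1))) (at r)" if "0 < r" for k r
    using that by (auto intro!: derivative_eq_intros)
  have low: "C0 / (2 * a) * r powr (- a) \<le> J r" if "R \<le> r" for r
  proof -
    have "0 \<le> J r - C0 / (2 * a) * r powr (- a)"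
    proof (rule antimono_tendsto_0_nonneg[OF _ _ _ that])
      fix x assume x: "R \<le> x"
      show "((\<lambda>r. J r - C0 / (2 * a) * r powr (- a)) has_real_derivative deriv J x - C0 / (2 * a) * (- a * x powr (- a - 1))) (at x)"
        using x R by (intro DERIV_diff pder admissible_kernel_deriv[OF J]) auto
      show "deriv J x - C0 / (2 * a) * (- a * x powr (- a - 1)) \<le> 0"
        using dJ(1)[OF x] a0 by simp
    next
      show "((\<lambda>r. J r - C0 / (2 * a) * r powr (- a)) \<longlongrightarrow> 0) at_top"
        using tendsto_diff[OF Jlim plim[of "C0 / (2 * a)"]] by simp
    qed
    then show ?thesis by simp
  qed
  have up: "J r \<le> 3 * C0 / (2 * a) * r powr (- a)" if "R \<le> r" for r
  proof -
    have "0 \<le> 3 * C0 / (2 * a) * r powr (- a) - J r"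
    proof (rule antimono_tendsto_0_nonneg[OF _ _ _ that])
      fix x assume x: "R \<le> x"
      show "((\<lambda>r. 3 * C0 / (2 * a) * r powr (- a) - J r) has_real_derivative 3 * C0 / (2 * a) * (- a * x powr (- a - 1)) - deriv J x) (at x)"
        using x R by (intro DERIV_diff pder admissible_kernel_deriv[OF J]) auto
      show "3 * C0 / (2 * a) * (- a * x powr (- a - 1)) - deriv J x \<le> 0"
        using dJ(2)[OF x] a0 by simp
    next
      show "((\<lambda>r. 3 * C0 / (2 * a) * r powr (- a) - J r) \<longlongrightarrow> 0) at_top"
        using tendsto_diff[OF plim[of "3 * C0 / (2 * a)"] Jlim] by simp
    qed
    then show ?thesis by simp
  qed
  have Jpos: "0 < J r" if "0 < r" for r using J that by (auto simp: admissible_kernel_def)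
  \<comment> \<open>The second entries of the minimum and of the maximum cover the bounded range
    from \<open>r0\<close> to \<open>R\<close>, where
    \<open>J R \<le> J r \<le> J r0\<close>.\<close>
  define c where "c = min (C0 / (2 * a)) (J R * r0 powr a)"
  define C where "C = max (3 * C0 / (2 * a)) (J r0 * R powr a)"
  show ?thesis
  proof (rule that[of c C])
    show "0 < c" using C0 a0 R r0 Jpos by (simp add: c_def)
    have "0 < 3 * C0 / (2 * a)" using C0 a0 by simp
    then show "0 < C" unfolding C_def by (rule less_le_trans) simp
    fix r assume r: "r0 \<le> r"
    show "c * r powr (- (d + \<alpha>)) \<le> J r"
    proof (cases "R \<le> r")
      case True
      have "c * r powr (- a) \<le> C0 / (2 * a) * r powr (- a)" by (intro mult_right_mono) (auto simp: c_def)
      then show ?thesis using low[OF True] by (simp add: a_def)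
    next
      case False
      have "r0 powr a * r powr (- a) \<le> r0 powr a * r0 powr (- a)"
        using r r0 a0 by (intro mult_left_mono powr_mono2') auto
      also have "\<dots> = 1" using r0 by (simp add: powr_add[symmetric])
      finally have "J R * (r0 powr a * r powr (- a)) \<le> J R * 1"
        using Jpos[OF R(1)] by (intro mult_left_mono) auto
      moreover have "c * r powr (- a) \<le> (J R * r0 powr a) * r powr (- a)"
        by (intro mult_right_mono) (auto simp: c_def)
      moreover have "J R \<le> J r" using False r r0 by (intro admissible_kernel_antimono[OF J]) auto
      ultimately show ?thesis by (simp add: a_def mult.assoc)
    qed
    show "J r \<le> C * r powr (- (d + \<alpha>))"
    proof (cases "R \<le> r")
      case True
      have "3 * C0 / (2 * a) * r powr (- a) \<le> C * r powr (- a)" by (intro mult_right_mono) (auto simp: C_def)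
      then show ?thesis using up[OF True] by (simp add: a_def)
    next
      case False
      have "1 = R powr a * R powr (- a)" using R by (simp add: powr_add[symmetric])
      also have "\<dots> \<le> R powr a * r powr (- a)"
        using r r0 a0 False by (intro mult_left_mono powr_mono2') auto
      finally have "J r0 * 1 \<le> J r0 * (R powr a * r powr (- a))"
        using Jpos[OF r0] by (intro mult_left_mono) auto
      moreover have "(J r0 * R powr a) * r powr (- a) \<le> C * r powr (- a)"
        by (intro mult_right_mono) (auto simp: C_def)
      moreover have "J r \<le> J r0" using r r0 by (intro admissible_kernel_antimono[OF J]) auto
      ultimately show ?thesis by (simp add: a_def mult.assoc)
    qed
  qed
qed

lemma cutoff_integral_bounds:
  assumes J: "admissible_kernel d \<alpha> J" and "0 < \<rho>" "\<rho> \<le> r"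
  shows "0 \<le> (LINT s:{\<rho>..r}|lborel. \<bar>deriv J s\<bar>)" "(LINT s:{\<rho>..r}|lborel. \<bar>deriv J s\<bar>) \<le> J \<rho> - J r"
proof -
  show "0 \<le> (LINT s:{\<rho>..r}|lborel. \<bar>deriv J s\<bar>)"
    unfolding set_lebesgue_integral_def by (intro integral_nonneg_AE) auto
  \<comment> \<open>The fundamental theorem gives a gauge integral for any derivative; the Lebesgue
    integral of the definition is compared with it afterwards.\<close>
  have "((\<lambda>s. - deriv J s) has_integral (- J r) - (- J \<rho>)) {\<rho>..r}"
  proof (rule fundamental_theorem_of_calculus[OF assms(3)])
    fix s assume "s \<in> {\<rho>..r}"
    then have "((\<lambda>x. - J x) has_real_derivative - deriv J s) (at s within {\<rho>..r})"
      using assms(2) by (intro DERIV_minus has_field_derivative_at_within[OF admissible_kernel_deriv(1)[OF J]]) auto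
    then show "((\<lambda>x. - J x) has_vector_derivative - deriv J s) (at s within {\<rho>..r})"
      by (simp only: has_real_derivative_iff_has_vector_derivative)
  qed
  moreover have "- deriv J s = \<bar>deriv J s\<bar>" if "s \<in> {\<rho>..r}" for s
    using admissible_kernel_deriv(2)[OF J, of s] that assms by auto
  ultimately have I: "((\<lambda>s. \<bar>deriv J s\<bar>) has_integral J \<rho> - J r) {\<rho>..r}"
    using has_integral_cong[of "{\<rho>..r}" "\<lambda>s. - deriv J s" "\<lambda>s. \<bar>deriv J s\<bar>"] by simp
  show "(LINT s:{\<rho>..r}|lborel. \<bar>deriv J s\<bar>) \<le> J \<rho> - J r"
  proof (cases "set_integrable lborel {\<rho>..r} (\<lambda>s. \<bar>deriv J s\<bar>)")
    case True
    then show ?thesis using set_borel_integral_eq_integral(2)[OF True] I by (simp add: integral_unique)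
  next
    \<comment> \<open>A non-integrable integrand has Lebesgue integral 0 by default, and the bound
      becomes \<open>J r \<le> J \<rho>\<close>.\<close>
    case False
    then have "(LINT s:{\<rho>..r}|lborel. \<bar>deriv J s\<bar>) = 0"
      unfolding set_lebesgue_integral_def set_integrable_def by (rule not_integrable_integral_eq)
    then show ?thesis using admissible_kernel_antimono[OF J assms(2,3)] by simp
  qed
qed

section \<open>Norms, lattice distances and edge weights\<close>

lemma is_norm_equivalent:
  fixes N :: "real ^ 'd \<Rightarrow> real"
  assumes N: "is_norm N"
  obtains c C where "0 < c" "0 < C" "\<And>x. c * norm x \<le> N x" "\<And>x. N x \<le> C * norm x"
proof -
  have N0: "0 \<le> N x" "N x = 0 \<longleftrightarrow> x = 0" "N (a *\<^sub>R x) = \<bar>a\<bar> * N x" "N (x + y) \<le> N x + N y" for a x y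
    using N unfolding is_norm_def by blast+
  define C where "C = (\<Sum>i\<in>UNIV. N (axis i 1)) + 1"
  have C: "0 < C" using N0(1) by (auto simp: C_def intro!: add_nonneg_pos sum_nonneg)
  have Nsum: "N (\<Sum>i\<in>I. f i) \<le> (\<Sum>i\<in>I. N (f i))" if "finite I" for I and f :: "'d \<Rightarrow> real ^ 'd"
    using that
  proof (induction I rule: finite_induct)
    case (insert i I)
    then show ?case using N0(4)[of "f i" "\<Sum>i\<in>I. f i"] by simp
  qed (use N0(2)[of 0] in simp)
  have up: "N x \<le> C * norm x" for x
  proof -
    have "N x = N (\<Sum>i\<in>UNIV. x $ i *\<^sub>R axis i 1)"
      by (simp only: basis_expansion scalar_mult_eq_scaleR[symmetric])
    also have "\<dots> \<le> (\<Sum>i\<in>UNIV. N (x $ i *\<^sub>R axis i 1))" by (rule Nsum) simp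
    also have "\<dots> \<le> (\<Sum>i\<in>UNIV. norm x * N (axis i 1))"
      unfolding N0(3) by (intro sum_mono mult_right_mono component_le_norm_cart N0(1))
    also have "\<dots> \<le> C * norm x" by (simp add: C_def sum_distrib_left[symmetric] algebra_simps)
    finally show ?thesis .
  qed
  have lip: "N x - N y \<le> C * norm (x - y)" for x y
    using N0(4)[of "x - y" y] up[of "x - y"] by simp
  have "continuous_on UNIV N"
  proof (rule lipschitz_on_continuous_on)
    show "C-lipschitz_on UNIV N"
    proof (rule lipschitz_onI)
      fix x y
      have "N y - N x \<le> C * norm (x - y)" using lip[of y x] by (simp add: norm_minus_commute)
      then show "dist (N x) (N y) \<le> C * dist x y" using lip[of x y] by (simp add: dist_norm abs_le_iff)
    qed (use C in simp)
  qed
  then have cont: "continuous_on (sphere 0 1) N" by (rule continuous_on_subset) simp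
  have "sphere 0 1 \<noteq> ({} :: (real ^ 'd) set)" by simp
  then obtain z where z: "z \<in> sphere 0 1" "\<And>y. y \<in> sphere 0 1 \<Longrightarrow> N z \<le> N y"
    using continuous_attains_inf[OF compact_sphere _ cont] by blast
  have "z \<noteq> 0" using z(1) by auto
  then have z0: "0 < N z" using N0(1)[of z] N0(2)[of z] by linarith
  have "N z * norm x \<le> N x" for x
  proof (cases "x = 0")
    case False
    then have "N z \<le> N ((1 / norm x) *\<^sub>R x)" by (intro z(2)) simp
    also have "\<dots> = N x / norm x" unfolding N0(3) by simp
    finally show ?thesis using False by (simp add: field_simps)
  qed (use N0(2)[of 0] in simp)
  then show ?thesis using that[of "N z" C] z0 C up by blast
qed

definition lnorm :: "int ^ 'd \<Rightarrow> real" where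
  "lnorm x = norm (lattice_point x)"

lemma lattice_point_diff: "lattice_point x - lattice_point y = lattice_point (x - y)"
  by (simp add: lattice_point_def vec_eq_iff)

lemma lnorm_triangle: "lnorm (x + y) \<le> lnorm x + lnorm y"
proof -
  have "lattice_point (x + y) = lattice_point x + lattice_point y" by (simp add: lattice_point_def vec_eq_iff)
  then show ?thesis by (simp add: lnorm_def norm_triangle_ineq)
qed

lemma lnorm_nonneg: "0 \<le> lnorm x" by (simp add: lnorm_def)

lemma lnorm_minus: "lnorm (x - y) = lnorm (y - x)"
  unfolding lnorm_def lattice_point_diff[symmetric] by (rule norm_minus_commute)

lemma component_le_lnorm: "real_of_int \<bar>x $ i\<bar> \<le> lnorm x"
  using component_le_norm_cart[of "lattice_point x" i] by (simp add: lnorm_def lattice_point_def)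

lemma lnorm_ge_1: assumes "x \<noteq> 0" shows "1 \<le> lnorm x"
proof -
  obtain i where "x $ i \<noteq> 0" using assms by (auto simp: vec_eq_iff)
  then have "(1::real) \<le> real_of_int \<bar>x $ i\<bar>" by linarith
  then show ?thesis using component_le_lnorm[of x i] by linarith
qed

lemma lnorm_lbox_diff:
  assumes "x \<in> lbox a n" "y \<in> lbox a n"
  shows "lnorm (x - y :: int ^ 'd) \<le> real CARD('d) * real n"
proof -
  have "lnorm (x - y) \<le> (\<Sum>i\<in>UNIV. \<bar>lattice_point (x - y) $ i\<bar>)"
    unfolding lnorm_def by (rule norm_le_l1_cart)
  also have "\<dots> \<le> (\<Sum>i\<in>(UNIV :: 'd set). real n)"
  proof (rule sum_mono)
    fix i
    have "a $ i \<le> x $ i \<and> x $ i < a $ i + int n" "a $ i \<le> y $ i \<and> y $ i < a $ i + int n"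
      using assms by (auto simp: lbox_def)
    then have "\<bar>x $ i - y $ i\<bar> \<le> int n" by linarith
    then have "real_of_int \<bar>x $ i - y $ i\<bar> \<le> real_of_int (int n)" by (simp only: of_int_le_iff)
    then show "\<bar>lattice_point (x - y) $ i\<bar> \<le> real n" by (simp add: lattice_point_def)
  qed
  finally show ?thesis by simp
qed

text \<open>The constants \<open>c\<close>, \<open>q\<close>, \<open>C\<close> are uniform in \<open>\<beta>\<close> and in the cut-off \<open>r\<close>.\<close>

locale power_law_weights =
  fixes W :: "real \<Rightarrow> (int ^ 'd) set \<Rightarrow> real" and Wr :: "real \<Rightarrow> real \<Rightarrow> (int ^ 'd) set \<Rightarrow> real"
    and \<alpha> c q C :: real
  assumes const_pos: "0 < c" "0 < q" "0 < C" "0 < \<alpha>" "\<alpha> < 1"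
    and W_linear: "W \<beta> e = \<beta> * W 1 e"
    and W_translate: "W \<beta> ((+) v ` e) = W \<beta> e"
    and W_nonneg: "0 \<le> \<beta> \<Longrightarrow> 0 \<le> W \<beta> e"
    and W_lower: "0 \<le> \<beta> \<Longrightarrow> 1 \<le> n \<Longrightarrow> e \<in> edges (lbox a n) \<Longrightarrow> \<beta> * q * real n powr (- (CARD('d) + \<alpha>)) \<le> W \<beta> e"
    and Wr_translate: "Wr r \<beta> ((+) v ` e) = Wr r \<beta> e"
    and Wr_nonneg: "0 \<le> \<beta> \<Longrightarrow> 0 \<le> Wr r \<beta> e"
    and Wr_le: "0 \<le> \<beta> \<Longrightarrow> 1 \<le> r \<Longrightarrow> r \<le> real n \<Longrightarrow> e \<in> edges (lbox a n) \<Longrightarrow>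
        Wr r \<beta> e + \<beta> * q * real n powr (- (CARD('d) + \<alpha>)) \<le> W \<beta> e"
    and Wr_upper: "0 \<le> \<beta> \<Longrightarrow> x \<noteq> y \<Longrightarrow> Wr r \<beta> {x, y} \<le> \<beta> * C * lnorm (x - y) powr (- (CARD('d) + \<alpha>))"
    and Wr_range: "x \<noteq> y \<Longrightarrow> r < c * lnorm (x - y) \<Longrightarrow> Wr r \<beta> {x, y} = 0"

lemma pweight_pair:
  assumes "\<And>x y. k x y = k y x" "x \<noteq> y"
  shows "pweight k \<beta> {x, y} = \<beta> * k x y"
  using assms by (simp add: pweight_def edge_weight_pair)

lemma card_2_edgeE:
  assumes "card e = 2" obtains x y where "e = {x, y}" "x \<noteq> y"
  using assms by (auto simp: card_2_iff)

lemma pweight_translate: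
  fixes k :: "int ^ 'd \<Rightarrow> int ^ 'd \<Rightarrow> real"
  assumes sym: "\<And>x y. k x y = k y x" and inv: "\<And>v x y. k (v + x) (v + y) = k x y"
  shows "pweight k \<beta> ((+) v ` e) = pweight k \<beta> e"
proof (cases "card e = 2")
  case True
  then obtain x y where e: "e = {x, y}" "x \<noteq> y" by (rule card_2_edgeE)
  then show ?thesis by (simp add: pweight_pair[OF sym] inv)
next
  case False
  then show ?thesis by (simp add: pweight_def card_image)
qed

lemma lattice_kernel_translate: "lattice_kernel N J (v + x) (v + y) = lattice_kernel N J x y"
  by (simp add: lattice_kernel_def lattice_point_diff)

lemma cutoff_kernel_translate: "cutoff_kernel N J r (v + x) (v + y) = cutoff_kernel N J r x y"
  by (simp add: cutoff_kernel_def lattice_point_diff)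

lemma power_law_weights_kernels:
  fixes N :: "real ^ 'd \<Rightarrow> real"
  assumes \<alpha>: "0 < \<alpha>" "\<alpha> < 1" and N: "is_norm N" and J: "admissible_kernel CARD('d) \<alpha> J"
  obtains c q C where
    "power_law_weights (pweight (lattice_kernel N J)) (\<lambda>r. pweight (cutoff_kernel N J r)) \<alpha> c q C"
proof -
  let ?a = "real CARD('d) + \<alpha>"
  have a0: "0 < ?a" using \<alpha> by (intro add_nonneg_pos) auto
  obtain c1 c2 where c1: "0 < c1" "\<And>x. c1 * norm x \<le> N x" and c2: "0 < c2" "\<And>x. N x \<le> c2 * norm x"
    by (rule is_norm_equivalent[OF N]) (rule that)
  \<comment> \<open>The kernel bounds are needed at distances of distinct lattice points, which are
    at least \<open>c1\<close>, and at sides of boxes, which are at least 1.\<close>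
  define r0 where "r0 = min 1 c1"
  have r0: "0 < r0" "r0 \<le> 1" "r0 \<le> c1" using c1 by (auto simp: r0_def)
  obtain b B where b: "0 < b" "\<And>r. r0 \<le> r \<Longrightarrow> b * r powr (- ?a) \<le> J r"
    and B: "0 < B" "\<And>r. r0 \<le> r \<Longrightarrow> J r \<le> B * r powr (- ?a)"
    by (rule admissible_kernel_bounds[OF J a0 r0(1)]) (rule that)
  \<comment> \<open>Two points of a box of side \<open>n\<close> are at most \<open>c3 * n\<close>
    apart in the norm \<open>N\<close>. Taking \<open>c3 \<ge> 1\<close> gives
    \<open>q \<le> b\<close>, so that one constant \<open>q\<close> serves both lower
    bounds.\<close>
  define c3 where "c3 = max 1 (c2 * CARD('d))"
  define q where "q = b * c3 powr (- ?a)"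
  define C where "C = B * c1 powr (- ?a)"
  have c3: "1 \<le> c3" by (simp add: c3_def)
  have q0: "0 < q" using b c3 by (simp add: q_def)
  have q1: "q \<le> b"
  proof -
    have "c3 powr (- ?a) \<le> c3 powr 0" using c3 a0 by (intro powr_mono) auto
    then show ?thesis using b c3 by (simp add: q_def mult_le_cancel_left1)
  qed
  define \<rho> where "\<rho> x y = N (lattice_point x - lattice_point y)" for x y :: "int ^ 'd"
  have \<rho>1: "c1 * lnorm (x - y) \<le> \<rho> x y" "\<rho> x y \<le> c2 * lnorm (x - y)" for x y
    using c1(2) c2(2) by (auto simp: \<rho>_def lattice_point_diff lnorm_def)
  have \<rho>0: "r0 \<le> \<rho> x y" "0 < \<rho> x y" if "x \<noteq> y" for x y
  proof -
    have "c1 * 1 \<le> c1 * lnorm (x - y)" using c1 lnorm_ge_1[of "x - y"] that by (intro mult_left_mono) auto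
    then show "r0 \<le> \<rho> x y" using \<rho>1(1)[of x y] r0 by linarith
    then show "0 < \<rho> x y" using r0 by linarith
  qed
  have lk: "lattice_kernel N J x y = J (\<rho> x y)" if "x \<noteq> y" for x y
    using that by (simp add: lattice_kernel_def \<rho>_def)
  have Jpos: "0 < J r" if "0 < r" for r using J that by (auto simp: admissible_kernel_def)
  have ck0: "0 \<le> cutoff_kernel N J r x y" for r x y
    using \<rho>0[of x y] cutoff_integral_bounds(1)[OF J, of "\<rho> x y" r]
    by (auto simp: cutoff_kernel_def Let_def \<rho>_def[symmetric])
  have ck1: "cutoff_kernel N J r x y \<le> J (\<rho> x y) - J r" if "x \<noteq> y" "\<rho> x y \<le> r" for r x y
    using \<rho>0[OF that(1)] that cutoff_integral_bounds(2)[OF J, of "\<rho> x y" r]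
    by (simp add: cutoff_kernel_def Let_def \<rho>_def[symmetric])
  have ck2: "cutoff_kernel N J r x y = 0" if "r < \<rho> x y" for r x y
    using that by (simp add: cutoff_kernel_def Let_def \<rho>_def[symmetric])
  have ck3: "cutoff_kernel N J r x y \<le> J (\<rho> x y)" if "x \<noteq> y" for r x y
  proof (cases "\<rho> x y \<le> r")
    case True
    then have "0 < J r" using \<rho>0[OF that] by (intro Jpos) linarith
    then show ?thesis using ck1[OF that True] by simp
  next
    case False
    then show ?thesis using ck2[of r x y] Jpos[OF \<rho>0(2)[OF that]] by simp
  qed
  have low: "q * real n powr (- ?a) \<le> J (\<rho> x y)" if "x \<in> lbox v n" "y \<in> lbox v n" "x \<noteq> y" "1 \<le> n" for x y v n
  proof -
    have "\<rho> x y \<le> c2 * (real CARD('d) * real n)"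
      using \<rho>1(2)[of x y] lnorm_lbox_diff[OF that(1,2)] c2 by (meson mult_left_mono less_imp_le order_trans)
    also have "\<dots> \<le> c3 * real n" unfolding mult.assoc[symmetric] by (intro mult_right_mono) (auto simp: c3_def)
    finally have "(c3 * real n) powr (- ?a) \<le> \<rho> x y powr (- ?a)"
      using \<rho>0[OF that(3)] a0 by (intro powr_mono2') auto
    then have "b * (c3 powr (- ?a) * real n powr (- ?a)) \<le> b * \<rho> x y powr (- ?a)"
      using b by (simp add: powr_mult)
    then show ?thesis using b(2)[OF \<rho>0(1)[OF that(3)]] by (simp add: q_def mult.assoc)
  qed
  note symL = lattice_kernel_commute[OF N, of J] and symC = cutoff_kernel_commute[OF N, of J]
  have nonneg: "0 \<le> pweight k \<beta> e" if "\<And>x y. k x y = k y x" "\<And>x y. 0 \<le> k x y" "0 \<le> \<beta>"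
    for k :: "int ^ 'd \<Rightarrow> int ^ 'd \<Rightarrow> real" and \<beta> e
  proof (cases "card e = 2")
    case True
    then obtain x y where e: "e = {x, y}" "x \<noteq> y" by (rule card_2_edgeE)
    then show ?thesis using pweight_pair[of k, OF that(1) e(2)] that(2,3) by simp
  qed (simp add: pweight_def)
  have lk0: "0 \<le> lattice_kernel N J x y" for x y
    using Jpos[OF \<rho>0(2)] lk by (cases "x = y") (auto simp: lattice_kernel_def less_imp_le)
  have "power_law_weights (pweight (lattice_kernel N J)) (\<lambda>r. pweight (cutoff_kernel N J r)) \<alpha> c1 q C"
  proof
    show "0 < C" using B c1 by (simp add: C_def)
    show "pweight (lattice_kernel N J) \<beta> e = \<beta> * pweight (lattice_kernel N J) 1 e" for \<beta> and e :: "(int ^ 'd) set"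
      by (simp add: pweight_def)
    show "pweight (lattice_kernel N J) \<beta> ((+) v ` e) = pweight (lattice_kernel N J) \<beta> e" for \<beta> v and e :: "(int ^ 'd) set"
      by (rule pweight_translate) (rule symL, rule lattice_kernel_translate)
    show "pweight (cutoff_kernel N J r) \<beta> ((+) v ` e) = pweight (cutoff_kernel N J r) \<beta> e" for r \<beta> v and e :: "(int ^ 'd) set"
      by (rule pweight_translate) (rule symC, rule cutoff_kernel_translate)
    show "0 \<le> pweight (lattice_kernel N J) \<beta> e" if "0 \<le> \<beta>" for \<beta> and e :: "(int ^ 'd) set"
      by (rule nonneg) (rule symL, rule lk0, rule that)
    show "0 \<le> pweight (cutoff_kernel N J r) \<beta> e" if "0 \<le> \<beta>" for r \<beta> and e :: "(int ^ 'd) set"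
      by (rule nonneg) (rule symC, rule ck0, rule that)
  next
    fix \<beta> :: real and n and e and v :: "int ^ 'd"
    assume \<beta>: "0 \<le> \<beta>" and n: "1 \<le> n" and "e \<in> edges (lbox v n)"
    then obtain x y where e: "e = {x, y}" "x \<in> lbox v n" "y \<in> lbox v n" "x \<noteq> y" using edgesE by metis
    show "\<beta> * q * real n powr (- ?a) \<le> pweight (lattice_kernel N J) \<beta> e"
      using low[OF e(2,3,4) n] \<beta> by (simp add: e(1) pweight_pair[OF symL e(4)] lk[OF e(4)] mult.assoc mult_left_mono)
  next
    fix \<beta> r :: real and n and e and v :: "int ^ 'd"
    assume \<beta>: "0 \<le> \<beta>" and r: "1 \<le> r" "r \<le> real n" and "e \<in> edges (lbox v n)"
    then obtain x y where e: "e = {x, y}" "x \<in> lbox v n" "y \<in> lbox v n" "x \<noteq> y" using edgesE by metis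
    have n: "1 \<le> n" using r by linarith
    \<comment> \<open>A short edge loses at least \<open>J r \<ge> J n\<close> by the cut-off. A
      long one has cut-off weight 0, so its whole weight is the loss.\<close>
    have "cutoff_kernel N J r x y + q * real n powr (- ?a) \<le> J (\<rho> x y)"
    proof (cases "\<rho> x y \<le> r")
      case True
      have "q * real n powr (- ?a) \<le> b * real n powr (- ?a)" using q1 by (intro mult_right_mono) auto
      also have "\<dots> \<le> J (real n)" using r r0 by (intro b(2)) linarith
      also have "\<dots> \<le> J r" using r by (intro admissible_kernel_antimono[OF J]) auto
      finally show ?thesis using ck1[OF e(4) True] by simp
    next
      case False
      then show ?thesis using ck2[of r x y] low[OF e(2,3,4) n] by simp
    qed
    then have "\<beta> * (cutoff_kernel N J r x y + q * real n powr (- ?a)) \<le> \<beta> * J (\<rho> x y)"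
      using \<beta> by (rule mult_left_mono)
    then show "pweight (cutoff_kernel N J r) \<beta> e + \<beta> * q * real n powr (- ?a) \<le> pweight (lattice_kernel N J) \<beta> e"
      by (simp add: e(1) pweight_pair[OF symL e(4)] pweight_pair[OF symC e(4)] lk[OF e(4)] algebra_simps)
  next
    fix \<beta> r :: real and x y :: "int ^ 'd" assume \<beta>: "0 \<le> \<beta>" and xy: "x \<noteq> y"
    have l: "0 < lnorm (x - y)" using lnorm_ge_1[of "x - y"] xy by simp
    have "cutoff_kernel N J r x y \<le> B * \<rho> x y powr (- ?a)"
      using ck3[OF xy] B(2)[OF \<rho>0(1)[OF xy]] by (rule order_trans)
    also have "\<dots> \<le> B * (c1 * lnorm (x - y)) powr (- ?a)"
      using \<rho>1(1)[of x y] B(1) a0 c1 l by (intro mult_left_mono powr_mono2') auto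
    also have "\<dots> = C * lnorm (x - y) powr (- ?a)" using c1 l by (simp add: C_def powr_mult)
    finally show "pweight (cutoff_kernel N J r) \<beta> {x, y} \<le> \<beta> * C * lnorm (x - y) powr (- ?a)"
      using \<beta> by (simp add: pweight_pair[OF symC xy] mult_left_mono mult.assoc)
  next
    fix \<beta> r :: real and x y :: "int ^ 'd" assume xy: "x \<noteq> y" "r < c1 * lnorm (x - y)"
    then have "r < \<rho> x y" using \<rho>1(1)[of x y] by linarith
    then show "pweight (cutoff_kernel N J r) \<beta> {x, y} = 0" by (simp add: pweight_pair[OF symC xy(1)] ck2)
  qed (use \<alpha> c1 q0 in auto)
  then show ?thesis by (rule that)
qed

section \<open>Boundary sums\<close>

text \<open>The dyadic shell at radius \<open>2 ^ k\<close> has order \<open>2 ^ (k * d)\<close>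
  points and contributes order \<open>(2 ^ k) powr (1 - \<alpha>)\<close>. For
  \<open>\<alpha> < 1\<close> this geometric series grows and is dominated by its last term.\<close>

lemma sum_lnorm_powr:
  fixes \<alpha> :: real
  assumes "0 < \<alpha>" "\<alpha> < 1"
  obtains K where "0 < K"
    "\<And>(U :: (int ^ 'd) set) \<rho>. \<lbrakk>finite U; 1 \<le> \<rho>; \<forall>u\<in>U. u \<noteq> 0 \<and> lnorm u \<le> \<rho>\<rbrakk> \<Longrightarrow>
      (\<Sum>u\<in>U. lnorm u powr (1 - (CARD('d) + \<alpha>))) \<le> K * \<rho> powr (1 - \<alpha>)"
proof -
  let ?d = "CARD('d)"
  define s where "s = 2 powr (1 - \<alpha>)"
  \<comment> \<open>A cube of radius \<open>2 ^ Suc k\<close> has side at most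
    \<open>8 * 2 ^ k\<close>; dividing by \<open>s - 1\<close> makes
    \<open>K0 * s ^ k + 8 ^ d * s ^ k = K0 * s ^ Suc k\<close>.\<close>
  define K0 where "K0 = 8 ^ ?d / (s - 1)"
  have "(1::real) < 2 powr (1 - \<alpha>)" using assms by simp
  then have s: "1 < s" by (simp add: s_def)
  have K0: "0 < K0" using s by (simp add: K0_def)
  have step: "(\<Sum>u\<in>U. lnorm u powr (1 - (?d + \<alpha>))) \<le> K0 * s ^ k"
    if "finite U" "\<And>u. u \<in> U \<Longrightarrow> u \<noteq> 0 \<and> lnorm u < 2 ^ k" for U :: "(int ^ 'd) set" and k
    using that
  proof (induction k arbitrary: U)
    case 0
    have "U = {}"
    proof (rule ccontr)
      assume "U \<noteq> {}"
      then obtain u where "u \<in> U" by auto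
      then show False using 0(2)[of u] lnorm_ge_1[of u] by simp
    qed
    then show ?case using K0 by simp
  next
    case (Suc k)
    let ?U1 = "{u \<in> U. lnorm u < 2 ^ k}" and ?U2 = "{u \<in> U. 2 ^ k \<le> lnorm u}"
    have U: "U = ?U1 \<union> ?U2" by auto
    have "(\<Sum>u\<in>U. lnorm u powr (1 - (?d + \<alpha>)))
        = (\<Sum>u\<in>?U1. lnorm u powr (1 - (?d + \<alpha>))) + (\<Sum>u\<in>?U2. lnorm u powr (1 - (?d + \<alpha>)))"
      using Suc.prems(1) by (subst U, subst sum.union_disjoint) auto
    also have "(\<Sum>u\<in>?U1. lnorm u powr (1 - (?d + \<alpha>))) \<le> K0 * s ^ k"
      using Suc.prems by (intro Suc.IH) auto
    also have "(\<Sum>u\<in>?U2. lnorm u powr (1 - (?d + \<alpha>))) \<le> real (card ?U2) * (2 ^ k) powr (1 - (?d + \<alpha>))"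
    proof (rule sum_bounded_above)
      fix u assume u: "u \<in> ?U2"
      have "1 \<le> real ?d" by simp
      then have "1 - (?d + \<alpha>) \<le> 0" using assms by linarith
      then show "lnorm u powr (1 - (?d + \<alpha>)) \<le> (2 ^ k) powr (1 - (?d + \<alpha>))"
        using u by (intro powr_mono2') auto
    qed
    also have "\<dots> \<le> (8 * 2 ^ k) ^ ?d * (2 ^ k) powr (1 - (?d + \<alpha>))"
    proof (rule mult_right_mono)
      have "?U2 \<subseteq> cube (2 ^ Suc k)"
      proof
        fix u assume "u \<in> ?U2"
        then have "lnorm u < 2 ^ Suc k" using Suc.prems(2) by auto
        then have "real_of_int \<bar>u $ i\<bar> < 2 ^ Suc k" for i using component_le_lnorm[of u i] by linarith
        then have "\<bar>u $ i\<bar> < 2 ^ Suc k" for i by (metis of_int_less_iff of_int_numeral of_int_power)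
        then have "\<bar>u $ i\<bar> \<le> int (2 ^ Suc k)" for i by (simp add: less_imp_le)
        then show "u \<in> cube (2 ^ Suc k)" unfolding mem_cube_iff by blast
      qed
      then have "card ?U2 \<le> card (cube (2 ^ Suc k) :: (int ^ 'd) set)" by (intro card_mono) auto
      also have "\<dots> = (2 * 2 ^ Suc k + 1) ^ ?d" by (simp add: cube_def)
      also have "\<dots> \<le> (8 * 2 ^ k) ^ ?d" by (intro power_mono) auto
      finally have "real (card ?U2) \<le> real ((8 * 2 ^ k) ^ ?d)" by (rule of_nat_mono)
      then show "real (card ?U2) \<le> (8 * 2 ^ k) ^ ?d" by simp
    qed simp
    also have "(8 * 2 ^ k) ^ ?d * (2 ^ k) powr (1 - (?d + \<alpha>)) = 8 ^ ?d * s ^ k"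
    proof -
      have "((2::real) ^ k) ^ ?d = (2 ^ k) powr ?d" by (simp add: powr_realpow)
      then have "(8 * 2 ^ k) ^ ?d * (2 ^ k) powr (1 - (?d + \<alpha>)) = 8 ^ ?d * ((2 ^ k) powr ?d * (2 ^ k) powr (1 - (?d + \<alpha>)))"
        by (simp add: power_mult_distrib)
      also have "\<dots> = 8 ^ ?d * (2 ^ k) powr (1 - \<alpha>)" by (simp add: powr_add[symmetric])
      also have "(2 ^ k) powr (1 - \<alpha>) = s ^ k"
        by (simp add: s_def powr_power powr_powr powr_realpow[symmetric] mult.commute)
      finally show ?thesis .
    qed
    also have "K0 * s ^ k + 8 ^ ?d * s ^ k = K0 * s ^ Suc k"
    proof -
      have "K0 * (s - 1) = 8 ^ ?d" using s by (simp add: K0_def)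
      then have e: "K0 * s = K0 + 8 ^ ?d" by (simp add: algebra_simps)
      have "K0 * s ^ Suc k = (K0 * s) * s ^ k" by simp
      also have "\<dots> = K0 * s ^ k + 8 ^ ?d * s ^ k" unfolding e by (rule distrib_right)
      finally show ?thesis by (rule sym)
    qed
    finally show ?case by simp
  qed
  show ?thesis
  proof (rule that[of "K0 * s"])
    show "0 < K0 * s" using K0 s by simp
    fix U :: "(int ^ 'd) set" and \<rho> :: real
    assume U: "finite U" "1 \<le> \<rho>" "\<forall>u\<in>U. u \<noteq> 0 \<and> lnorm u \<le> \<rho>"
    define k where "k = nat \<lfloor>log 2 \<rho>\<rfloor>"
    have l0: "0 \<le> log 2 \<rho>" using U(2) by simp
    then have k: "real k \<le> log 2 \<rho>" "log 2 \<rho> < real k + 1" by (auto simp: k_def)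
    have lo: "2 ^ k \<le> \<rho>" using k(1) U(2) by (simp add: le_log_iff powr_realpow)
    have hi: "\<rho> < 2 ^ Suc k"
    proof -
      have "\<rho> < 2 powr (real k + 1)" using k(2) U(2) by (simp add: log_less_iff)
      also have "\<dots> = 2 ^ Suc k" by (simp add: powr_add powr_realpow)
      finally show ?thesis .
    qed
    have "(\<Sum>u\<in>U. lnorm u powr (1 - (?d + \<alpha>))) \<le> K0 * s ^ Suc k"
      using U hi by (intro step) (auto intro: le_less_trans)
    also have "\<dots> = K0 * s * (2 ^ k) powr (1 - \<alpha>)"
      by (simp add: s_def powr_power powr_powr powr_realpow[symmetric] mult.commute)
    also have "\<dots> \<le> K0 * s * \<rho> powr (1 - \<alpha>)"
      using lo assms K0 s by (intro mult_left_mono powr_mono2) auto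
    finally show "(\<Sum>u\<in>U. lnorm u powr (1 - (?d + \<alpha>))) \<le> K0 * s * \<rho> powr (1 - \<alpha>)" .
  qed
qed

text \<open>If the shift by \<open>u\<close> leaves the box, it does so in some coordinate
  \<open>i\<close>. Then \<open>y $ i\<close> has at most \<open>\<bar>u $ i\<bar>\<close> possible
  values, and the other coordinates have \<open>n ^ (d - 1)\<close>.\<close>

lemma card_lbox_exit:
  fixes u :: "int ^ 'd"
  shows "real (card {y \<in> lbox 0 n. y + u \<notin> lbox 0 n}) \<le> real CARD('d) * lnorm u * real n ^ (CARD('d) - 1)"
proof -
  let ?d = "CARD('d)"
  define A where "A i = {y :: int ^ 'd. \<forall>j. y $ j \<in> (if j = i then {t \<in> {0..<int n}. t + u $ i \<notin> {0..<int n}} else {0..<int n})}" for i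
  have card1: "card {t \<in> {0..<int n}. t + h \<notin> {0..<int n}} \<le> nat \<bar>h\<bar>" for h
  proof -
    have "{t \<in> {0..<int n}. t + h \<notin> {0..<int n}} \<subseteq> (if 0 \<le> h then {int n - h..<int n} else {0..<-h})" by auto
    then have "card {t \<in> {0..<int n}. t + h \<notin> {0..<int n}} \<le> card (if 0 \<le> h then {int n - h..<int n} else {0..<-h})"
      by (intro card_mono) auto
    then show ?thesis by (auto split: if_splits)
  qed
  have A: "finite (A i)" "card (A i) \<le> nat \<bar>u $ i\<bar> * n ^ (?d - 1)" for i
  proof -
    have fin: "finite {t \<in> {0..<int n}. P t}" for P by (rule finite_subset[of _ "{0..<int n}"]) auto
    let ?T = "\<lambda>j. if j = i then {t \<in> {0..<int n}. t + u $ i \<notin> {0..<int n}} else {0..<int n}"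
    show "finite (A i)" unfolding A_def by (rule vec_product_card) (use fin in \<open>simp only: finite_atLeastLessThan_int split: if_splits, simp\<close>)
    have "card (A i) = (\<Prod>j\<in>UNIV. card (?T j))" unfolding A_def by (rule vec_product_card) (use fin in \<open>simp only: finite_atLeastLessThan_int split: if_splits, simp\<close>)
    also have "\<dots> = card (?T i) * (\<Prod>j\<in>UNIV - {i}. card (?T j))" by (rule prod.remove) auto
    also have "(\<Prod>j\<in>UNIV - {i}. card (?T j)) = (\<Prod>j\<in>UNIV - {i}. n)" by (intro prod.cong) auto
    also have "\<dots> = n ^ (?d - 1)" by (simp add: card_Diff_singleton)
    also have "card (?T i) \<le> nat \<bar>u $ i\<bar>" using card1[of "u $ i"] by simp
    finally show "card (A i) \<le> nat \<bar>u $ i\<bar> * n ^ (?d - 1)" by simp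
  qed
  have "{y \<in> lbox 0 n. y + u \<notin> lbox 0 n} \<subseteq> (\<Union>i. A i)"
    by (auto simp: lbox_def A_def)
  then have "card {y \<in> lbox 0 n. y + u \<notin> lbox 0 n} \<le> card (\<Union>i. A i)" using A by (intro card_mono) auto
  also have "\<dots> \<le> (\<Sum>i\<in>UNIV. card (A i))" by (rule card_UN_le) simp
  also have "\<dots> \<le> (\<Sum>i\<in>UNIV. nat \<bar>u $ i\<bar> * n ^ (?d - 1))" by (intro sum_mono A)
  finally have "real (card {y \<in> lbox 0 n. y + u \<notin> lbox 0 n}) \<le> real (\<Sum>i\<in>UNIV. nat \<bar>u $ i\<bar> * n ^ (?d - 1))"
    by (rule of_nat_mono)
  also have "\<dots> = (\<Sum>i\<in>UNIV. real (nat \<bar>u $ i\<bar>) * real n ^ (?d - 1))" by simp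
  also have "\<dots> \<le> (\<Sum>i\<in>(UNIV :: 'd set). lnorm u * real n ^ (?d - 1))"
  proof (intro sum_mono mult_right_mono)
    fix i
    have "real (nat \<bar>u $ i\<bar>) = real_of_int \<bar>u $ i\<bar>" by simp
    then show "real (nat \<bar>u $ i\<bar>) \<le> lnorm u" using component_le_lnorm[of u i] by simp
  qed simp
  finally show ?thesis by (simp add: mult.assoc)
qed

section \<open>Blocks at the critical point\<close>

lemma conn_sym: "conn V w x y = conn V w y x"
  unfolding conn_def by (subst cluster_sym) (rule refl)

context power_law_weights
begin

lemma dim_gt: "\<alpha> < real CARD('d)"
proof -
  have "1 \<le> real CARD('d)" by simp
  then show ?thesis using const_pos by linarith
qed

lemma W_criterion:
  obtains L \<epsilon> where "0 < L" "0 < \<epsilon>" "\<And>\<beta> n m. \<lbrakk>0 \<le> \<beta>; 1 \<le> n; 1 \<le> m;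
      L * real n powr (CARD('d) + \<alpha>) \<le> \<beta> * q * (real m)\<^sup>2;
      bern (edges (lbox 0 n)) (W \<beta>) (\<lambda>\<omega>. of_bool (\<not> big (lbox 0 n) m \<omega>)) \<le> \<epsilon>\<rbrakk> \<Longrightarrow> large_clusters (W \<beta>)"
proof (rule finite_size_criterion[OF const_pos(4) dim_gt])
  fix L \<epsilon> :: real
  assume L: "0 < L" "0 < \<epsilon>" and crit:
    "\<And>(w :: (int ^ 'd) set \<Rightarrow> real) Q n m. \<lbrakk>\<And>v e. w ((+) v ` e) = w e;
       \<And>a n e. 1 \<le> n \<Longrightarrow> e \<in> edges (lbox a n) \<Longrightarrow> Q * real n powr (- (CARD('d) + \<alpha>)) \<le> w e;
       0 \<le> Q; 1 \<le> n; 1 \<le> m; L * real n powr (CARD('d) + \<alpha>) \<le> Q * (real m)\<^sup>2;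
       bern (edges (lbox 0 n)) w (\<lambda>\<omega>. of_bool (\<not> big (lbox 0 n) m \<omega>)) \<le> \<epsilon>\<rbrakk>
       \<Longrightarrow> large_clusters w"
  show thesis
  proof (rule that[OF L])
    fix \<beta> :: real and n m :: nat
    assume *: "0 \<le> \<beta>" "1 \<le> n" "1 \<le> m" "L * real n powr (CARD('d) + \<alpha>) \<le> \<beta> * q * (real m)\<^sup>2"
      "bern (edges (lbox 0 n)) (W \<beta>) (\<lambda>\<omega>. of_bool (\<not> big (lbox 0 n) m \<omega>)) \<le> \<epsilon>"
    show "large_clusters (W \<beta>)"
    proof (rule crit[OF _ _ _ *(2-5)])
      show "W \<beta> ((+) v ` e) = W \<beta> e" for v e by (rule W_translate)
      show "\<beta> * q * real n powr (- (CARD('d) + \<alpha>)) \<le> W \<beta> e" if "1 \<le> n" "e \<in> edges (lbox a n)" for a n e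
        using W_lower[OF *(1) that] .
      show "0 \<le> \<beta> * q" using *(1) const_pos by simp
    qed
  qed
qed

lemma large_clusters_at_large_parameter: "\<exists>\<beta>\<ge>0. large_clusters (W \<beta>)"
proof -
  obtain L \<epsilon> where L: "0 < L" "0 < \<epsilon>" and crit: "\<And>\<beta> n m. \<lbrakk>0 \<le> \<beta>; 1 \<le> n; 1 \<le> m;
      L * real n powr (CARD('d) + \<alpha>) \<le> \<beta> * q * (real m)\<^sup>2;
      bern (edges (lbox 0 n)) (W \<beta>) (\<lambda>\<omega>. of_bool (\<not> big (lbox 0 n) m \<omega>)) \<le> \<epsilon>\<rbrakk> \<Longrightarrow> large_clusters (W \<beta>)"
    by (rule W_criterion) (rule that)
  define \<beta> where "\<beta> = L / q"
  have \<beta>: "0 \<le> \<beta>" "\<beta> * q = L" using L const_pos by (auto simp: \<beta>_def)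
  have "big (lbox (0 :: int ^ 'd) 1) 1 \<omega>" for \<omega>
  proof -
    have 0: "(0 :: int ^ 'd) \<in> lbox 0 1" by (simp add: lbox_def)
    then have "0 \<in> clus \<omega> 0 \<inter> lbox 0 1" by simp
    then have "0 < card (clus \<omega> 0 \<inter> lbox (0 :: int ^ 'd) 1)"
      by (metis card_gt_0_iff empty_iff finite_Int finite_lbox)
    then show ?thesis unfolding big_def using 0 by (intro bexI[of _ 0]) auto
  qed
  then have z: "bern (edges (lbox 0 1)) (W \<beta>) (\<lambda>\<omega>. of_bool (\<not> big (lbox 0 1) 1 \<omega>)) \<le> \<epsilon>"
    using L by (simp add: bern_def)
  have "large_clusters (W \<beta>)"
    by (rule crit[OF _ _ _ _ z]) (use \<beta> in auto)
  then show ?thesis using \<beta> by auto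
qed

text \<open>The definition of the critical point says something only about parameters below it.
  There the criterion must fail, so having no big cluster has probability at least
  \<open>\<epsilon>\<close>; for a fixed finite box this is continuous in the parameter and passes
  to \<open>b\<close> from the left.\<close>

lemma big_unlikely:
  assumes b: "0 < b" "\<forall>\<beta>\<in>{0..<b}. \<not> large_clusters (W \<beta>)"
  obtains \<rho> \<Lambda> where "\<rho> < 1" "0 < \<Lambda>"
    "\<And>n m. 1 \<le> n \<Longrightarrow> 1 \<le> m \<Longrightarrow> \<Lambda> * real n powr (CARD('d) + \<alpha>) \<le> (real m)\<^sup>2 \<Longrightarrow>
      bern (edges (lbox 0 n)) (W b) (\<lambda>\<omega>. of_bool (big (lbox 0 n) m \<omega>)) \<le> \<rho>"
proof -
  obtain L \<epsilon> where L: "0 < L" "0 < \<epsilon>" and crit: "\<And>\<beta> n m. \<lbrakk>0 \<le> \<beta>; 1 \<le> n; 1 \<le> m;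
      L * real n powr (CARD('d) + \<alpha>) \<le> \<beta> * q * (real m)\<^sup>2;
      bern (edges (lbox 0 n)) (W \<beta>) (\<lambda>\<omega>. of_bool (\<not> big (lbox 0 n) m \<omega>)) \<le> \<epsilon>\<rbrakk> \<Longrightarrow> large_clusters (W \<beta>)"
    by (rule W_criterion) (rule that)
  \<comment> \<open>The factor 2 makes the size condition of the criterion hold for every parameter
    from \<open>b / 2\<close> on.\<close>
  define \<Lambda> where "\<Lambda> = 2 * L / (b * q)"
  show ?thesis
  proof (rule that[of "1 - \<epsilon>" \<Lambda>])
    show "1 - \<epsilon> < 1" "0 < \<Lambda>" using L b const_pos by (auto simp: \<Lambda>_def)
    fix n m :: nat assume n: "1 \<le> n" and m: "1 \<le> m" and \<Lambda>: "\<Lambda> * real n powr (CARD('d) + \<alpha>) \<le> (real m)\<^sup>2"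
    let ?E = "edges (lbox (0 :: int ^ 'd) n)"
    define g where "g \<beta> = bern ?E (W \<beta>) (\<lambda>\<omega>. of_bool (\<not> big (lbox 0 n) m \<omega>))" for \<beta>
    have L2: "2 * L * real n powr (CARD('d) + \<alpha>) \<le> b * q * (real m)\<^sup>2"
    proof -
      have "b * q * (\<Lambda> * real n powr (CARD('d) + \<alpha>)) \<le> b * q * (real m)\<^sup>2"
        using \<Lambda> b const_pos by (intro mult_left_mono) auto
      then show ?thesis using b const_pos by (simp add: \<Lambda>_def)
    qed
    have g: "\<epsilon> \<le> g \<beta>" if \<beta>: "b / 2 \<le> \<beta>" "\<beta> < b" for \<beta>
    proof (rule ccontr)
      assume "\<not> \<epsilon> \<le> g \<beta>"
      then have le: "bern ?E (W \<beta>) (\<lambda>\<omega>. of_bool (\<not> big (lbox 0 n) m \<omega>)) \<le> \<epsilon>" by (simp add: g_def)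
      have "L * real n powr (CARD('d) + \<alpha>) \<le> b / 2 * (q * (real m)\<^sup>2)" using L2 by (simp add: mult.assoc)
      also have "\<dots> \<le> \<beta> * (q * (real m)\<^sup>2)" using \<beta> const_pos by (intro mult_right_mono) auto
      finally have "L * real n powr (CARD('d) + \<alpha>) \<le> \<beta> * q * (real m)\<^sup>2" by (simp add: mult.assoc)
      then have "large_clusters (W \<beta>)"
        using \<beta> b by (intro crit[OF _ n m _ le]) auto
      then show False using b \<beta> by auto
    qed
    have "continuous_on UNIV g" unfolding g_def
    proof (rule continuous_bern)
      show "continuous_on UNIV (\<lambda>\<beta>. W \<beta> e)" for e
        by (subst W_linear) (intro continuous_intros)
    qed
    then have "isCont g b" by (simp add: continuous_on_eq_continuous_at)
    then have "(g \<longlongrightarrow> g b) (at_left b)" by (rule isCont_tendsto_compose[OF _ tendsto_ident_at])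
    moreover have "eventually (\<lambda>\<beta>. \<epsilon> \<le> g \<beta>) (at_left b)"
      using g b unfolding eventually_at_left_field by (intro exI[of _ "b / 2"]) auto
    ultimately have "\<epsilon> \<le> g b" by (intro tendsto_lowerbound[of g _ "at_left b"]) auto
    then show "bern ?E (W b) (\<lambda>\<omega>. of_bool (big (lbox 0 n) m \<omega>)) \<le> 1 - \<epsilon>"
      by (simp add: g_def of_bool_not_iff bern_diff finite_edges)
  qed
qed

lemma sus_bound:
  assumes b: "0 < b" "\<forall>\<beta>\<in>{0..<b}. \<not> large_clusters (W \<beta>)"
  obtains K where "0 < K" "\<And>n r. 1 \<le> r \<Longrightarrow> r \<le> real n \<Longrightarrow>
      bern (edges (lbox 0 n)) (Wr r b) (sus (lbox 0 n)) \<le> K * real n powr (CARD('d) + \<alpha>)"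
proof -
  obtain \<rho> \<Lambda> where \<rho>: "\<rho> < 1" "0 < \<Lambda>" and un:
    "\<And>n m. 1 \<le> n \<Longrightarrow> 1 \<le> m \<Longrightarrow> \<Lambda> * real n powr (CARD('d) + \<alpha>) \<le> (real m)\<^sup>2 \<Longrightarrow>
      bern (edges (lbox 0 n)) (W b) (\<lambda>\<omega>. of_bool (big (lbox 0 n) m \<omega>)) \<le> \<rho>"
    by (rule big_unlikely[OF b]) (rule that)
  \<comment> \<open>With \<open>m^2\<close> of order
    \<open>\<Lambda>' * n powr (d + \<alpha>)\<close>, the first entry keeps the probability of a
    cluster of size \<open>m\<close> at most \<open>\<rho>\<close>, and the second makes the
    sprinkling rate \<open>4 / m^2\<close> at most the weight removed by the cut-off.\<close>
  define \<Lambda>' where "\<Lambda>' = max \<Lambda> (4 / (b * q))"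
  have \<Lambda>': "0 < \<Lambda>'" "\<Lambda> \<le> \<Lambda>'" "4 / (b * q) \<le> \<Lambda>'" using \<rho> by (auto simp: \<Lambda>'_def)
  define S where "S = \<bar>2 + 36 * (\<Sum>k. 9 ^ k * \<rho> ^ (2 ^ k))\<bar> + 1"
  show ?thesis
  proof (rule that[of "S * (2 + 2 * \<Lambda>')"])
    show "0 < S * (2 + 2 * \<Lambda>')" using \<Lambda>' by (simp add: S_def add_pos_pos)
    fix n :: nat and r :: real assume r: "1 \<le> r" "r \<le> real n"
    then have n: "1 \<le> n" by linarith
    have na: "1 \<le> real n powr (CARD('d) + \<alpha>)" using n const_pos dim_gt by (intro ge_one_powr_ge_zero) auto
    define t where "t = sqrt (\<Lambda>' * real n powr (CARD('d) + \<alpha>))"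
    have t: "0 \<le> t" "t\<^sup>2 = \<Lambda>' * real n powr (CARD('d) + \<alpha>)" using \<Lambda>' by (auto simp: t_def)
    have t0: "0 < t" unfolding t_def real_sqrt_gt_0_iff by (rule mult_pos_pos) (use \<Lambda>' na in linarith)+
    define m where "m = nat \<lceil>t\<rceil>"
    have m: "t \<le> real m" "real m \<le> t + 1" using t(1) by (auto simp: m_def)
    have m1: "1 \<le> m" using m t0 by linarith
    have m2: "\<Lambda>' * real n powr (CARD('d) + \<alpha>) \<le> (real m)\<^sup>2" using m t power_mono[of t "real m" 2] by simp
    have m3: "(real m)\<^sup>2 \<le> (2 + 2 * \<Lambda>') * real n powr (CARD('d) + \<alpha>)"
    proof -
      have "(real m)\<^sup>2 \<le> (t + 1)\<^sup>2" using m by (intro power_mono) auto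
      also have "\<dots> \<le> 2 * t\<^sup>2 + 2"
        using zero_le_power2[of "t - 1"] by (simp add: power2_eq_square algebra_simps)
      also have "\<dots> \<le> (2 + 2 * \<Lambda>') * real n powr (CARD('d) + \<alpha>)" using t na by (simp add: algebra_simps)
      finally show ?thesis .
    qed
    have "\<Lambda> * real n powr (CARD('d) + \<alpha>) \<le> \<Lambda>' * real n powr (CARD('d) + \<alpha>)" using \<Lambda>' by (intro mult_right_mono) auto
    then have big: "bern (edges (lbox 0 n)) (W b) (\<lambda>\<omega>. of_bool (big (lbox 0 n) m \<omega>)) \<le> \<rho>"
      using m2 by (intro un n m1) linarith
    have four: "4 / (real m)\<^sup>2 \<le> b * q * real n powr (- (CARD('d) + \<alpha>))"
    proof -
      have "4 / (b * q) * real n powr (CARD('d) + \<alpha>) \<le> (real m)\<^sup>2"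
        using \<Lambda>'(3) m2 mult_right_mono[OF \<Lambda>'(3), of "real n powr (CARD('d) + \<alpha>)"] by simp
      then have four: "4 * real n powr (CARD('d) + \<alpha>) \<le> b * q * (real m)\<^sup>2" using b const_pos by (simp add: field_simps)
      define p where "p = real n powr (CARD('d) + \<alpha>)"
      have p: "0 < p" "4 * p \<le> b * q * (real m)\<^sup>2" using na four by (simp_all only: p_def)
      have m0: "0 < (real m)\<^sup>2" using m1 by simp
      have "4 / (real m)\<^sup>2 \<le> b * q * (1 / p)" using p m0 by (simp add: field_simps)
      then show ?thesis by (simp only: p_def powr_minus_divide)
    qed
    have "bern (edges (lbox 0 n)) (Wr r b) (sus (lbox 0 n)) \<le> (2 + 36 * (\<Sum>k. 9 ^ k * \<rho> ^ (2 ^ k))) * (real m)\<^sup>2"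
    proof (rule bern_sus_le[OF _ _ _ m1 big \<rho>(1)])
      fix e assume e: "e \<in> edges (lbox (0 :: int ^ 'd) n)"
      show "0 \<le> Wr r b e" using b by (intro Wr_nonneg) auto
      show "Wr r b e + 4 / (real m)\<^sup>2 \<le> W b e" using Wr_le[OF _ r e, of b] b four by simp
    qed simp
    also have "\<dots> \<le> S * (real m)\<^sup>2" by (intro mult_right_mono) (auto simp: S_def)
    also have "\<dots> \<le> S * ((2 + 2 * \<Lambda>') * real n powr (CARD('d) + \<alpha>))" using m3 by (intro mult_left_mono) (auto simp: S_def)
    finally show "bern (edges (lbox 0 n)) (Wr r b) (sus (lbox 0 n)) \<le> S * (2 + 2 * \<Lambda>') * real n powr (CARD('d) + \<alpha>)" by simp
  qed
qed

text \<open>Every vertex of the middle third of the box of side \<open>3n\<close> sees a translate of the box of side \<open>n\<close>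
  around it, so the averaged bound becomes a pointwise one.\<close>

lemma box_susceptibility_bound:
  assumes b: "0 < b" "\<forall>\<beta>\<in>{0..<b}. \<not> large_clusters (W \<beta>)"
  obtains K where "0 < K" "\<And>n r y. 1 \<le> r \<Longrightarrow> r \<le> real n \<Longrightarrow> y \<in> lbox 0 n \<Longrightarrow>
      (\<Sum>x\<in>lbox 0 n. conn (lbox 0 n) (Wr r b) y x) \<le> K * real n powr \<alpha>"
proof -
  obtain K where K: "0 < K" "\<And>n r. 1 \<le> r \<Longrightarrow> r \<le> real n \<Longrightarrow>
      bern (edges (lbox 0 n)) (Wr r b) (sus (lbox 0 n)) \<le> K * real n powr (CARD('d) + \<alpha>)"
    by (rule sus_bound[OF b]) (rule that)
  show ?thesis
  proof (rule that[of "K * 3 powr (CARD('d) + \<alpha>)"])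
    show "0 < K * 3 powr (CARD('d) + \<alpha>)" using K by simp
    fix n :: nat and r :: real and y :: "int ^ 'd"
    assume r: "1 \<le> r" "r \<le> real n" and y: "y \<in> lbox 0 n"
    let ?w = "Wr r b" and ?B = "lbox (0 :: int ^ 'd) n" and ?B' = "lbox (0 :: int ^ 'd) (3 * n)"
    let ?M = "lbox (\<chi> i. int n) n :: (int ^ 'd) set"
    let ?X = "\<Sum>x\<in>?B. conn ?B ?w y x"
    have w0: "0 \<le> ?w e" for e using b by (intro Wr_nonneg) auto
    note nn = conn_nonneg[OF w0]
    have n: "0 < real n" using r by linarith
    have "?X \<le> (\<Sum>z\<in>?B'. conn ?B' ?w v z)" if v: "v \<in> ?M" for v
    proof -
      define s where "s = v - y"
      have sub: "(+) s ` ?B \<subseteq> ?B'"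
      proof
        fix z assume "z \<in> (+) s ` ?B"
        then obtain x where x: "z = s + x" "x \<in> ?B" by auto
        show "z \<in> ?B'" unfolding lbox_def mem_Collect_eq
        proof
          fix i
          have "0 \<le> x $ i \<and> x $ i < int n" "0 \<le> y $ i \<and> y $ i < int n" "int n \<le> v $ i \<and> v $ i < int n + int n"
            using x y v by (auto simp: lbox_def)
          then show "0 $ i \<le> z $ i \<and> z $ i < 0 $ i + int (3 * n)" by (simp add: x s_def)
        qed
      qed
      have "?X = (\<Sum>x\<in>?B. conn ((+) s ` ?B) ?w v (s + x))"
        using conn_translate[of ?w ?B s y, OF Wr_translate finite_lbox] by (simp add: s_def)
      also have "\<dots> \<le> (\<Sum>x\<in>?B. conn ?B' ?w v (s + x))"
        using sub w0 by (intro sum_mono conn_mono) auto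
      also have "\<dots> = (\<Sum>z\<in>(+) s ` ?B. conn ?B' ?w v z)" by (simp add: sum.reindex)
      also have "\<dots> \<le> (\<Sum>z\<in>?B'. conn ?B' ?w v z)" using sub w0 by (intro sum_mono2 nn) auto
      finally show ?thesis .
    qed
    then have "(\<Sum>v\<in>?M. ?X) \<le> (\<Sum>v\<in>?M. \<Sum>z\<in>?B'. conn ?B' ?w v z)" by (rule sum_mono)
    also have "\<dots> \<le> (\<Sum>v\<in>?B'. \<Sum>z\<in>?B'. conn ?B' ?w v z)"
    proof (rule sum_mono2)
      show "?M \<subseteq> ?B'"
      proof
        fix x assume "x \<in> ?M"
        then have "int n \<le> x $ i \<and> x $ i < int n + int n" for i by (auto simp: lbox_def)
        then show "x \<in> ?B'" unfolding lbox_def by (simp add: add_increasing) (smt (verit) of_nat_0_le_iff)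
      qed
    qed (use w0 in \<open>auto intro!: sum_nonneg nn\<close>)
    also have "\<dots> = bern (edges ?B') ?w (sus ?B')" by (rule sum_conn_sus) simp
    also have "\<dots> \<le> K * real (3 * n) powr (CARD('d) + \<alpha>)" using r by (intro K) auto
    \<comment> \<open>The middle third has \<open>n ^ d\<close> vertices; dividing by this number
      turns the exponent \<open>d + \<alpha>\<close> into \<open>\<alpha>\<close>.\<close>
    also have "\<dots> = K * 3 powr (CARD('d) + \<alpha>) * (real n powr CARD('d) * real n powr \<alpha>)"
      using n by (simp add: powr_mult powr_add)
    finally have "real n ^ CARD('d) * ?X \<le> real n ^ CARD('d) * (K * 3 powr (CARD('d) + \<alpha>) * real n powr \<alpha>)"
      using n by (simp add: powr_realpow mult_ac)
    then show "?X \<le> K * 3 powr (CARD('d) + \<alpha>) * real n powr \<alpha>" using n by (subst (asm) mult_le_cancel_left_pos) auto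
  qed
qed

end

section \<open>Flux through the boundary of a box and choice of the blocks\<close>

context power_law_weights
begin

text \<open>Edges are sorted by their displacement \<open>u\<close>. At most
  \<open>d * lnorm u * n ^ (d - 1)\<close> vertices leave the box under the shift, so the weight of
  \<open>u\<close> is multiplied by its length; the sum up to length of order \<open>r\<close> is
  \<open>sum_lnorm_powr\<close>.\<close>

lemma boundary_weight_bound:
  obtains K where "0 < K" "\<And>b n r Z. \<lbrakk>0 \<le> b; 1 \<le> r; finite Z\<rbrakk> \<Longrightarrow>
     (\<Sum>y\<in>lbox 0 n. \<Sum>z\<in>Z - lbox 0 n. Wr r b {y, z}) \<le> b * K * r powr (1 - \<alpha>) * real n ^ (CARD('d) - 1)"
proof -
  let ?d = "CARD('d)"
  obtain K where K: "0 < K"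
    "\<And>(U :: (int ^ 'd) set) \<rho>. \<lbrakk>finite U; 1 \<le> \<rho>; \<forall>u\<in>U. u \<noteq> 0 \<and> lnorm u \<le> \<rho>\<rbrakk> \<Longrightarrow>
      (\<Sum>u\<in>U. lnorm u powr (1 - (?d + \<alpha>))) \<le> K * \<rho> powr (1 - \<alpha>)"
    by (rule sum_lnorm_powr[OF const_pos(4,5)]) (rule that)
  \<comment> \<open>Edges of positive weight satisfy \<open>c * lnorm u \<le> r\<close>; the maximum
    with 1 keeps the radius \<open>r * \<kappa>\<close> at least 1.\<close>
  define \<kappa> where "\<kappa> = max 1 (1 / c)"
  define K' where "K' = C * ?d * (K * \<kappa> powr (1 - \<alpha>))"
  have \<kappa>: "1 \<le> \<kappa>" "1 / c \<le> \<kappa>" by (auto simp: \<kappa>_def)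
  show ?thesis
  proof (rule that[of K'])
    show "0 < K'" using K const_pos \<kappa> by (simp add: K'_def)
    fix b r :: real and n :: nat and Z :: "(int ^ 'd) set"
    assume b: "0 \<le> b" and r: "1 \<le> r" and Z: "finite Z"
    let ?B = "lbox 0 n :: (int ^ 'd) set"
    define U where "U = {u. u \<noteq> 0 \<and> c * lnorm u \<le> r \<and> u \<in> (\<lambda>(y, z). z - y) ` (?B \<times> Z)}"
    have finU: "finite U"
      unfolding U_def by (rule finite_subset[of _ "(\<lambda>(y, z). z - y) ` (?B \<times> Z)"]) (use Z in auto)
    have Ur: "u \<noteq> 0 \<and> lnorm u \<le> r * \<kappa>" if "u \<in> U" for u
    proof -
      have "lnorm u \<le> r * (1 / c)" using that const_pos by (simp add: U_def field_simps)
      also have "\<dots> \<le> r * \<kappa>" using \<kappa> r by (intro mult_left_mono) auto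
      finally show ?thesis using that by (simp add: U_def)
    qed
    define h where "h u = b * C * lnorm u powr (- (?d + \<alpha>))" for u :: "int ^ 'd"
    have h0: "0 \<le> h u" for u using b const_pos by (simp add: h_def)
    have "(\<Sum>z\<in>Z - ?B. Wr r b {y, z}) \<le> (\<Sum>u\<in>U. h u * of_bool (y + u \<notin> ?B))" if y: "y \<in> ?B" for y
    proof -
      have "(\<Sum>z\<in>Z - ?B. Wr r b {y, z}) = (\<Sum>z\<in>{z \<in> Z - ?B. c * lnorm (y - z) \<le> r}. Wr r b {y, z})"
      proof (intro sum.mono_neutral_right ballI)
        fix z assume "z \<in> Z - ?B - {z \<in> Z - ?B. c * lnorm (y - z) \<le> r}"
        then show "Wr r b {y, z} = 0" using y by (intro Wr_range) auto
      qed (use Z in auto)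
      also have "\<dots> \<le> (\<Sum>z\<in>{z \<in> Z - ?B. c * lnorm (y - z) \<le> r}. h (z - y))"
      proof (rule sum_mono)
        fix z assume "z \<in> {z \<in> Z - ?B. c * lnorm (y - z) \<le> r}"
        then have "y \<noteq> z" using y by auto
        from Wr_upper[OF b this, of r] show "Wr r b {y, z} \<le> h (z - y)" by (simp add: h_def lnorm_minus[of y z])
      qed
      also have "\<dots> = (\<Sum>u\<in>(\<lambda>z. z - y) ` {z \<in> Z - ?B. c * lnorm (y - z) \<le> r}. h u)"
        by (subst sum.reindex) (auto simp: inj_on_def)
      also have "\<dots> = (\<Sum>u\<in>(\<lambda>z. z - y) ` {z \<in> Z - ?B. c * lnorm (y - z) \<le> r}. h u * of_bool (y + u \<notin> ?B))"
        by (intro sum.cong) auto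
      also have "\<dots> \<le> (\<Sum>u\<in>U. h u * of_bool (y + u \<notin> ?B))"
      proof (rule sum_mono2[OF finU])
        show "(\<lambda>z. z - y) ` {z \<in> Z - ?B. c * lnorm (y - z) \<le> r} \<subseteq> U"
          using y by (auto simp: U_def lnorm_minus image_iff)
      qed (use h0 in auto)
      finally show ?thesis .
    qed
    then have "(\<Sum>y\<in>?B. \<Sum>z\<in>Z - ?B. Wr r b {y, z}) \<le> (\<Sum>y\<in>?B. \<Sum>u\<in>U. h u * of_bool (y + u \<notin> ?B))"
      by (rule sum_mono)
    also have "\<dots> = (\<Sum>u\<in>U. h u * (\<Sum>y\<in>?B. of_bool (y + u \<notin> ?B)))"
      by (subst sum.swap) (simp only: sum_distrib_left)
    also have "\<dots> \<le> (\<Sum>u\<in>U. b * C * ?d * real n ^ (?d - 1) * lnorm u powr (1 - (?d + \<alpha>)))"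
    proof (rule sum_mono)
      fix u assume "u \<in> U"
      then have l: "0 < lnorm u" using Ur[of u] lnorm_ge_1[of u] by auto
      have "(\<Sum>y\<in>?B. of_bool (y + u \<notin> ?B)) = real (card {y \<in> ?B. y + u \<notin> ?B})"
        by (simp add: Int_def)
      also have "\<dots> \<le> real ?d * lnorm u * real n ^ (?d - 1)" by (rule card_lbox_exit)
      finally have "h u * (\<Sum>y\<in>?B. of_bool (y + u \<notin> ?B)) \<le> h u * (real ?d * lnorm u * real n ^ (?d - 1))"
        using h0 by (intro mult_left_mono)
      also have "\<dots> = b * C * ?d * real n ^ (?d - 1) * lnorm u powr (1 - (?d + \<alpha>))"
      proof -
        have "1 - (?d + \<alpha>) = - (?d + \<alpha>) + 1" by simp
        then have "lnorm u powr (1 - (?d + \<alpha>)) = lnorm u powr (- (?d + \<alpha>)) * lnorm u"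
          using l by (simp only: powr_add powr_one)
        then show ?thesis by (simp only: h_def mult_ac)
      qed
      finally show "h u * (\<Sum>y\<in>?B. of_bool (y + u \<notin> ?B)) \<le> b * C * ?d * real n ^ (?d - 1) * lnorm u powr (1 - (?d + \<alpha>))" .
    qed
    also have "\<dots> = b * C * ?d * real n ^ (?d - 1) * (\<Sum>u\<in>U. lnorm u powr (1 - (?d + \<alpha>)))"
      by (simp add: sum_distrib_left)
    also have "\<dots> \<le> b * C * ?d * real n ^ (?d - 1) * (K * (r * \<kappa>) powr (1 - \<alpha>))"
    proof (rule mult_left_mono)
      have "1 * 1 \<le> r * \<kappa>" using r \<kappa> by (intro mult_mono) auto
      then show "(\<Sum>u\<in>U. lnorm u powr (1 - (?d + \<alpha>))) \<le> K * (r * \<kappa>) powr (1 - \<alpha>)"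
        using Ur by (intro K(2) finU) auto
    qed (use b const_pos in auto)
    also have "\<dots> = b * K' * r powr (1 - \<alpha>) * real n ^ (?d - 1)"
      using r \<kappa> by (simp add: K'_def powr_mult mult_ac)
    finally show "(\<Sum>y\<in>?B. \<Sum>z\<in>Z - ?B. Wr r b {y, z}) \<le> b * K' * r powr (1 - \<alpha>) * real n ^ (?d - 1)" .
  qed
qed

text \<open>By symmetry of \<open>conn\<close> the sum over \<open>x\<close> can be taken first. It
  gives order \<open>n powr \<alpha>\<close> for each \<open>y\<close>, and the boundary weight is
  of order \<open>r powr (1 - \<alpha>) * n ^ (d - 1)\<close>; the product is \<open>n ^ d\<close>
  times \<open>(r / n) powr (1 - \<alpha>)\<close> up to a constant.\<close>

lemma averaged_boundary_flux:
  assumes b: "0 < b" "\<forall>\<beta>\<in>{0..<b}. \<not> large_clusters (W \<beta>)"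
  obtains A :: nat where "1 \<le> A" "\<And>r n Z. \<lbrakk>1 \<le> r; real A * r \<le> real n; finite Z\<rbrakk> \<Longrightarrow>
     (\<Sum>x\<in>lbox 0 n. \<Sum>y\<in>lbox 0 n. \<Sum>z\<in>Z - lbox 0 n. conn (lbox 0 n) (Wr r b) x y * Wr r b {y, z})
       \<le> 1 / 2 * real n ^ CARD('d)"
proof -
  let ?d = "CARD('d)"
  obtain K1 where K1: "0 < K1" "\<And>n r y. 1 \<le> r \<Longrightarrow> r \<le> real n \<Longrightarrow> y \<in> lbox 0 n \<Longrightarrow>
      (\<Sum>x\<in>lbox 0 n. conn (lbox 0 n) (Wr r b) y x) \<le> K1 * real n powr \<alpha>"
    by (rule box_susceptibility_bound[OF b]) (rule that)
  obtain K2 where K2: "0 < K2" "\<And>b n r Z. \<lbrakk>0 \<le> b; 1 \<le> r; finite Z\<rbrakk> \<Longrightarrow>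
     (\<Sum>y\<in>lbox 0 n. \<Sum>z\<in>Z - lbox 0 n. Wr r b {y, z}) \<le> b * K2 * r powr (1 - \<alpha>) * real n ^ (?d - 1)"
    by (rule boundary_weight_bound) (rule that)
  define K where "K = K1 * (b * K2)"
  have K: "0 < K" using K1 K2 b by (simp add: K_def)
  \<comment> \<open>Large enough for \<open>K * A powr (\<alpha> - 1) \<le> 1 / 2\<close>.\<close>
  define A where "A = nat \<lceil>(2 * K) powr (1 / (1 - \<alpha>))\<rceil> + 1"
  have "(2 * K) powr (1 / (1 - \<alpha>)) \<le> real A" unfolding A_def by linarith
  then have "((2 * K) powr (1 / (1 - \<alpha>))) powr (1 - \<alpha>) \<le> real A powr (1 - \<alpha>)"
    using const_pos by (intro powr_mono2) auto
  then have A: "2 * K \<le> real A powr (1 - \<alpha>)" using K const_pos by (simp add: powr_powr)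
  show ?thesis
  proof (rule that[of A])
    show A1: "1 \<le> A" by (simp add: A_def)
    fix r :: real and n :: nat and Z :: "(int ^ 'd) set"
    assume r: "1 \<le> r" and n: "real A * r \<le> real n" and Z: "finite Z"
    let ?B = "lbox 0 n :: (int ^ 'd) set" and ?w = "Wr r b"
    have "1 * r \<le> real A * r" using A1 r by (intro mult_right_mono) auto
    then have rn: "r \<le> real n" using n by linarith
    then have n0: "0 < real n" using r by linarith
    have w0: "0 \<le> ?w e" for e using b by (intro Wr_nonneg) auto
    have "(\<Sum>x\<in>?B. \<Sum>y\<in>?B. \<Sum>z\<in>Z - ?B. conn ?B ?w x y * ?w {y, z})
      = (\<Sum>y\<in>?B. (\<Sum>x\<in>?B. conn ?B ?w y x) * (\<Sum>z\<in>Z - ?B. ?w {y, z}))"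
      unfolding sum_product
      by (subst sum.swap) (intro sum.cong refl arg_cong2[where f = "(*)"] conn_sym)
    also have "\<dots> \<le> (\<Sum>y\<in>?B. K1 * real n powr \<alpha> * (\<Sum>z\<in>Z - ?B. ?w {y, z}))"
      using r rn w0 by (intro sum_mono mult_right_mono K1 sum_nonneg) auto
    also have "\<dots> = K1 * real n powr \<alpha> * (\<Sum>y\<in>?B. \<Sum>z\<in>Z - ?B. ?w {y, z})"
      by (simp add: sum_distrib_left)
    also have "\<dots> \<le> K1 * real n powr \<alpha> * (b * K2 * r powr (1 - \<alpha>) * real n ^ (?d - 1))"
      using b r Z K1 by (intro mult_left_mono K2) auto
    also have "\<dots> = K * r powr (1 - \<alpha>) * (real n powr \<alpha> * real n ^ (?d - 1))"
      by (simp add: K_def mult_ac)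
    also have "\<dots> \<le> 1 / 2 * (real n powr (1 - \<alpha>)) * (real n powr \<alpha> * real n ^ (?d - 1))"
    proof (rule mult_right_mono)
      have "K * r powr (1 - \<alpha>) \<le> 1 / 2 * real A powr (1 - \<alpha>) * r powr (1 - \<alpha>)"
        using A by (intro mult_right_mono) auto
      also have "\<dots> = 1 / 2 * (real A * r) powr (1 - \<alpha>)" using r by (simp add: powr_mult)
      also have "\<dots> \<le> 1 / 2 * real n powr (1 - \<alpha>)"
        using n r const_pos by (intro mult_left_mono powr_mono2) auto
      finally show "K * r powr (1 - \<alpha>) \<le> 1 / 2 * real n powr (1 - \<alpha>)" .
    qed simp
    also have "\<dots> = 1 / 2 * real n ^ ?d"
    proof -
      have "real n powr (1 - \<alpha>) * real n powr \<alpha> = real n" using n0 by (simp add: powr_add[symmetric])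
      moreover have "real n * real n ^ (?d - 1) = real n ^ ?d"
        by (rule power_minus_mult[of ?d "real n", unfolded mult.commute[of _ "real n"]]) simp
      ultimately show ?thesis by (simp add: mult.assoc[symmetric])
    qed
    finally show "(\<Sum>x\<in>?B. \<Sum>y\<in>?B. \<Sum>z\<in>Z - ?B. conn ?B ?w x y * ?w {y, z}) \<le> 1 / 2 * real n ^ ?d" .
  qed
qed

text \<open>The average over positions yields one vertex \<open>x\<close> of the box with flux at
  most \<open>1 / 2\<close>; by translation invariance the box moved so that \<open>x\<close> lands
  on \<open>u\<close> is a block for \<open>u\<close>. The critical estimates divide by
  \<open>b\<close>; for \<open>b = 0\<close> all edge weights vanish and singletons are
  blocks.\<close>

lemma blocks_exist:
  assumes b: "0 \<le> b" "\<forall>\<beta>\<in>{0..<b}. \<not> large_clusters (W \<beta>)"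
  obtains K where "0 < K" "\<And>r. 1 \<le> r \<Longrightarrow>
     \<exists>S D M. sub_critical_blocks (Wr r b) S (\<lambda>x y. lnorm (y - x)) D M \<and> D \<le> K * r"
proof (cases "b = 0")
  case True
  have z: "Wr r b e = 0" if "1 \<le> r" "card e = 2" for r e
  proof -
    from that obtain x y where e: "e = {x, y}" "x \<noteq> y" by (auto simp: card_2_iff)
    show ?thesis using Wr_upper[of b x y r] Wr_nonneg[of b r e] b True e by simp
  qed
  show ?thesis
  proof (rule that[of 1])
    fix r :: real assume r: "1 \<le> r"
    have "sub_critical_blocks (Wr r b) (\<lambda>u. {u}) (\<lambda>x y. lnorm (y - x)) 1 1"
    proof
      show "lnorm (z - x) \<le> lnorm (y - x) + lnorm (z - y)" for x y z :: "int ^ 'd"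
        using lnorm_triangle[of "y - x" "z - y"] by simp
      show "a \<in> {u} \<Longrightarrow> lnorm (a - u) < 1" for a u :: "int ^ 'd"
        by (simp add: lnorm_def lattice_point_def norm_eq_zero[THEN iffD2] vec_eq_iff)
      show "Wr r b {a, v} = 0" if "a \<in> {u}" "v \<notin> {u}" for a u v
        using that z[OF r, of "{a, v}"] by auto
      show "(\<Sum>a\<in>{u}. \<Sum>v\<in>Z - {u}. conn {u} (Wr r b) u a * (1 - exp (- Wr r b {a, v}))) \<le> 1 / 2" for u and Z :: "(int ^ 'd) set"
      proof -
        have "(\<Sum>v\<in>Z - {u}. conn {u} (Wr r b) u u * (1 - exp (- Wr r b {u, v}))) = 0"
        proof (intro sum.neutral ballI)
          fix v assume "v \<in> Z - {u}"
          then have "Wr r b {u, v} = 0" by (intro z[OF r]) auto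
          then show "conn {u} (Wr r b) u u * (1 - exp (- Wr r b {u, v})) = 0" by simp
        qed
        then show ?thesis by simp
      qed
    qed (use Wr_nonneg b in auto)
    then show "\<exists>S D M. sub_critical_blocks (Wr r b) S (\<lambda>x y. lnorm (y - x)) D M \<and> D \<le> 1 * r"
      using r by (intro exI[of _ "\<lambda>u. {u}"] exI[of _ 1] exI[of _ 1]) auto
  qed simp
next
  case False
  then have b0: "0 < b" using b by simp
  let ?d = "CARD('d)"
  obtain A :: nat where A: "1 \<le> A" and flux: "\<And>r n Z. \<lbrakk>1 \<le> r; real A * r \<le> real n; finite Z\<rbrakk> \<Longrightarrow>
     (\<Sum>x\<in>lbox 0 n. \<Sum>y\<in>lbox 0 n. \<Sum>z\<in>Z - lbox 0 n. conn (lbox 0 n) (Wr r b) x y * Wr r b {y, z})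
       \<le> 1 / 2 * real n ^ ?d"
    by (rule averaged_boundary_flux[OF b0 b(2)]) (rule that)
  define K where "K = 2 * (?d * (2 * real A) + 1 / c) + 1"
  show ?thesis
  proof (rule that[of K])
    show "0 < K" using const_pos by (simp add: K_def add_nonneg_pos)
    fix r :: real assume r: "1 \<le> r"
    define n where "n = nat \<lceil>real A * r\<rceil>"
    have Ar: "1 \<le> real A * r" using A r mult_mono[of 1 "real A" 1 r] by simp
    then have n: "real A * r \<le> real n" "real n \<le> 2 * (real A * r)" by (auto simp: n_def) linarith+
    then have n0: "0 < n" using Ar by linarith
    let ?B = "lbox 0 n :: (int ^ 'd) set" and ?w = "Wr r b"
    have w0: "0 \<le> ?w e" for e using b by (intro Wr_nonneg) auto
    \<comment> \<open>The first summand bounds distances within a block, the second the length of an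
      edge of positive weight, and the 1 makes the radius inequality strict.\<close>
    define D where "D = ?d * real n + r / c + 1"
    have D: "D \<le> K * r"
    proof -
      define X where "X = real ?d * (2 * (real A * r))"
      have X: "?d * real n \<le> X" unfolding X_def using n by (intro mult_left_mono) auto
      have X0: "0 \<le> X" "0 \<le> r / c" using r const_pos by (auto simp: X_def)
      have arith: "x + y + 1 \<le> 2 * (X + y) + r" if "x \<le> X" "0 \<le> y" for x y
        using that X0(1) r by (simp add: algebra_simps)
      have "D \<le> 2 * (X + r / c) + r" unfolding D_def by (rule arith[OF X X0(2)])
      also have "\<dots> = K * r" by (simp add: K_def X_def algebra_simps)
      finally show ?thesis .
    qed
    \<comment> \<open>One vertex \<open>x\<close> has to serve all finite sets \<open>Z\<close>.
      Edges of positive weight from the box end in the finite set \<open>Z0\<close>, so it is enough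
      to choose \<open>x\<close> for \<open>Z0\<close>.\<close>
    define Z0 where "Z0 = {z :: int ^ 'd. \<exists>y\<in>?B. c * lnorm (y - z) \<le> r}"
    have "Z0 \<subseteq> (\<Union>y\<in>?B. (\<lambda>u. y - u) ` cube (nat \<lceil>r / c\<rceil>))"
    proof
      fix z assume "z \<in> Z0"
      then obtain y where y: "y \<in> ?B" "c * lnorm (y - z) \<le> r" by (auto simp: Z0_def)
      have "y - z \<in> cube (nat \<lceil>r / c\<rceil>)"
        unfolding mem_cube_iff
      proof
        fix i
        have "real_of_int \<bar>(y - z) $ i\<bar> \<le> r / c"
          using component_le_lnorm[of "y - z" i] y(2) const_pos by (simp add: field_simps) (meson mult_left_mono less_imp_le order_trans)
        then show "\<bar>(y - z) $ i\<bar> \<le> int (nat \<lceil>r / c\<rceil>)" by linarith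
      qed
      then show "z \<in> (\<Union>y\<in>?B. (\<lambda>u. y - u) ` cube (nat \<lceil>r / c\<rceil>))"
        using y(1) by (intro UN_I[of y] image_eqI[of _ _ "y - z"]) auto
    qed
    then have finZ0: "finite Z0" by (rule finite_subset) auto
    define flx where "flx x Z = (\<Sum>y\<in>?B. \<Sum>z\<in>Z - ?B. conn ?B ?w x y * ?w {y, z})" for x and Z :: "(int ^ 'd) set"
    have "\<exists>x\<in>?B. flx x Z0 \<le> 1 / 2"
    proof (rule ccontr)
      assume "\<not> (\<exists>x\<in>?B. flx x Z0 \<le> 1 / 2)"
      then have "1 / 2 < flx x Z0" if "x \<in> ?B" for x using that by auto
      moreover have "?B \<noteq> {}" using card_lbox[of "0 :: int ^ 'd" n] n0 by force
      ultimately have "(\<Sum>x\<in>?B. 1 / 2) < (\<Sum>x\<in>?B. flx x Z0)" by (intro sum_strict_mono) auto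
      then show False using flux[OF r n(1) finZ0] by (simp add: flx_def)
    qed
    then obtain x where x: "x \<in> ?B" "flx x Z0 \<le> 1 / 2" by auto
    have flx: "flx x Z \<le> 1 / 2" if Z: "finite Z" for Z
    proof -
      have "flx x Z \<le> flx x Z0"
        unfolding flx_def
      proof (rule sum_mono)
        fix y assume y: "y \<in> ?B"
        have "(\<Sum>z\<in>Z - ?B. conn ?B ?w x y * ?w {y, z}) = (\<Sum>z\<in>(Z - ?B) \<inter> Z0. conn ?B ?w x y * ?w {y, z})"
        proof (intro sum.mono_neutral_right ballI)
          fix z assume z: "z \<in> Z - ?B - (Z - ?B) \<inter> Z0"
          then have "\<not> c * lnorm (y - z) \<le> r" using y by (auto simp: Z0_def)
          then have "?w {y, z} = 0" using z y by (intro Wr_range) auto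
          then show "conn ?B ?w x y * ?w {y, z} = 0" by simp
        qed (use Z in auto)
        also have "\<dots> \<le> (\<Sum>z\<in>Z0 - ?B. conn ?B ?w x y * ?w {y, z})"
          using finZ0 w0 by (intro sum_mono2) (auto intro!: mult_nonneg_nonneg conn_nonneg)
        finally show "(\<Sum>z\<in>Z - ?B. conn ?B ?w x y * ?w {y, z}) \<le> (\<Sum>z\<in>Z0 - ?B. conn ?B ?w x y * ?w {y, z})" .
      qed
      then show ?thesis using x(2) by linarith
    qed
    define S where "S u = (+) (u - x) ` ?B" for u
    have Sd: "lnorm (a - u) \<le> ?d * real n" if "a \<in> S u" for a u
    proof -
      from that obtain y where y: "y \<in> ?B" "a = u - x + y" by (auto simp: S_def)
      have "a - u = y - x" using y by simp
      then show ?thesis using lnorm_lbox_diff[OF y(1) x(1)] by simp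
    qed
    have "sub_critical_blocks ?w S (\<lambda>x y. lnorm (y - x)) D (n ^ ?d)"
    proof
      show "lnorm (z - x) \<le> lnorm (y - x) + lnorm (z - y)" for x y z :: "int ^ 'd"
        using lnorm_triangle[of "y - x" "z - y"] by simp
      have rc: "0 \<le> r / c" using r const_pos by simp
      show "lnorm (a - u) < D" if "a \<in> S u" for a u using Sd[OF that] rc by (simp add: D_def)
      have "0 \<le> ?d * real n" by simp
      then show "0 < D" unfolding D_def using rc by linarith
      show "u \<in> S u" for u unfolding S_def by (rule image_eqI[of _ _ x]) (use x in auto)
      show "finite (S u)" for u by (simp add: S_def)
      show "card (S u) \<le> n ^ ?d" for u by (simp add: S_def card_image)
      show "?w {a, v} = 0" if "a \<in> S u" "v \<notin> S u" "D < lnorm (v - u)" for a u v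
      proof (rule Wr_range)
        show "a \<noteq> v" using that by auto
        have "lnorm (v - u) \<le> lnorm (a - u) + lnorm (a - v)"
          using lnorm_triangle[of "a - u" "v - a"] lnorm_minus[of a v] by simp
        then have "r / c < lnorm (a - v)" using Sd[OF that(1)] that(3) unfolding D_def by linarith
        then show "r < c * lnorm (a - v)" using const_pos by (simp add: field_simps)
      qed
      show "0 \<le> ?w e" for e by (rule w0)
      show "(\<Sum>a\<in>S u. \<Sum>v\<in>Z - S u. conn (S u) ?w u a * (1 - exp (- ?w {a, v}))) \<le> 1 / 2" if Z: "finite Z" for u Z
      proof -
        define s where "s = u - x"
        let ?Z = "(+) (- s) ` Z"
        have inj: "inj_on ((+) s) X" for X :: "(int ^ 'd) set" by simp
        have Zs: "Z - S u = (+) s ` (?Z - ?B)"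
        proof -
          have "Z = (+) s ` ?Z" by (simp add: image_image)
          then show ?thesis unfolding S_def s_def[symmetric] by (metis image_set_diff inj)
        qed
        have "(\<Sum>a\<in>S u. \<Sum>v\<in>Z - S u. conn (S u) ?w u a * (1 - exp (- ?w {a, v})))
          = (\<Sum>y\<in>?B. \<Sum>z\<in>?Z - ?B. conn (S u) ?w u (s + y) * (1 - exp (- ?w {s + y, s + z})))"
          unfolding Zs unfolding S_def s_def[symmetric] by (simp add: sum.reindex)
        also have "\<dots> = (\<Sum>y\<in>?B. \<Sum>z\<in>?Z - ?B. conn ?B ?w x y * (1 - exp (- ?w {y, z})))"
        proof (intro sum.cong refl)
          fix y z
          have "conn (S u) ?w u (s + y) = conn ?B ?w x y"
            using conn_translate[of ?w ?B s x y, OF Wr_translate finite_lbox] by (simp add: S_def s_def)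
          moreover have "?w {s + y, s + z} = ?w {y, z}" using Wr_translate[of r b s "{y, z}"] by simp
          ultimately show "conn (S u) ?w u (s + y) * (1 - exp (- ?w {s + y, s + z})) = conn ?B ?w x y * (1 - exp (- ?w {y, z}))"
            by simp
        qed
        also have "\<dots> \<le> (\<Sum>y\<in>?B. \<Sum>z\<in>?Z - ?B. conn ?B ?w x y * ?w {y, z})"
        proof (intro sum_mono mult_left_mono conn_nonneg w0)
          fix y z
          show "1 - exp (- ?w {y, z}) \<le> ?w {y, z}" using exp_ge_add_one_self[of "- ?w {y, z}"] by simp
        qed
        also have "\<dots> = flx x ?Z" by (simp add: flx_def)
        also have "\<dots> \<le> 1 / 2" using Z by (intro flx) auto
        finally show ?thesis .
      qed
    qed
    then show "\<exists>S D M. sub_critical_blocks ?w S (\<lambda>x y. lnorm (y - x)) D M \<and> D \<le> K * r" using D by blast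
  qed
qed

end

section \<open>Moments of the cluster\<close>

text \<open>Shells of width \<open>D\<close> match the distance gained per step of the Simon--Lieb
  iteration.\<close>

lemma le_sum_levels:
  fixes t D p :: real
  assumes "0 \<le> t" "0 < D" "0 < p" "t < real J * D"
  shows "t powr p \<le> (\<Sum>j<J. (real (Suc j) * D) powr p * of_bool (real j * D \<le> t))"
  using assms(4)
proof (induction J)
  case 0
  then show ?case using assms by simp
next
  case (Suc J)
  let ?s = "\<Sum>j<J. (real (Suc j) * D) powr p * of_bool (real j * D \<le> t)"
  show ?case
  proof (cases "t < real J * D")
    case True
    have "t powr p \<le> ?s" by (rule Suc.IH[OF True])
    also have "\<dots> \<le> (\<Sum>j<Suc J. (real (Suc j) * D) powr p * of_bool (real j * D \<le> t))" by simp
    finally show ?thesis .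
  next
    case False
    have "t powr p \<le> (real (Suc J) * D) powr p" using Suc.prems assms by (intro powr_mono2) auto
    moreover have "0 \<le> ?s" by (intro sum_nonneg) auto
    ultimately show ?thesis using False by simp
  qed
qed

lemma summable_powr_geometric: "summable (\<lambda>j. real (Suc j) powr p / 2 ^ j)" if "0 < p"
proof -
  have "(\<lambda>j. (1 + inverse (real (Suc j))) powr p) \<longlonglongrightarrow> (1 + 0) powr p"
    by (intro tendsto_powr tendsto_add tendsto_const LIMSEQ_inverse_real_of_nat) auto
  then have "eventually (\<lambda>j. (1 + inverse (real (Suc j))) powr p < 3 / 2) sequentially"
    by (rule order_tendstoD) simp
  then obtain n0 where n0: "\<And>j. j \<ge> n0 \<Longrightarrow> (1 + inverse (real (Suc j))) powr p < 3 / 2"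
    by (auto simp: eventually_sequentially)
  show ?thesis
  proof (rule summable_ratio_test[where c = "3 / 4" and N = n0])
    fix j assume j: "n0 \<le> j"
    have "real (Suc (Suc j)) = (1 + inverse (real (Suc j))) * real (Suc j)" by (simp add: field_simps)
    then have "real (Suc (Suc j)) powr p = (1 + inverse (real (Suc j))) powr p * real (Suc j) powr p"
      by (simp only:) (rule powr_mult)
    also have "\<dots> \<le> 3 / 2 * real (Suc j) powr p"
      using n0[OF j] by (intro mult_right_mono) auto
    finally have "real (Suc (Suc j)) powr p / 2 ^ Suc j \<le> 3 / 2 * real (Suc j) powr p / 2 ^ Suc j"
      by (rule divide_right_mono) simp
    then show "norm (real (Suc (Suc j)) powr p / 2 ^ Suc j) \<le> 3 / 4 * norm (real (Suc j) powr p / 2 ^ j)"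
      by (simp add: field_simps)
  qed simp
qed

text \<open>The tail at distance \<open>j * D\<close> is at most \<open>\<chi>0 / 2 ^ j\<close>,
  where \<open>\<chi>0\<close> is the expected cluster size itself. It cancels in the quotient, and
  the bound depends on \<open>p\<close> and \<open>D\<close> alone; the block size \<open>M\<close>
  only ensures that \<open>\<chi>0\<close> is finite.\<close>

lemma gyration_radius_bound:
  fixes k :: "int ^ 'd \<Rightarrow> int ^ 'd \<Rightarrow> real"
  assumes blocks: "sub_critical_blocks (pweight k \<beta>) S (\<lambda>x y. lnorm (y - x)) D M"
    and inv: "\<And>v e. pweight k \<beta> ((+) v ` e) = pweight k \<beta> e" and p: "0 < p"
  shows "gyration_radius k \<beta> p \<le> ennreal ((\<Sum>j. real (Suc j) powr p / 2 ^ j) powr (1 / p) * D)"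
proof -
  interpret sub_critical_blocks "pweight k \<beta>" S "\<lambda>x y. lnorm (y - x)" D M by (rule blocks)
  let ?w = "pweight k \<beta>"
  define \<sigma> where "\<sigma> R = (\<Sum>x\<in>cube R. conn (cube R) ?w 0 x)" for R
  define \<chi>0 where "\<chi>0 = (SUP R. \<sigma> R)"
  have \<sigma>M: "\<sigma> R \<le> 2 * real M" for R unfolding \<sigma>_def by (rule sum_conn_bound) auto
  have bdd: "bdd_above (range \<sigma>)" using \<sigma>M by (auto intro: bdd_aboveI[of _ "2 * real M"])
  have \<sigma>: "\<sigma> R \<le> \<chi>0" for R unfolding \<chi>0_def by (rule cSUP_upper[OF _ bdd]) simp
  have size: "expected_cluster_size k \<beta> = ennreal \<chi>0"
  proof -
    have "expected_cluster_size k \<beta> = (SUP R. ennreal (\<sigma> R))"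
      unfolding \<sigma>_def by (rule expected_cluster_size_eq[OF w_nonneg])
    also have "\<dots> = ennreal \<chi>0"
    proof (rule antisym)
      show "(SUP R. ennreal (\<sigma> R)) \<le> ennreal \<chi>0" using \<sigma> by (intro SUP_least ennreal_leI)
      then obtain t where t: "0 \<le> t" "(SUP R. ennreal (\<sigma> R)) = ennreal t"
        by (cases "SUP R. ennreal (\<sigma> R)") (auto simp: top_unique)
      have "\<sigma> R \<le> t" for R
      proof -
        have "ennreal (\<sigma> R) \<le> ennreal t" unfolding t(2)[symmetric] by (rule SUP_upper) simp
        then show ?thesis using t(1) by (simp add: ennreal_le_iff)
      qed
      then have "\<chi>0 \<le> t" unfolding \<chi>0_def by (intro cSUP_least) auto
      then show "ennreal \<chi>0 \<le> (SUP R. ennreal (\<sigma> R))" unfolding t(2) by (rule ennreal_leI)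
    qed
    finally show ?thesis .
  qed
  have "0 \<le> \<sigma> 0" unfolding \<sigma>_def by (intro sum_nonneg conn_nn)
  then have \<chi>0: "0 \<le> \<chi>0" using \<sigma>[of 0] by linarith
  have \<chi>0': "1 \<le> \<chi>0"
  proof -
    have "1 = conn (cube 0) ?w 0 0" by (simp add: conn_def)
    also have "\<dots> \<le> \<sigma> 0" unfolding \<sigma>_def using conn_nn by (intro member_le_sum) auto
    finally show ?thesis using \<sigma>[of 0] by linarith
  qed
  \<comment> \<open>Moving \<open>u\<close> to the origin carries the cube into a larger one, so the
    single constant \<open>\<chi>0\<close> serves all starting points, as
    \<open>sum_conn_far\<close> requires.\<close>
  have all: "(\<Sum>x\<in>cube R. conn (cube R) ?w u x) \<le> \<chi>0" if u: "u \<in> cube R" for u R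
  proof -
    have fin: "finite ((+) (- u) ` cube R)" by simp
    obtain R' where R': "(+) (- u) ` cube R \<subseteq> cube R'" by (rule finite_subset_cube[OF fin])
    have "(\<Sum>x\<in>cube R. conn (cube R) ?w u x) = (\<Sum>x\<in>cube R. conn ((+) (- u) ` cube R) ?w (- u + u) (- u + x))"
      by (subst conn_translate[OF inv finite_cube]) (rule refl)
    also have "\<dots> \<le> (\<Sum>x\<in>cube R. conn (cube R') ?w 0 (- u + x))"
      unfolding add.left_inverse using R' w_nonneg by (intro sum_mono conn_mono) auto
    also have "\<dots> = (\<Sum>x\<in>(+) (- u) ` cube R. conn (cube R') ?w 0 x)" by (subst sum.reindex) auto
    also have "\<dots> \<le> \<sigma> R'" unfolding \<sigma>_def using R' conn_nn by (intro sum_mono2) auto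
    finally show ?thesis using \<sigma>[of R'] by linarith
  qed
  define Q where "Q = (\<Sum>j. real (Suc j) powr p / 2 ^ j)"
  have Q0: "0 \<le> Q" unfolding Q_def by (intro suminf_nonneg summable_powr_geometric p) auto
  have mom: "(\<Sum>x\<in>cube R. lnorm x powr p * conn (cube R) ?w 0 x) \<le> Q * D powr p * \<chi>0" for R
  proof -
    let ?c = "\<lambda>x. conn (cube R) ?w 0 x"
    \<comment> \<open>\<open>J\<close> shells cover the cube; it depends on \<open>R\<close>, but
      the partial sums below are bounded by the convergent series \<open>Q\<close>.\<close>
    obtain J :: nat where J: "(\<Sum>x\<in>(cube R :: (int ^ 'd) set). lnorm x) < real J * D"
      using reals_Archimedean3[OF D] by blast
    have "(\<Sum>x\<in>cube R. lnorm x powr p * ?c x)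
       \<le> (\<Sum>x\<in>cube R. (\<Sum>j<J. (real (Suc j) * D) powr p * of_bool (real j * D \<le> lnorm x)) * ?c x)"
    proof (intro sum_mono mult_right_mono conn_nn le_sum_levels lnorm_nonneg D p)
      fix x :: "int ^ 'd" assume "x \<in> cube R"
      then have "lnorm x \<le> (\<Sum>x\<in>(cube R :: (int ^ 'd) set). lnorm x)"
        by (intro member_le_sum) (auto simp: lnorm_nonneg)
      then show "lnorm x < real J * D" using J by linarith
    qed
    also have "\<dots> = (\<Sum>j<J. (real (Suc j) * D) powr p * (\<Sum>x\<in>cube R. of_bool (real j * D \<le> lnorm x) * ?c x))"
      unfolding sum_distrib_right sum_distrib_left by (subst sum.swap) (simp add: mult.assoc)
    also have "\<dots> \<le> (\<Sum>j<J. (real (Suc j) * D) powr p * (\<chi>0 / 2 ^ j))"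
    proof (intro sum_mono mult_left_mono)
      fix j
      have "(\<Sum>x\<in>cube R. of_bool (real j * D \<le> lnorm x) * ?c x) = (\<Sum>x | x \<in> cube R \<and> real j * D \<le> lnorm (x - 0). ?c x)"
        by (intro sum.mono_neutral_cong_right) auto
      also have "\<dots> \<le> \<chi>0 / 2 ^ j" using all by (intro sum_conn_far) auto
      finally show "(\<Sum>x\<in>cube R. of_bool (real j * D \<le> lnorm x) * ?c x) \<le> \<chi>0 / 2 ^ j" .
    qed simp
    also have "\<dots> = D powr p * \<chi>0 * (\<Sum>j<J. real (Suc j) powr p / 2 ^ j)"
      unfolding sum_distrib_left using D by (intro sum.cong refl) (simp add: powr_mult)
    also have "\<dots> \<le> D powr p * \<chi>0 * Q"
      unfolding Q_def using \<chi>0 summable_powr_geometric[OF p] by (intro mult_left_mono sum_le_suminf) auto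
    finally show ?thesis by (simp add: mult_ac)
  qed
  have moment: "expected_cluster_moment k \<beta> p \<le> ennreal (Q * D powr p * \<chi>0)"
    unfolding expected_cluster_moment_def lnorm_def[symmetric]
    by (subst nn_integral_cluster[OF w_nonneg]) (auto intro!: SUP_least ennreal_leI mom)
  have fin: "expected_cluster_size k \<beta> \<noteq> \<infinity>" "expected_cluster_moment k \<beta> p \<noteq> \<infinity>"
    using size moment by (auto simp: top_unique)
  have m: "enn2real (expected_cluster_moment k \<beta> p) \<le> Q * D powr p * \<chi>0"
    by (rule enn2real_leI[OF _ moment]) (use Q0 \<chi>0 in auto)
  have "enn2real (expected_cluster_moment k \<beta> p) / enn2real (expected_cluster_size k \<beta>) \<le> Q * D powr p"
    using m \<chi>0' by (simp add: size field_simps)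
  then have "(enn2real (expected_cluster_moment k \<beta> p) / enn2real (expected_cluster_size k \<beta>)) powr (1 / p)
      \<le> (Q * D powr p) powr (1 / p)"
    using p by (intro powr_mono2) auto
  also have "\<dots> = Q powr (1 / p) * D" using Q0 D p by (simp add: powr_mult powr_powr)
  finally show ?thesis using fin by (simp add: gyration_radius_def Q_def ennreal_leI)
qed

theorem mainTheorem4:
  fixes \<alpha> :: real and N :: "real ^ 'd \<Rightarrow> real" and J :: "real \<Rightarrow> real"
  assumes "0 < \<alpha>"
    and "is_norm N"
    and "admissible_kernel CARD('d) \<alpha> J"
    and "\<alpha> < 1"
  shows "correlation_length_condition N J"
proof -
  obtain c q C where "power_law_weights (pweight (lattice_kernel N J)) (\<lambda>r. pweight (cutoff_kernel N J r)) \<alpha> c q C"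
    by (rule power_law_weights_kernels[OF assms(1,4,2,3)])
  then interpret power_law_weights "pweight (lattice_kernel N J)" "\<lambda>r. pweight (cutoff_kernel N J r)" \<alpha> c q C .
  define \<beta>c where "\<beta>c = critical_point (lattice_kernel N J)"
  have le: "\<beta>c \<le> ereal \<beta>" if "0 \<le> \<beta>" "large_clusters (pweight (lattice_kernel N J) \<beta>)" for \<beta>
    unfolding \<beta>c_def critical_point_def
    using that large_clusters_percolates[OF W_nonneg[OF that(1)] that(2)] by (intro Inf_lower) auto
  have ge: "0 \<le> \<beta>c"
    unfolding \<beta>c_def critical_point_def by (intro Inf_greatest) auto
  obtain \<beta>0 where "0 \<le> \<beta>0" "large_clusters (pweight (lattice_kernel N J) \<beta>0)"
    using large_clusters_at_large_parameter by blast
  from le[OF this] have lt: "\<beta>c < \<infinity>" by auto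
  define b where "b = real_of_ereal \<beta>c"
  have b: "\<beta>c = ereal b" "0 \<le> b" using ge lt by (cases \<beta>c; simp add: b_def)+
  \<comment> \<open>Large clusters below the infimum would percolate there, contradicting
    \<open>le\<close>.\<close>
  have below: "\<forall>\<beta>\<in>{0..<b}. \<not> large_clusters (pweight (lattice_kernel N J) \<beta>)"
    using le by (auto simp: b(1)) (meson not_less)
  obtain K where K: "0 < K" "\<And>r. 1 \<le> r \<Longrightarrow>
     \<exists>S D M. sub_critical_blocks (pweight (cutoff_kernel N J r) b) S (\<lambda>x y. lnorm (y - x)) D M \<and> D \<le> K * r"
    by (rule blocks_exist[OF b(2) below]) (rule that)
  have "\<exists>C. \<forall>r\<ge>1. gyration_radius (cutoff_kernel N J r) b p \<le> ennreal (C * r)" if p: "0 < p" for p :: real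
  proof (intro exI[of _ "(\<Sum>j. real (Suc j) powr p / 2 ^ j) powr (1 / p) * K"] allI impI)
    fix r :: real assume r: "1 \<le> r"
    from K(2)[OF r] obtain S D M where
      S: "sub_critical_blocks (pweight (cutoff_kernel N J r) b) S (\<lambda>x y. lnorm (y - x)) D M" and D: "D \<le> K * r" by blast
    let ?Q = "(\<Sum>j. real (Suc j) powr p / 2 ^ j) powr (1 / p)"
    have "gyration_radius (cutoff_kernel N J r) b p \<le> ennreal (?Q * D)"
      by (rule gyration_radius_bound[OF S _ p]) (rule Wr_translate)
    also have "\<dots> \<le> ennreal (?Q * K * r)"
      using D unfolding mult.assoc by (intro ennreal_leI mult_left_mono) auto
    finally show "gyration_radius (cutoff_kernel N J r) b p \<le> ennreal (?Q * K * r)" .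
  qed
  then show ?thesis
    using lt by (simp add: correlation_length_condition_def Let_def \<beta>c_def[symmetric] b_def[symmetric])
qed

end
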